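(* Let $r$ be a prime power. Let $(D_i^j)_{i,j=1}^r$, $D_i^j\subseteq\mathcal{C}_3$, be a matrix of closed, covering and equivariant preferences on the configuration space $\mathcal{C}_3=[r]^{*r}$. Then there exists an envy-free division: $$\bigcap_{i\in[r]} D_i^i\neq\emptyset .$$ In other words, there exist a cut of $[0,1]$ into $r$ (possibly degenerate) tiles and an allocation of the non-degenerate tiles into the $r$ boxes such that player $j$ prefers box $j$ for all $j\in[r]$.
   Context: Notation: $[r]=\{1,\dots,r\}$. A cut of $[0,1]$ by $r-1$ cut-points $0\le x_1\le\dots\le x_{r-1}\le 1$ (with $x_0=0$, $x_r=1$) produces tiles $I_t=[x_{t-1},x_t]$, $t\in[r]$, and is recorded by the vector of lengths $z=(z_1,\dots,z_r)$, $z_t=x_t-x_{t-1}$, a point of the standard simplex $\Delta^{r-1}$. Tile $t$ is degenerate if $z_t=0$. Configuration space $\mathcal{C}_3=[r]^{*r}$: the $r$-fold join of the $0$-dimensional complex $[r]$, i.e. the (geometric realization of the) simplicial complex with vertices $v_{t,b}$, $t\in[r]$ (tile), $b\in[r]$ (box), in which a set $S$ of vertices is a simplex iff for each tile $t$ at most one vertex $v_{t,b}$ lies in $S$. A point of $\mathcal{C}_3$ has the form $\sum_t z_t v_{t,\alpha(t)}$, the sum over tiles with $z_t>0$, and is written $(z,\alpha)$: it consists of a cut $z\in\Delta^{r-1}$ together with an arbitrary allocation $\alpha$ of its non-degenerate tiles to boxes (degenerate tiles are not allocated; a box may be empty or contain several tiles). The symmetric group $S_r$ acts on $\mathcal{C}_3$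 by renumbering the boxes: $\sigma(z,\alpha)=(z,\sigma\circ\alpha)$. A matrix $(D_i^j)_{i,j=1}^r$ of subsets of $\mathcal{C}_3$ is interpreted as preferences of $r$ players: $(z,\alpha)\in D_i^j$ means that player $j$ prefers the content of box $i$. The preferences are closed if every $D_i^j$ is a closed subset of $\mathcal{C}_3$; covering if $\bigcup_{i=1}^r D_i^j=\mathcal{C}_3$ for every $j$; equivariant if for all $\sigma\in S_r$, all $i,j\in[r]$ and all $(z,\alpha)\in\mathcal{C}_3$: $(z,\alpha)\in D_i^j\Leftrightarrow\sigma(z,\alpha)\in D_{\sigma(i)}^j$. *)

theory Defs
  imports
    "HOL-Analysis.Analysis"
    "HOL-Number_Theory.Prime_Powers"
    "HOL-Combinatorics.Permutations"
begin

text \<open>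
  Points are given by their barycentric coordinates. The function space carries the product
  topology, so for a finite complex this subspace has the usual Euclidean topology.
  The sum condition forces the support to be finite.
\<close>

definition geometric_realization :: "'v set set \<Rightarrow> ('v \<Rightarrow> real) set" where
  "geometric_realization K =
     {w. (\<forall>v. 0 \<le> w v) \<and> {v. w v \<noteq> 0} \<in> K \<and> (\<Sum>v | w v \<noteq> 0. w v) = 1}"

text \<open>The vertex $v_{t,b}$ (tile $t$, box $b$) is the pair \<open>(t, b)\<close>.\<close>

definition join_complex :: "nat \<Rightarrow> (nat \<times> nat) set set" where
  "join_complex r =
     {S. S \<subseteq> {1..r} \<times> {1..r} \<and> (\<forall>t b b'. (t, b) \<in> S \<longrightarrow> (t, b') \<in> S \<longrightarrow> b = b')}"

definition C3 :: "nat \<Rightarrow> (nat \<times> nat \<Rightarrow> real) set" where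
  "C3 r = geometric_realization (join_complex r)"

text \<open>
  The point $(z, \alpha) = \sum_t z_t v_{t,\alpha(t)}$. The value of \<open>\<alpha>\<close> on degenerate tiles
  does not influence it.
\<close>

definition config_point :: "nat \<Rightarrow> (nat \<Rightarrow> real) \<Rightarrow> (nat \<Rightarrow> nat) \<Rightarrow> (nat \<times> nat \<Rightarrow> real)" where
  "config_point r z \<alpha> = (\<lambda>(t, b). if t \<in> {1..r} \<and> b = \<alpha> t then z t else 0)"

definition box_action :: "(nat \<Rightarrow> nat) \<Rightarrow> (nat \<times> nat \<Rightarrow> real) \<Rightarrow> (nat \<times> nat \<Rightarrow> real)" where
  "box_action \<sigma> w = (\<lambda>(t, b). w (t, inv \<sigma> b))"

text \<open>In the following, \<open>D i j\<close> is $D_i^j$: player \<open>j\<close> prefers box \<open>i\<close>.\<close>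

definition closed_preferences ::
  "nat \<Rightarrow> (nat \<Rightarrow> nat \<Rightarrow> (nat \<times> nat \<Rightarrow> real) set) \<Rightarrow> bool" where
  "closed_preferences r D \<longleftrightarrow>
     (\<forall>i\<in>{1..r}. \<forall>j\<in>{1..r}. closedin (top_of_set (C3 r)) (D i j))"

definition covering_preferences ::
  "nat \<Rightarrow> (nat \<Rightarrow> nat \<Rightarrow> (nat \<times> nat \<Rightarrow> real) set) \<Rightarrow> bool" where
  "covering_preferences r D \<longleftrightarrow> (\<forall>j\<in>{1..r}. (\<Union>i\<in>{1..r}. D i j) = C3 r)"

definition equivariant_preferences ::
  "nat \<Rightarrow> (nat \<Rightarrow> nat \<Rightarrow> (nat \<times> nat \<Rightarrow> real) set) \<Rightarrow> bool" where
  "equivariant_preferences r D \<longleftrightarrow>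
     (\<forall>\<sigma>. \<sigma> permutes {1..r} \<longrightarrow>
        (\<forall>i\<in>{1..r}. \<forall>j\<in>{1..r}. \<forall>w\<in>C3 r. w \<in> D i j \<longleftrightarrow> box_action \<sigma> w \<in> D (\<sigma> i) j))"

definition is_cut :: "nat \<Rightarrow> (nat \<Rightarrow> real) \<Rightarrow> bool" where
  "is_cut r x \<longleftrightarrow> x 0 = 0 \<and> x r = 1 \<and> (\<forall>t\<in>{1..r}. x (t - 1) \<le> x t)"

definition tile_length :: "(nat \<Rightarrow> real) \<Rightarrow> nat \<Rightarrow> real" where
  "tile_length x t = x t - x (t - 1)"

definition is_allocation :: "nat \<Rightarrow> (nat \<Rightarrow> real) \<Rightarrow> (nat \<Rightarrow> nat) \<Rightarrow> bool" where
  "is_allocation r z \<alpha> \<longleftrightarrow> (\<forall>t\<in>{1..r}. z t > 0 \<longrightarrow> \<alpha> t \<in> {1..r})"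

lemma box_action_config_point:
  assumes "\<sigma> permutes {1..r}"
  shows "box_action \<sigma> (config_point r z \<alpha>) = config_point r z (\<sigma> \<circ> \<alpha>)"
  using permutes_inv_eq[OF assms]
  by (auto simp: box_action_def config_point_def fun_eq_iff)

lemma sum_tile_length: "(\<Sum>t\<in>{1..n}. tile_length x t) = x n - x 0"
  by (induction n) (auto simp: tile_length_def)

lemma config_point_in_C3:
  assumes z: "\<And>t. t \<in> {1..r} \<Longrightarrow> 0 \<le> z t" "(\<Sum>t\<in>{1..r}. z t) = 1"
    and \<alpha>: "is_allocation r z \<alpha>"
  shows "config_point r z \<alpha> \<in> C3 r"
proof -
  let ?w = "config_point r z \<alpha>" and ?T = "{t\<in>{1..r}. z t \<noteq> 0}"
  have supp: "{v. ?w v \<noteq> 0} = (\<lambda>t. (t, \<alpha> t)) ` ?T"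
    by (auto simp: config_point_def split: if_splits)
  have "(\<Sum>v | ?w v \<noteq> 0. ?w v) = (\<Sum>t\<in>?T. z t)"
    unfolding supp by (subst sum.reindex) (auto simp: inj_on_def config_point_def intro!: sum.cong)
  also have "\<dots> = 1"
    using z(2) by (subst sum.mono_neutral_left[of "{1..r}"]) auto
  finally have "(\<Sum>v | ?w v \<noteq> 0. ?w v) = 1" .
  moreover have "\<alpha> t \<in> {1..r}" if "t \<in> ?T" for t
    using that z(1)[of t] \<alpha> unfolding is_allocation_def by force
  then have "{v. ?w v \<noteq> 0} \<in> join_complex r"
    unfolding supp join_complex_def by auto
  moreover have "0 \<le> ?w v" for v
    using z(1) by (auto simp: config_point_def split: prod.splits)
  ultimately show ?thesis
    by (simp add: C3_def geometric_realization_def)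
qed

lemma C3_eq_cuts_with_allocations:
  "C3 r = {config_point r (tile_length x) \<alpha> | x \<alpha>.
             is_cut r x \<and> is_allocation r (tile_length x) \<alpha>}" (is "_ = ?R")
proof (intro equalityI subsetI)
  fix w assume "w \<in> ?R"
  then obtain x \<alpha> where x: "w = config_point r (tile_length x) \<alpha>" "is_cut r x"
    "is_allocation r (tile_length x) \<alpha>" by blast
  then show "w \<in> C3 r"
    using sum_tile_length[of x r]
    by (auto simp: is_cut_def tile_length_def intro!: config_point_in_C3)
next
  fix w assume "w \<in> C3 r"
  then have nonneg: "\<And>v. 0 \<le> w v" and S: "{v. w v \<noteq> 0} \<in> join_complex r"
    and sum1: "(\<Sum>v | w v \<noteq> 0. w v) = 1"
    by (auto simp: C3_def geometric_realization_def)
  define \<alpha> where "\<alpha> t = (if \<exists>b. w (t, b) \<noteq> 0 then THE b. w (t, b) \<noteq> 0 else 1)" for t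
  define z where "z t = w (t, \<alpha> t)" for t
  define x where "x n = (\<Sum>t\<in>{1..n}. z t)" for n
  have \<alpha>: "\<alpha> t = b" if "w (t, b) \<noteq> 0" for t b
  proof -
    have "b' = b" if "w (t, b') \<noteq> 0" for b'
      using S that \<open>w (t, b) \<noteq> 0\<close> by (auto simp: join_complex_def)
    with that have "(THE b. w (t, b) \<noteq> 0) = b" by (rule the_equality)
    moreover have "\<exists>b. w (t, b) \<noteq> 0" using that by blast
    ultimately show ?thesis by (simp add: \<alpha>_def)
  qed
  have sub: "t \<in> {1..r} \<and> b \<in> {1..r}" if "w (t, b) \<noteq> 0" for t b
    using S that by (auto simp: join_complex_def)
  have z: "tile_length x t = z t" if "t \<in> {1..r}" for t
    using that by (cases t) (auto simp: tile_length_def x_def)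
  have w: "w = config_point r (tile_length x) \<alpha>"
  proof
    fix v :: "nat \<times> nat"
    obtain t b where v: "v = (t, b)" by fastforce
    show "w v = config_point r (tile_length x) \<alpha> v"
    proof (cases "w (t, b) = 0")
      case True
      then show ?thesis using z[of t] by (auto simp: v config_point_def z_def)
    next
      case False
      then show ?thesis using z[of t] \<alpha>[of t b] sub[of t b]
        by (auto simp: v config_point_def z_def)
    qed
  qed
  have supp: "{v. w v \<noteq> 0} = (\<lambda>t. (t, \<alpha> t)) ` {t\<in>{1..r}. z t \<noteq> 0}"
  proof (intro equalityI subsetI)
    fix v assume v: "v \<in> {v. w v \<noteq> 0}"
    obtain t b where tb: "v = (t, b)" by fastforce
    show "v \<in> (\<lambda>t. (t, \<alpha> t)) ` {t\<in>{1..r}. z t \<noteq> 0}"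
      using v \<alpha>[of t b] sub[of t b] unfolding tb z_def by (intro image_eqI[of _ _ t]) auto
  qed (auto simp: z_def)
  have "(\<Sum>t\<in>{1..r}. z t) = (\<Sum>t\<in>{t\<in>{1..r}. z t \<noteq> 0}. z t)"
    by (rule sum.mono_neutral_right) auto
  also have "\<dots> = (\<Sum>v | w v \<noteq> 0. w v)"
    unfolding supp by (subst sum.reindex) (auto simp: inj_on_def z_def)
  finally have "x r = 1" using sum1 by (simp add: x_def)
  moreover have "x (t - 1) \<le> x t" if "t \<in> {1..r}" for t
  proof -
    have "0 \<le> tile_length x t"
      unfolding z[OF that] z_def by (rule nonneg)
    then show ?thesis by (simp add: tile_length_def)
  qed
  moreover have "x 0 = 0" by (simp add: x_def)
  ultimately have "is_cut r x" unfolding is_cut_def by blast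
  moreover have "is_allocation r (tile_length x) \<alpha>"
    unfolding is_allocation_def
  proof (intro ballI impI)
    fix t assume "t \<in> {1..r}" "0 < tile_length x t"
    then have "w (t, \<alpha> t) \<noteq> 0" using z[of t] by (simp add: z_def)
    then show "\<alpha> t \<in> {1..r}" using sub by blast
  qed
  ultimately show "w \<in> ?R" using w by blast
qed

end

theory Submission
  imports Defs "HOL-Number_Theory.Cong"
begin

text \<open>
  Let $r = p^n$ and let $G = (\mathbb{Z}/p)^n$ act on the $r$ boxes by translations; then $G$ acts
  freely on $\mathcal{C}_3$. Subdivide finely and let player $j$ own the barycentres of the cells of
  dimension $j - 1$, each of which $G$-equivariantly receives as label a box that its owner prefers.
  A flag of cells whose labels are pairwise different is an almost envy-free division up to a
  permutation of the boxes, which equivariance removes; compactness yields the theorem.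

  That such a flag exists is a Borsuk--Ulam type count. Weight the flags by the incidence numbers of
  a $G$-invariant chain that is a cycle modulo $p$. Because the sign of a map
  $m : [r] \to [r]$ (which is $0$ unless $m$ is a bijection) equals $\sum_i \mathrm{sgn}\, m(i := a)$
  for every $a$, and because the weights
  of the flags that differ in one place only cancel, the weighted number of fully labelled flags
  modulo $G$ does not depend modulo $p$ on the equivariant labelling. For one particular labelling
  the count is computed.

  The cycle comes from the tensor product of $n$ minimal resolutions of $\mathbb{Z}/p$, in
  multidegree $((p-1)p^{n-1}, \dots, (p-1)p, p-1)$. Its fully labelled flags are Hamiltonian paths
  on $G$ in which the direction of every step is forced to be the one of a Gray code: the $t$-th
  step changes the digit whose number is the $p$-adic valuation of $t$. For odd $p$ all of them are
  even permutations and their number is a power of $((p-1)/2)!$, which is not divisible by $p$;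
  for $p = 2$ there is one.
\<close>

section \<open>Counting fully labelled flags modulo $p$\<close>

text \<open>The abstract count \<open>weighted_flags\<close> is used twice. In the coarse instance
  the vertices of place i are the cells of degree i of the tensor product, each sent to the box
  given by its group element. So the join of these vertex sets maps equivariantly to
  \<open>C3\<close>, the flag weights form a cycle modulo p on it, and the count can be evaluated.
  In the fine instance that join is subdivided and labelled by the players. The obstacle is to
  relate the two counts, with signs and at any mesh. A join of finite sets is the outer boundary of
  a product of stars; dividing the legs into edges makes the product a cubical complex with a tensor
  product boundary, so a single parameter controls the mesh. There one labelling admits just one
  possibly full flag above each coarse flag, hence the counts agree up to a global sign. The
  multidegree leaves room for exactly the steps of a Gray code: (p-1)p^(n-1-k) of the numbers 1,
  ..., r-1 have valuation k. These add up to r-1, the dimension of \<open>C3\<close>, and are so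
  tight that a path through all of G has no other choice of directions.\<close>

definition sgn_map :: "nat \<Rightarrow> (nat \<Rightarrow> nat) \<Rightarrow> int" where
  "sgn_map r m = (if bij_betw m {..<r} {..<r} then sign_on {..<r} m else 0)"

lemma sgn_map_cong:
  assumes "\<And>i. i < r \<Longrightarrow> m i = m' i"
  shows "sgn_map r m = sgn_map r m'"
proof -
  have "bij_betw m {..<r} {..<r} \<longleftrightarrow> bij_betw m' {..<r} {..<r}"
    by (rule bij_betw_cong) (use assms in auto)
  moreover have "sign_on {..<r} m = sign_on {..<r} m'"
    by (rule sign_on_cong) (use assms in auto)
  ultimately show ?thesis by (simp add: sgn_map_def)
qed

lemma sgn_map_eq_0: "\<not> inj_on m {..<r} \<Longrightarrow> sgn_map r m = 0"
  by (auto simp: sgn_map_def bij_betw_def)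

lemma sgn_map_comp:
  assumes g: "bij_betw g {..<r} {..<r}" and m: "m ` {..<r} \<subseteq> {..<r}"
  shows "sgn_map r (\<lambda>i. g (m i)) = sign_on {..<r} g * sgn_map r m"
proof (cases "bij_betw m {..<r} {..<r}")
  case True
  then have "bij_betw (g \<circ> m) {..<r} {..<r}"
    using g bij_betw_trans by blast
  with True show ?thesis
    using sign_on_compose[OF g True] by (simp add: sgn_map_def o_def)
next
  case False
  then have "\<not> inj_on m {..<r}"
    using m by (metis bij_betw_imageI endo_inj_surj finite_lessThan)
  then have "\<not> inj_on (\<lambda>i. g (m i)) {..<r}"
    unfolding inj_on_def by metis
  with False show ?thesis
    by (auto simp: sgn_map_def bij_betw_def)
qed

lemma sgn_map_transpose:
  assumes "i < r" "j < r" "i \<noteq> j"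
  shows "sgn_map r (m \<circ> Transposition.transpose i j) = - sgn_map r m"
proof -
  have t: "bij_betw (Transposition.transpose i j) {..<r} {..<r}"
    using assms by (intro permutes_imp_bij permutes_swap_id) auto
  have "bij_betw (m \<circ> Transposition.transpose i j) {..<r} {..<r} \<longleftrightarrow> bij_betw m {..<r} {..<r}"
    using bij_betw_comp_iff[OF t] by metis
  moreover have "sign_on {..<r} (m \<circ> Transposition.transpose i j) = - sign_on {..<r} m"
    if "bij_betw m {..<r} {..<r}"
    using sign_on_compose[OF that t] sign_on_transpose[of i "{..<r}" j] assms by simp
  ultimately show ?thesis by (auto simp: sgn_map_def)
qed

text \<open>If m is a bijection, only the place that already carries a survives. If m is not, an
  update can be bijective only when m misses a and takes one value twice. The two places sharing
  that value then give bijections that differ by a transposition and cancel; updating any other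
  place leaves the repetition in place.\<close>

lemma sgn_map_expand:
  assumes m: "m ` {..<r} \<subseteq> {..<r}" and a: "a < r"
  shows "(\<Sum>i<r. sgn_map r (m(i := a))) = sgn_map r m"
proof (cases "bij_betw m {..<r} {..<r}")
  case True
  then obtain k where k: "k < r" "m k = a"
    using a unfolding bij_betw_def by (metis image_iff lessThan_iff)
  have "sgn_map r (m(i := a)) = 0" if "i < r" "i \<noteq> k" for i
    by (rule sgn_map_eq_0) (use that k in \<open>auto simp: inj_on_def\<close>)
  then have "(\<Sum>i<r. sgn_map r (m(i := a))) = (\<Sum>i\<in>{k}. sgn_map r (m(i := a)))"
    using k by (intro sum.mono_neutral_right) auto
  with k show ?thesis
    by (simp add: fun_upd_idem)
next
  case False
  then have m0: "sgn_map r m = 0" by (simp add: sgn_map_def)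
  show ?thesis
  proof (cases "\<forall>i<r. sgn_map r (m(i := a)) = 0")
    case True
    with m0 show ?thesis by simp
  next
    case False
    then obtain i where i: "i < r" "sgn_map r (m(i := a)) \<noteq> 0" by blast
    then have bij: "bij_betw (m(i := a)) {..<r} {..<r}"
      by (auto simp: sgn_map_def split: if_splits)
    have "m i \<noteq> a"
      using i m0 by (metis fun_upd_triv)
    moreover have "m i < r" using m i by auto
    then obtain j where j: "j < r" "(m(i := a)) j = m i"
      using bij unfolding bij_betw_def by (metis image_iff lessThan_iff)
    ultimately have ij: "j \<noteq> i" "m j = m i" by (auto split: if_splits)
    have "sgn_map r (m(k := a)) = 0" if "k < r" "k \<noteq> i" "k \<noteq> j" for k
      by (rule sgn_map_eq_0) (use that ij i j in \<open>auto simp: inj_on_def\<close>)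
    then have "(\<Sum>k<r. sgn_map r (m(k := a))) = (\<Sum>k\<in>{i, j}. sgn_map r (m(k := a)))"
      using i j by (intro sum.mono_neutral_right) auto
    also have "\<dots> = sgn_map r (m(i := a)) + sgn_map r (m(j := a))"
      using ij by simp
    also have "m(j := a) = m(i := a) \<circ> Transposition.transpose i j"
      using ij by (auto simp: fun_eq_iff Transposition.transpose_def)
    finally show ?thesis
      using sgn_map_transpose[of i r j "m(i := a)"] i j ij m0 by (simp del: fun_upd_apply add: o_def)
  qed
qed

lemma sum_PiE_coordinate:
  assumes "i \<in> I"
  shows "(\<Sum>s\<in>PiE I V. g s) = (\<Sum>s\<in>PiE (I - {i}) V. \<Sum>x\<in>V i. g (s(i := x)))"
proof -
  have I: "I = insert i (I - {i})" using assms by blast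
  have "(\<Sum>s\<in>PiE I V. g s)
      = (\<Sum>s\<in>(\<lambda>(x, s). s(i := x)) ` (V i \<times> PiE (I - {i}) V). g s)"
    by (subst I, subst PiE_insert_eq) simp
  also have "\<dots> = (\<Sum>(x, s)\<in>V i \<times> PiE (I - {i}) V. g (s(i := x)))"
    by (subst sum.reindex[OF inj_combinator]) (auto simp: case_prod_unfold)
  also have "\<dots> = (\<Sum>x\<in>V i. \<Sum>s\<in>PiE (I - {i}) V. g (s(i := x)))"
    by (rule sum.cartesian_product[symmetric])
  also have "\<dots> = (\<Sum>s\<in>PiE (I - {i}) V. \<Sum>x\<in>V i. g (s(i := x)))"
    by (rule sum.swap)
  finally show ?thesis .
qed

text \<open>\<open>w_cycle\<close> says that w is a top-dimensional cycle modulo p on the join of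
  the sets V i. \<open>lab0\<close> is an equivariant labelling that serves both to select orbit
  representatives and as the reference for the count. \<open>sign_ad\<close> is asked only modulo p,
  since for p = 2 a translation can be an odd permutation.\<close>

locale weighted_flags =
  fixes r p :: nat
    and V :: "nat \<Rightarrow> 'v set"
    and w :: "(nat \<Rightarrow> 'v) \<Rightarrow> int"
    and ad :: "nat \<Rightarrow> nat \<Rightarrow> nat" and neg :: "nat \<Rightarrow> nat" and act :: "nat \<Rightarrow> 'v \<Rightarrow> 'v"
    and lab0 :: "nat \<Rightarrow> 'v \<Rightarrow> nat"
  assumes r_pos: "0 < r"
    and finite_V: "\<And>i. i < r \<Longrightarrow> finite (V i)"
    and bij_ad: "\<And>h. h < r \<Longrightarrow> bij_betw (ad h) {..<r} {..<r}"
    and sign_ad: "\<And>h. h < r \<Longrightarrow> [sign_on {..<r} (ad h) = 1] (mod int p)"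
    and transitive: "\<And>x. x < r \<Longrightarrow> \<exists>!h. h < r \<and> ad h x = 0"
    and bij_neg: "bij_betw neg {..<r} {..<r}"
    and act_in: "\<And>h i v. h < r \<Longrightarrow> i < r \<Longrightarrow> v \<in> V i \<Longrightarrow> act h v \<in> V i"
    and act_neg: "\<And>h i v. h < r \<Longrightarrow> i < r \<Longrightarrow> v \<in> V i \<Longrightarrow> act h (act (neg h) v) = v"
    and neg_act: "\<And>h i v. h < r \<Longrightarrow> i < r \<Longrightarrow> v \<in> V i \<Longrightarrow> act (neg h) (act h v) = v"
    and w_act: "\<And>h s. h < r \<Longrightarrow> s \<in> PiE {..<r} V \<Longrightarrow> w (\<lambda>i\<in>{..<r}. act h (s i)) = w s"
    and w_cycle: "\<And>s i. i < r \<Longrightarrow> s \<in> PiE {..<r} V \<Longrightarrow> int p dvd (\<Sum>x\<in>V i. w (s(i := x)))"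
    and lab0_lt: "\<And>i v. i < r \<Longrightarrow> v \<in> V i \<Longrightarrow> lab0 i v < r"
    and lab0_act: "\<And>h i v. h < r \<Longrightarrow> i < r \<Longrightarrow> v \<in> V i \<Longrightarrow> lab0 i (act h v) = ad h (lab0 i v)"
begin

definition equivariant :: "(nat \<Rightarrow> 'v \<Rightarrow> nat) \<Rightarrow> bool" where
  "equivariant l \<longleftrightarrow> (\<forall>i<r. \<forall>v\<in>V i. l i v < r \<and> (\<forall>h<r. l i (act h v) = ad h (l i v)))"

text \<open>The factor \<open>lab0 j (s j) = 0\<close> selects one flag from every orbit.\<close>

definition count :: "nat \<Rightarrow> (nat \<Rightarrow> 'v \<Rightarrow> nat) \<Rightarrow> int" where
  "count j l = (\<Sum>s\<in>PiE {..<r} V. of_bool (lab0 j (s j) = 0) * (w s * sgn_map r (\<lambda>i. l i (s i))))"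

lemma equivariant_lab0: "equivariant lab0"
  by (simp add: equivariant_def lab0_lt lab0_act)

lemma neg_lt: "h < r \<Longrightarrow> neg h < r"
  using bij_neg by (auto simp: bij_betw_def)

lemma representatives:
  assumes "i < r" "v \<in> V i"
  shows "(\<Sum>h<r. of_bool (lab0 i (act h v) = 0) :: int) = 1"
proof -
  obtain h where h: "h < r" "ad h (lab0 i v) = 0"
    and uniq: "\<And>h'. h' < r \<Longrightarrow> ad h' (lab0 i v) = 0 \<Longrightarrow> h' = h"
    using transitive[OF lab0_lt[OF assms]] by blast
  have "(\<Sum>h<r. of_bool (lab0 i (act h v) = 0) :: int) = (\<Sum>h'<r. of_bool (h' = h))"
    by (intro sum.cong refl arg_cong[where f = of_bool]) (metis lessThan_iff h uniq lab0_act assms)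
  with h show ?thesis by simp
qed

lemma sum_flags_act:
  assumes h: "h < r"
  shows "(\<Sum>s\<in>PiE {..<r} V. f (\<lambda>i\<in>{..<r}. act h (s i))) = (\<Sum>s\<in>PiE {..<r} V. f s)"
proof -
  have undo: "(\<lambda>i\<in>{..<r}. act (neg h) ((\<lambda>i\<in>{..<r}. act h (s i)) i)) = s"
    "(\<lambda>i\<in>{..<r}. act h ((\<lambda>i\<in>{..<r}. act (neg h) (s i)) i)) = s" if s: "s \<in> PiE {..<r} V" for s
    by (rule extensionalityI[of _ "{..<r}"]; use s h PiE_mem[OF s] act_neg[OF h] neg_act[OF h] in \<open>auto simp: PiE_iff\<close>)+
  have "bij_betw (\<lambda>s. \<lambda>i\<in>{..<r}. act h (s i)) (PiE {..<r} V) (PiE {..<r} V)"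
  proof (rule bij_betw_byWitness[where f' = "\<lambda>s. \<lambda>i\<in>{..<r}. act (neg h) (s i)"])
    show "(\<lambda>s. \<lambda>i\<in>{..<r}. act h (s i)) ` PiE {..<r} V \<subseteq> PiE {..<r} V"
      "(\<lambda>s. \<lambda>i\<in>{..<r}. act (neg h) (s i)) ` PiE {..<r} V \<subseteq> PiE {..<r} V"
      using act_in[OF h] act_in[OF neg_lt[OF h]] by (auto simp: PiE_iff)
  qed (use undo in auto)
  then show ?thesis by (rule sum.reindex_bij_betw)
qed

lemma sgn_act:
  assumes l: "equivariant l" and h: "h < r" and s: "s \<in> PiE {..<r} V"
  shows "[sgn_map r (\<lambda>i. l i ((\<lambda>i\<in>{..<r}. act h (s i)) i)) = sgn_map r (\<lambda>i. l i (s i))] (mod int p)"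
proof -
  have "sgn_map r (\<lambda>i. l i ((\<lambda>i\<in>{..<r}. act h (s i)) i)) = sgn_map r (\<lambda>i. ad h (l i (s i)))"
    by (rule sgn_map_cong) (use l h s in \<open>auto simp: equivariant_def\<close>)
  also have "\<dots> = sign_on {..<r} (ad h) * sgn_map r (\<lambda>i. l i (s i))"
    by (rule sgn_map_comp[OF bij_ad[OF h]]) (use l s in \<open>auto simp: equivariant_def\<close>)
  also have "[\<dots> = 1 * sgn_map r (\<lambda>i. l i (s i))] (mod int p)"
    by (intro cong_mult sign_ad h cong_refl)
  finally show ?thesis by simp
qed

text \<open>Double counting over orbits: insert the sum over h of the representative condition at j,
  which is 1, and replace s by its translate; then the condition at i is the one that is summed over
  h, to 1 again. Translating changes the sign of the labels, which is harmless modulo p.\<close>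

lemma count_cong_position:
  assumes l: "equivariant l" and i: "i < r" and j: "j < r"
  shows "[count i l = count j l] (mod int p)"
proof -
  define T where "T s = w s * sgn_map r (\<lambda>i. l i (s i))" for s
  define a :: "nat \<Rightarrow> (nat \<Rightarrow> 'v) \<Rightarrow> int" where "a k s = of_bool (lab0 k (s k) = 0)" for k s
  define g where "g h s = (\<lambda>i\<in>{..<r}. act h (s i))" for h s
  let ?S = "PiE {..<r} V"
  have T: "[T s = T (g h s)] (mod int p)" if "s \<in> ?S" "h < r" for s h
    unfolding T_def g_def using w_act[OF that(2,1)] cong_sym[OF sgn_act[OF l that(2,1)]]
    by (metis cong_scalar_left)
  have one: "(\<Sum>h<r. a k (g h s)) = 1" if "s \<in> ?S" "k < r" for s k
    unfolding a_def g_def using representatives[of k "s k"] that by (auto simp: restrict_def)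
  have one': "(\<Sum>h<r. a k (g (neg h) s)) = 1" if "s \<in> ?S" "k < r" for s k
    using sum.reindex_bij_betw[OF bij_neg, of "\<lambda>h. a k (g h s)"] one[OF that] by simp
  have undo: "a i (g (neg h) (g h s)) = a i s" if "s \<in> ?S" "h < r" for s h
    unfolding a_def g_def using that i neg_act[OF that(2) i] by (auto simp: PiE_iff)
  have reindex: "(\<Sum>s\<in>?S. f (g h s)) = (\<Sum>s\<in>?S. f s)" if "h < r" for h and f :: "(nat \<Rightarrow> 'v) \<Rightarrow> int"
    unfolding g_def by (rule sum_flags_act[OF that])
  have "count i l = (\<Sum>s\<in>?S. a i s * T s * (\<Sum>h<r. a j (g h s)))"
    unfolding count_def by (rule sum.cong) (use one j in \<open>auto simp: a_def T_def\<close>)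
  also have "\<dots> = (\<Sum>h<r. \<Sum>s\<in>?S. a i s * T s * a j (g h s))"
    unfolding sum_distrib_left by (rule sum.swap)
  \<comment> \<open>Every factor is expressed through \<open>g h s\<close>, so that the flag can be
    replaced by its translate in the sum.\<close>
  also have "[\<dots> = (\<Sum>h<r. \<Sum>s\<in>?S. a i (g (neg h) (g h s)) * T (g h s) * a j (g h s))] (mod int p)"
    by (intro cong_sum cong_mult) (use T undo in auto)
  also have "(\<Sum>h<r. \<Sum>s\<in>?S. a i (g (neg h) (g h s)) * T (g h s) * a j (g h s))
      = (\<Sum>h<r. \<Sum>s\<in>?S. a i (g (neg h) s) * T s * a j s)"
  proof (rule sum.cong[OF refl])
    fix h assume "h \<in> {..<r}"
    then show "(\<Sum>s\<in>?S. a i (g (neg h) (g h s)) * T (g h s) * a j (g h s))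
      = (\<Sum>s\<in>?S. a i (g (neg h) s) * T s * a j s)"
      by (intro reindex[of h "\<lambda>s. a i (g (neg h) s) * T s * a j s"]) simp
  qed
  also have "\<dots> = (\<Sum>s\<in>?S. (\<Sum>h<r. a i (g (neg h) s)) * (T s * a j s))"
    unfolding sum_distrib_right mult.assoc by (rule sum.swap)
  also have "\<dots> = count j l"
    unfolding count_def by (rule sum.cong) (use one' i in \<open>auto simp: a_def T_def\<close>)
  finally show ?thesis .
qed

text \<open>Expand the sign at the value 0. In the term of a place i other than j the sign no longer
  sees s i, so the sum over V i alone vanishes modulo p by \<open>w_cycle\<close>. The surviving
  term, that of place j, does not involve the label of v; this is why relabelling v has no
  effect.\<close>

lemma star_sum_cong:
  assumes j: "j < r" and v: "v \<in> V j" and l: "\<And>i v. i < r \<Longrightarrow> v \<in> V i \<Longrightarrow> l i v < r"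
  shows "[(\<Sum>s\<in>PiE {..<r} (V(j := {v})). w s * sgn_map r (\<lambda>i. l i (s i)))
        = (\<Sum>s\<in>PiE {..<r} (V(j := {v})). w s * sgn_map r ((\<lambda>i. l i (s i))(j := 0)))] (mod int p)"
proof -
  let ?S = "PiE {..<r} (V(j := {v}))"
  let ?m = "\<lambda>s i. l i (s i)"
  have sub: "s \<in> PiE {..<r} V" if "s \<in> ?S" for s
    using that v by (auto simp: PiE_iff Pi_iff split: if_splits)
  have vanish: "int p dvd (\<Sum>s\<in>?S. w s * sgn_map r ((?m s)(i := 0)))" if i: "i < r" "i \<noteq> j" for i
  proof -
    have "(\<Sum>s\<in>?S. w s * sgn_map r ((?m s)(i := 0)))
        = (\<Sum>s\<in>PiE ({..<r} - {i}) (V(j := {v})). \<Sum>x\<in>V i. w (s(i := x)) * sgn_map r ((?m (s(i := x)))(i := 0)))"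
      using i by (subst sum_PiE_coordinate[of i]) auto
    also have "\<dots> = (\<Sum>s\<in>PiE ({..<r} - {i}) (V(j := {v})). (\<Sum>x\<in>V i. w (s(i := x))) * sgn_map r ((?m s)(i := 0)))"
      unfolding sum_distrib_right
      by (intro sum.cong refl arg_cong2[of _ _ _ _ "(*)"] sgn_map_cong) auto
    also have "int p dvd \<dots>"
    proof (rule dvd_sum, rule dvd_mult2)
      fix s assume s: "s \<in> PiE ({..<r} - {i}) (V(j := {v}))"
      show "int p dvd (\<Sum>x\<in>V i. w (s(i := x)))"
      \<comment> \<open>\<open>w_cycle\<close> speaks of full flags: any y in V i completes s to
        one, and for empty V i the sum is 0.\<close>
      proof (cases "V i = {}")
        case False
        then obtain y where "y \<in> V i" by blast
        with s i v have "s(i := y) \<in> PiE {..<r} V"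
          by (auto simp: PiE_iff Pi_iff extensional_def split: if_splits)
        from w_cycle[OF i(1) this] show ?thesis by simp
      qed simp
    qed
    finally show ?thesis .
  qed
  define X where "X i = (\<Sum>s\<in>?S. w s * sgn_map r ((?m s)(i := 0)))" for i
  have "(\<Sum>s\<in>?S. w s * sgn_map r (?m s)) = (\<Sum>s\<in>?S. w s * (\<Sum>i<r. sgn_map r ((?m s)(i := 0))))"
  proof (rule sum.cong[OF refl])
    fix s assume "s \<in> ?S"
    then have "?m s ` {..<r} \<subseteq> {..<r}" using sub[of s] l by (auto simp: PiE_iff)
    then show "w s * sgn_map r (?m s) = w s * (\<Sum>i<r. sgn_map r ((?m s)(i := 0)))"
      using r_pos by (subst sgn_map_expand) auto
  qed
  also have "\<dots> = (\<Sum>i<r. X i)"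
    unfolding sum_distrib_left X_def by (rule sum.swap)
  also have "\<dots> = X j + (\<Sum>i\<in>{..<r} - {j}. X i)"
    using j by (subst sum.remove[of _ j]) auto
  finally have eq: "(\<Sum>s\<in>?S. w s * sgn_map r (?m s)) = X j + (\<Sum>i\<in>{..<r} - {j}. X i)" .
  have "int p dvd (\<Sum>i\<in>{..<r} - {j}. X i)"
    by (rule dvd_sum) (use vanish in \<open>auto simp: X_def\<close>)
  then have "[X j + (\<Sum>i\<in>{..<r} - {j}. X i) = X j] (mod int p)"
    by (simp add: cong_iff_dvd_diff)
  then show ?thesis
    unfolding eq by (simp add: X_def)
qed

text \<open>The comparison uses \<open>count j\<close> because its representative condition
  restricts only s j. The sums over the other places remain unrestricted, as the cancellation in
  \<open>star_sum_cong\<close> requires.\<close>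

lemma count_cong_coordinate:
  assumes j: "j < r"
    and l: "\<And>i v. i < r \<Longrightarrow> v \<in> V i \<Longrightarrow> l i v < r" and l': "\<And>i v. i < r \<Longrightarrow> v \<in> V i \<Longrightarrow> l' i v < r"
    and eq: "\<And>i v. i < r \<Longrightarrow> i \<noteq> j \<Longrightarrow> l i v = l' i v"
  shows "[count j l = count j l'] (mod int p)"
proof -
  have split: "count j l = (\<Sum>v\<in>V j. of_bool (lab0 j v = 0) *
      (\<Sum>s\<in>PiE {..<r} (V(j := {v})). w s * sgn_map r (\<lambda>i. l i (s i))))" for l
  proof -
    have "count j l = (\<Sum>s\<in>PiE ({..<r} - {j}) V. \<Sum>v\<in>V j. of_bool (lab0 j v = 0) *
        (w (s(j := v)) * sgn_map r (\<lambda>i. l i ((s(j := v)) i))))"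
      unfolding count_def sum_PiE_coordinate[OF lessThan_iff[THEN iffD2, OF j]] fun_upd_same ..
    also have "\<dots> = (\<Sum>v\<in>V j. of_bool (lab0 j v = 0) * (\<Sum>s\<in>PiE ({..<r} - {j}) V.
        w (s(j := v)) * sgn_map r (\<lambda>i. l i ((s(j := v)) i))))"
      unfolding sum_distrib_left by (rule sum.swap)
    also have "\<dots> = (\<Sum>v\<in>V j. of_bool (lab0 j v = 0) *
        (\<Sum>s\<in>PiE {..<r} (V(j := {v})). w s * sgn_map r (\<lambda>i. l i (s i))))"
    proof (rule sum.cong[OF refl])
      fix v
      have "PiE ({..<r} - {j}) V = PiE ({..<r} - {j}) (V(j := {v}))"
        by (rule PiE_cong) auto
      then have "(\<Sum>s\<in>PiE {..<r} (V(j := {v})). w s * sgn_map r (\<lambda>i. l i (s i)))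
        = (\<Sum>s\<in>PiE ({..<r} - {j}) V. w (s(j := v)) * sgn_map r (\<lambda>i. l i ((s(j := v)) i)))"
        unfolding sum_PiE_coordinate[OF lessThan_iff[THEN iffD2, OF j]] fun_upd_same by simp
      then show "of_bool (lab0 j v = 0) *
          (\<Sum>s\<in>PiE ({..<r} - {j}) V. w (s(j := v)) * sgn_map r (\<lambda>i. l i ((s(j := v)) i)))
        = of_bool (lab0 j v = 0) * (\<Sum>s\<in>PiE {..<r} (V(j := {v})). w s * sgn_map r (\<lambda>i. l i (s i)))"
        by simp
    qed
    finally show ?thesis .
  qed
  have eq0: "sgn_map r ((\<lambda>i. l i (s i))(j := 0)) = sgn_map r ((\<lambda>i. l' i (s i))(j := 0))" for s
    by (rule sgn_map_cong) (use eq in auto)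
  define E where "E l v = (\<Sum>s\<in>PiE {..<r} (V(j := {v})). w s * sgn_map r (\<lambda>i. l i (s i)))"
    for l :: "nat \<Rightarrow> 'v \<Rightarrow> nat" and v
  have E: "[E l v = E l' v] (mod int p)" if v: "v \<in> V j" for v
  proof -
    define z where "z = (\<Sum>s\<in>PiE {..<r} (V(j := {v})). w s * sgn_map r ((\<lambda>i. l' i (s i))(j := 0)))"
    have "[E l v = z] (mod int p)"
      using star_sum_cong[OF j v, of l, OF l] unfolding E_def z_def eq0 .
    moreover have "[E l' v = z] (mod int p)"
      using star_sum_cong[OF j v, of l', OF l'] unfolding E_def z_def .
    ultimately show ?thesis
      using cong_sym cong_trans by blast
  qed
  have "[(\<Sum>v\<in>V j. of_bool (lab0 j v = 0) * E l v) = (\<Sum>v\<in>V j. of_bool (lab0 j v = 0) * E l' v)] (mod int p)"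
    by (rule cong_sum, rule cong_scalar_left, rule E)
  then show ?thesis
    unfolding split E_def .
qed

text \<open>The labels are exchanged one place at a time. Before each exchange the representative
  condition is moved to that place, and afterwards back to place 0.\<close>

theorem count_independent:
  assumes l: "equivariant l" and l': "equivariant l'"
  shows "[count 0 l = count 0 l'] (mod int p)"
proof -
  define mix where "mix k = (\<lambda>i v. if i < k then l' i v else l i v)" for k :: nat
  have mix: "equivariant (mix k)" for k
    using l l' by (auto simp: mix_def equivariant_def)
  then have lt: "mix k i v < r" if "i < r" "v \<in> V i" for k i v
    using that by (auto simp: equivariant_def)
  have "[count 0 l = count 0 (mix k)] (mod int p)" if "k \<le> r" for k
    using that
  proof (induction k)
    case 0
    then show ?case by (simp add: mix_def)
  next
    case (Suc k)
    then have k: "k < r" by simp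
    have "[count 0 l = count 0 (mix k)] (mod int p)" using Suc by simp
    also have "[count 0 (mix k) = count k (mix k)] (mod int p)"
      by (rule count_cong_position[OF mix r_pos k])
    also have "[count k (mix k) = count k (mix (Suc k))] (mod int p)"
      by (rule count_cong_coordinate[OF k, of "mix k" "mix (Suc k)", OF lt lt]) (auto simp: mix_def)
    also have "[count k (mix (Suc k)) = count 0 (mix (Suc k))] (mod int p)"
      by (rule count_cong_position[OF mix k r_pos])
    finally show ?case .
  qed
  from this[of r] have "[count 0 l = count 0 (mix r)] (mod int p)" by simp
  also have "count 0 (mix r) = count 0 l'"
    unfolding count_def mix_def
    by (rule sum.cong[OF refl]) (simp add: sgn_map_cong[where m = "\<lambda>i. if i < r then l' i (_ i) else l i (_ i)" and m' = "\<lambda>i. l' i (_ i)"])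
  finally show ?thesis .
qed

corollary exists_full_flag:
  assumes "\<not> int p dvd count 0 lab0" and l: "equivariant l"
  shows "\<exists>s\<in>PiE {..<r} V. w s \<noteq> 0 \<and> bij_betw (\<lambda>i. l i (s i)) {..<r} {..<r}"
proof (rule ccontr)
  assume "\<not> ?thesis"
  then have "count 0 l = 0"
    unfolding count_def by (intro sum.neutral) (auto simp: sgn_map_def)
  with count_independent[OF l equivariant_lab0] assms(1) show False
    by (simp add: cong_iff_dvd_diff)
qed

end

section \<open>Chains of cells in a product of stars\<close>

text \<open>With \<iota> the incidence numbers of a complex, this is up to a global sign the
  coefficient of the flag s in the barycentric subdivision of the chain z.\<close>

definition chain_weight :: "nat \<Rightarrow> ('v \<Rightarrow> 'v \<Rightarrow> int) \<Rightarrow> ('v \<Rightarrow> int) \<Rightarrow> (nat \<Rightarrow> 'v) \<Rightarrow> int" where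
  "chain_weight m \<iota> z s = z (s m) * (\<Prod>i<m. \<iota> (s i) (s (Suc i)))"

text \<open>Varying one cell of a flag leaves all but the adjacent factors constant. The three
  hypotheses are what remains: the augmentation of a boundary at the lowest place, the boundary of a
  boundary at a middle place, the boundary of z at the top place.\<close>

lemma chain_weight_cycle:
  assumes bottom: "\<And>y. y \<in> V (Suc 0) \<Longrightarrow> c dvd (\<Sum>x\<in>V 0. \<iota> x y)"
    and middle: "\<And>i x y. Suc i < m \<Longrightarrow> x \<in> V i \<Longrightarrow> y \<in> V (Suc (Suc i)) \<Longrightarrow>
                   c dvd (\<Sum>u\<in>V (Suc i). \<iota> x u * \<iota> u y)"
    and top: "\<And>x. x \<in> V (m - 1) \<Longrightarrow> c dvd (\<Sum>u\<in>V m. \<iota> x u * z u)"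
    and m: "0 < m" and s: "\<And>i. i \<le> m \<Longrightarrow> s i \<in> V i" and j: "j \<le> m"
  shows "c dvd (\<Sum>u\<in>V j. chain_weight m \<iota> z (s(j := u)))"
proof -
  consider "j = 0" | i where "j = Suc i" "Suc i < m" | "j = m"
    using j by (cases j) force+
  then show ?thesis
  proof cases
    case 1
    have "chain_weight m \<iota> z (s(j := u))
        = z (s m) * (\<Prod>i\<in>{..<m} - {0}. \<iota> (s i) (s (Suc i))) * \<iota> u (s (Suc 0))" for u
      unfolding chain_weight_def 1 using m
      by (subst prod.remove[of _ 0]) (auto intro!: prod.cong)
    then have "(\<Sum>u\<in>V j. chain_weight m \<iota> z (s(j := u)))
        = z (s m) * (\<Prod>i\<in>{..<m} - {0}. \<iota> (s i) (s (Suc i))) * (\<Sum>u\<in>V 0. \<iota> u (s (Suc 0)))"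
      by (simp only: sum_distrib_left[symmetric] 1)
    then show ?thesis
      using bottom[of "s (Suc 0)"] s[of "Suc 0"] m by simp
  next
    case (2 i)
    have "chain_weight m \<iota> z (s(j := u))
        = z (s m) * (\<Prod>k\<in>{..<m} - {i} - {Suc i}. \<iota> (s k) (s (Suc k)))
          * (\<iota> (s i) u * \<iota> u (s (Suc (Suc i))))" for u
    proof -
      let ?f = "\<lambda>k. \<iota> ((s(j := u)) k) ((s(j := u)) (Suc k))"
      have "(\<Prod>k<m. ?f k) = ?f i * (\<Prod>k\<in>{..<m} - {i}. ?f k)"
        by (rule prod.remove) (use 2 in auto)
      also have "(\<Prod>k\<in>{..<m} - {i}. ?f k) = ?f (Suc i) * (\<Prod>k\<in>{..<m} - {i} - {Suc i}. ?f k)"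
        by (rule prod.remove) (use 2 in auto)
      also have "(\<Prod>k\<in>{..<m} - {i} - {Suc i}. ?f k)
          = (\<Prod>k\<in>{..<m} - {i} - {Suc i}. \<iota> (s k) (s (Suc k)))"
        using 2 by (intro prod.cong) auto
      finally show ?thesis
        using 2 by (simp add: chain_weight_def mult_ac)
    qed
    then have "(\<Sum>u\<in>V j. chain_weight m \<iota> z (s(j := u)))
        = z (s m) * (\<Prod>k\<in>{..<m} - {i} - {Suc i}. \<iota> (s k) (s (Suc k)))
          * (\<Sum>u\<in>V (Suc i). \<iota> (s i) u * \<iota> u (s (Suc (Suc i))))"
      by (simp only: sum_distrib_left[symmetric] 2)
    then show ?thesis
      using middle[of i "s i" "s (Suc (Suc i))"] s 2 by simp
  next
    case 3
    have "chain_weight m \<iota> z (s(j := u))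
        = (\<Prod>i\<in>{..<m} - {m - 1}. \<iota> (s i) (s (Suc i))) * (\<iota> (s (m - 1)) u * z u)" for u
    proof -
      let ?f = "\<lambda>k. \<iota> ((s(j := u)) k) ((s(j := u)) (Suc k))"
      have "(\<Prod>k<m. ?f k) = ?f (m - 1) * (\<Prod>k\<in>{..<m} - {m - 1}. ?f k)"
        using m by (subst prod.remove[of _ "m - 1"]) auto
      also have "(\<Prod>k\<in>{..<m} - {m - 1}. ?f k) = (\<Prod>k\<in>{..<m} - {m - 1}. \<iota> (s k) (s (Suc k)))"
        using 3 by (intro prod.cong) auto
      finally show ?thesis
        using 3 m less_irrefl[of m] by (cases m) (auto simp: chain_weight_def mult_ac)
    qed
    then have "(\<Sum>u\<in>V j. chain_weight m \<iota> z (s(j := u)))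
        = (\<Prod>i\<in>{..<m} - {m - 1}. \<iota> (s i) (s (Suc i))) * (\<Sum>u\<in>V m. \<iota> (s (m - 1)) u * z u)"
      by (simp only: sum_distrib_left[symmetric] 3)
    then show ?thesis
      using top[of "s (m - 1)"] s[of "m - 1"] by simp
  qed
qed

text \<open>The cells of a star with legs \<open>B\<close>, every leg being subdivided into \<open>n\<close> edges: on leg \<open>b\<close>
  the pair \<open>(k, b)\<close> is a vertex if \<open>k\<close> is even and an edge if \<open>k\<close> is odd, counted from the centre.
  The centre lies on no leg, hence the second component \<open>undefined\<close>.\<close>

definition star :: "nat \<Rightarrow> 'b set \<Rightarrow> (nat \<times> 'b) set" where
  "star n B = insert (0, undefined) ({1..2 * n} \<times> B)"

definition inner_end :: "nat \<times> 'b \<Rightarrow> nat \<times> 'b" where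
  "inner_end y = (if fst y = 1 then (0, undefined) else (fst y - 1, snd y))"

definition star_inc :: "nat \<times> 'b \<Rightarrow> nat \<times> 'b \<Rightarrow> int" where
  "star_inc x y = (if odd (fst y)
     then of_bool (x = (Suc (fst y), snd y)) - of_bool (x = inner_end y) else 0)"

lemma finite_star: "finite B \<Longrightarrow> finite (star n B)"
  by (simp add: star_def)

lemma star_inc_parity: "star_inc x y \<noteq> 0 \<Longrightarrow> odd (fst y) \<and> even (fst x)"
  by (auto simp: star_inc_def inner_end_def of_bool_def split: if_splits)

lemma star_endpoints:
  assumes "y \<in> star n B" "odd (fst y)"
  shows "(Suc (fst y), snd y) \<in> star n B" "inner_end y \<in> star n B" "inner_end y \<noteq> (Suc (fst y), snd y)"
  using assms by (auto simp: star_def inner_end_def) presburger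

lemma sum_star_inc_faces:
  assumes "finite B" "y \<in> star n B"
  shows "(\<Sum>x\<in>star n B. star_inc x y) = 0"
proof (cases "odd (fst y)")
  case True
  have "(\<Sum>x\<in>star n B. star_inc x y)
      = (\<Sum>x\<in>star n B. of_bool (x = (Suc (fst y), snd y))) - (\<Sum>x\<in>star n B. of_bool (x = inner_end y))"
    using True by (simp add: star_inc_def sum_subtractf)
  also have "\<dots> = 0"
    using star_endpoints[OF assms(2) True] finite_star[OF assms(1)] by simp
  finally show ?thesis .
qed (simp add: star_inc_def)

text \<open>A vertex inside a leg lies on two edges of that leg, with opposite signs and the same
  weight. At the centre all legs start with the same sign, which leaves the sum of G. An outermost
  vertex lies on one edge only and is excluded.\<close>

lemma sum_star_inc_cofaces:
  assumes B: "finite B" and x: "x \<in> star n B" "fst x \<noteq> 2 * n" and G: "c dvd (\<Sum>b\<in>B. G b)"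
  shows "c dvd (\<Sum>y\<in>star n B. star_inc x y * G (snd y))"
proof (cases "odd (fst x)")
  case True
  then have "star_inc x y = 0" for y
    using star_inc_parity[of x y] by blast
  then show ?thesis by simp
next
  case even: False
  show ?thesis
  proof (cases "fst x = 0")
    case True
    then have x0: "x = (0, undefined)" using x by (auto simp: star_def)
    have inc: "star_inc x y = - of_bool (fst y = 1)" for y
      by (cases y) (auto simp: star_inc_def inner_end_def x0 gr0_conv_Suc elim!: oddE)
    have n: "0 < n" using x x0 by auto
    have "(\<Sum>y\<in>star n B. star_inc x y * G (snd y)) = (\<Sum>y\<in>Pair (1 :: nat) ` B. - G (snd y))"
      unfolding inc
      by (rule sum.mono_neutral_cong_right) (use B n in \<open>auto simp: star_def\<close>)
    also have "\<dots> = - (\<Sum>b\<in>B. G b)"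
      by (simp add: sum_negf sum.reindex inj_on_def)
    finally show ?thesis using G by simp
  next
    case False
    obtain k b where kb: "x = (k, b)" "1 \<le> k" "k < 2 * n" "b \<in> B"
      using x False by (cases x) (auto simp: star_def)
    have inc: "star_inc x y = of_bool (y = (k - 1, b)) - of_bool (y = (Suc k, b))" for y
      using even kb by (cases y) (auto simp: star_inc_def inner_end_def elim!: oddE evenE)
    have "(\<Sum>y\<in>star n B. star_inc x y * G (snd y))
        = (\<Sum>y\<in>star n B. of_bool (y = (k - 1, b)) * G (snd y)) - (\<Sum>y\<in>star n B. of_bool (y = (Suc k, b)) * G (snd y))"
      unfolding inc by (simp add: left_diff_distrib sum_subtractf)
    also have "(\<Sum>y\<in>star n B. of_bool (y = (k - 1, b)) * G (snd y)) = (\<Sum>y\<in>{(k - 1, b)}. G (snd y))"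
      by (rule sum.mono_neutral_cong_right) (use finite_star[OF B] kb even in \<open>auto simp: star_def elim!: evenE\<close>)
    also have "(\<Sum>y\<in>star n B. of_bool (y = (Suc k, b)) * G (snd y)) = (\<Sum>y\<in>{(Suc k, b)}. G (snd y))"
      by (rule sum.mono_neutral_cong_right) (use finite_star[OF B] kb even in \<open>auto simp: star_def elim!: evenE\<close>)
    finally show ?thesis by simp
  qed
qed


section \<open>The product of stars as a cubical complex\<close>

definition cells :: "nat \<Rightarrow> nat \<Rightarrow> (nat \<Rightarrow> 'b set) \<Rightarrow> (nat \<Rightarrow> nat \<times> 'b) set" where
  "cells r n B = PiE {..<r} (\<lambda>t. star n (B t))"

definition edges_below :: "nat \<Rightarrow> (nat \<Rightarrow> nat \<times> 'b) \<Rightarrow> nat" where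
  "edges_below t c = card {k. k < t \<and> odd (fst (c k))}"

text \<open>The boundary of a tensor product of complexes, \<open>edges_below\<close> being the
  exponent of the Koszul sign. At most one term of the sum is nonzero, that of the coordinate at
  which an edge of y is replaced by an endpoint.\<close>

definition incidence :: "nat \<Rightarrow> (nat \<Rightarrow> nat \<times> 'b) \<Rightarrow> (nat \<Rightarrow> nat \<times> 'b) \<Rightarrow> int" where
  "incidence r x y =
     (\<Sum>t<r. of_bool (x = y(t := x t)) * (- 1) ^ edges_below t y * star_inc (x t) (y t))"

lemma finite_cells: "(\<And>t. t < r \<Longrightarrow> finite (B t)) \<Longrightarrow> finite (cells r n B)"
  unfolding cells_def by (intro finite_PiE finite_star) auto

lemma cells_upd: "c \<in> cells r n B \<Longrightarrow> t < r \<Longrightarrow> u \<in> star n (B t) \<Longrightarrow> c(t := u) \<in> cells r n B"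
  by (auto simp: cells_def PiE_iff extensional_def)

lemma cells_coordinate: "c \<in> cells r n B \<Longrightarrow> t < r \<Longrightarrow> c t \<in> star n (B t)"
  by (auto simp: cells_def)

lemma edges_below_upd:
  "edges_below t (c(k := u)) = (if k < t \<and> odd (fst (c k)) \<and> even (fst u) then edges_below t c - 1
     else if k < t \<and> even (fst (c k)) \<and> odd (fst u) then Suc (edges_below t c) else edges_below t c)"
proof -
  let ?A = "{k. k < t \<and> odd (fst (c k))}"
  have "{j. j < t \<and> odd (fst ((c(k := u)) j))}
      = (if k < t \<and> odd (fst u) then insert k ?A else ?A - {k})"
    by auto
  moreover have "finite ?A" by simp
  ultimately show ?thesis
    by (auto simp: edges_below_def card_insert_if)
qed

lemma edges_below_pos: "k < t \<Longrightarrow> odd (fst (c k)) \<Longrightarrow> 0 < edges_below t c"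
  unfolding edges_below_def by (subst card_gt_0_iff) auto

lemma incidence_sum_faces:
  assumes B: "\<And>t. t < r \<Longrightarrow> finite (B t)" and y: "y \<in> cells r n B"
  shows "(\<Sum>x\<in>cells r n B. incidence r x y * H x)
    = (\<Sum>t<r. (- 1) ^ edges_below t y * (\<Sum>u\<in>star n (B t). star_inc u (y t) * H (y(t := u))))"
proof -
  have "(\<Sum>x\<in>cells r n B. incidence r x y * H x)
      = (\<Sum>t<r. \<Sum>x\<in>cells r n B. of_bool (x = y(t := x t)) * (- 1) ^ edges_below t y * star_inc (x t) (y t) * H x)"
    unfolding incidence_def sum_distrib_right by (rule sum.swap)
  also have "\<dots> = (\<Sum>t<r. (- 1) ^ edges_below t y * (\<Sum>u\<in>star n (B t). star_inc u (y t) * H (y(t := u))))"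
  proof (rule sum.cong[OF refl])
    fix t assume "t \<in> {..<r}"
    then have t: "t < r" by simp
    have inj: "inj_on (\<lambda>u. y(t := u)) (star n (B t))"
      by (rule inj_onI) (metis fun_upd_same)
    have "(\<Sum>x\<in>cells r n B. of_bool (x = y(t := x t)) * (- 1) ^ edges_below t y * star_inc (x t) (y t) * H x)
        = (\<Sum>x\<in>(\<lambda>u. y(t := u)) ` star n (B t). (- 1) ^ edges_below t y * (star_inc (x t) (y t) * H x))"
    proof (rule sum.mono_neutral_cong_right)
      show "finite (cells r n B)" by (rule finite_cells[OF B])
      show "(\<lambda>u. y(t := u)) ` star n (B t) \<subseteq> cells r n B"
        using cells_upd[OF y t] by blast
      show "\<forall>x\<in>cells r n B - (\<lambda>u. y(t := u)) ` star n (B t).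
          of_bool (x = y(t := x t)) * (- 1) ^ edges_below t y * star_inc (x t) (y t) * H x = 0"
        using cells_coordinate[OF _ t] by (auto simp: image_iff)
    qed auto
    then show "(\<Sum>x\<in>cells r n B. of_bool (x = y(t := x t)) * (- 1) ^ edges_below t y * star_inc (x t) (y t) * H x)
        = (- 1) ^ edges_below t y * (\<Sum>u\<in>star n (B t). star_inc u (y t) * H (y(t := u)))"
      by (simp add: sum.reindex[OF inj] sum_distrib_left)
  qed
  finally show ?thesis .
qed

text \<open>The sign of a coface x(t := u) can be read off x, because \<open>edges_below t\<close>
  does not look at coordinate t.\<close>

lemma incidence_sum_cofaces:
  assumes B: "\<And>t. t < r \<Longrightarrow> finite (B t)" and x: "x \<in> cells r n B"
  shows "(\<Sum>y\<in>cells r n B. incidence r x y * H y)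
    = (\<Sum>t<r. (- 1) ^ edges_below t x * (\<Sum>u\<in>star n (B t). star_inc (x t) u * H (x(t := u))))"
proof -
  have "(\<Sum>y\<in>cells r n B. incidence r x y * H y)
      = (\<Sum>t<r. \<Sum>y\<in>cells r n B. of_bool (x = y(t := x t)) * (- 1) ^ edges_below t y * star_inc (x t) (y t) * H y)"
    unfolding incidence_def sum_distrib_right by (rule sum.swap)
  also have "\<dots> = (\<Sum>t<r. (- 1) ^ edges_below t x * (\<Sum>u\<in>star n (B t). star_inc (x t) u * H (x(t := u))))"
  proof (rule sum.cong[OF refl])
    fix t assume "t \<in> {..<r}"
    then have t: "t < r" by simp
    have inj: "inj_on (\<lambda>u. x(t := u)) (star n (B t))"
      by (rule inj_onI) (metis fun_upd_same)
    have "(\<Sum>y\<in>cells r n B. of_bool (x = y(t := x t)) * (- 1) ^ edges_below t y * star_inc (x t) (y t) * H y)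
        = (\<Sum>y\<in>(\<lambda>u. x(t := u)) ` star n (B t). (- 1) ^ edges_below t x * (star_inc (x t) (y t) * H y))"
    proof (rule sum.mono_neutral_cong_right)
      show "finite (cells r n B)" by (rule finite_cells[OF B])
      show "(\<lambda>u. x(t := u)) ` star n (B t) \<subseteq> cells r n B"
        using cells_upd[OF x t] by blast
      have "x \<noteq> y(t := x t)" if y: "y \<in> cells r n B - (\<lambda>u. x(t := u)) ` star n (B t)" for y
      proof
        assume "x = y(t := x t)"
        then have "y = x(t := y t)" by (metis fun_upd_triv fun_upd_upd)
        moreover have "y t \<in> star n (B t)" using cells_coordinate[OF _ t] y by blast
        ultimately show False using y by blast
      qed
      then show "\<forall>y\<in>cells r n B - (\<lambda>u. x(t := u)) ` star n (B t).
          of_bool (x = y(t := x t)) * (- 1) ^ edges_below t y * star_inc (x t) (y t) * H y = 0"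
        by simp
    qed (auto simp: edges_below_upd)
    then show "(\<Sum>y\<in>cells r n B. of_bool (x = y(t := x t)) * (- 1) ^ edges_below t y * star_inc (x t) (y t) * H y)
        = (- 1) ^ edges_below t x * (\<Sum>u\<in>star n (B t). star_inc (x t) u * H (x(t := u)))"
      by (simp add: sum.reindex[OF inj] sum_distrib_left)
  qed
  finally show ?thesis .
qed

text \<open>\<open>A t k\<close> is the contribution of shrinking y first at t, then at k. Turning
  an edge into a vertex lowers the Koszul exponent of every later coordinate by one, so the two
  orders have opposite signs and A is antisymmetric.\<close>

lemma incidence_incidence:
  assumes B: "\<And>t. t < r \<Longrightarrow> finite (B t)" and x: "x \<in> cells r n B" and y: "y \<in> cells r n B"
  shows "(\<Sum>u\<in>cells r n B. incidence r x u * incidence r u y) = 0"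
proof -
  define A where "A t k = (if k = t then 0 else of_bool (x = y(t := x t, k := x k))
      * (- 1) ^ (edges_below t y + edges_below k (y(t := x t)))
      * (star_inc (x t) (y t) * star_inc (x k) (y k)))" for t k
  have anti: "A k t = - A t k" for t k
  proof (cases "star_inc (x t) (y t) * star_inc (x k) (y k) = 0 \<or> k = t")
    case False
    then have par: "odd (fst (y t))" "even (fst (x t))" "odd (fst (y k))" "even (fst (x k))" "k \<noteq> t"
      using star_inc_parity[of "x t" "y t"] star_inc_parity[of "x k" "y k"] by auto
    have "(- 1 :: int) ^ (edges_below t y + edges_below k (y(t := x t)))
        = - ((- 1) ^ (edges_below k y + edges_below t (y(k := x k))))"
    proof (cases "t < k")
      case True
      then have "0 < edges_below k y" using edges_below_pos[of t k y] par by simp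
      with True par show ?thesis
        by (cases "edges_below k y") (auto simp: edges_below_upd power_add)
    next
      case False
      then have kt: "k < t" using par by simp
      then have "0 < edges_below t y" using edges_below_pos[of k t y] par by simp
      with kt par show ?thesis
        by (cases "edges_below t y") (auto simp: edges_below_upd power_add)
    qed
    moreover have "y(t := x t, k := x k) = y(k := x k, t := x t)"
      using par by (simp add: fun_upd_twist)
    ultimately show ?thesis using par by (simp add: A_def mult_ac)
  qed (auto simp: A_def)
  have "(\<Sum>u\<in>cells r n B. incidence r x u * incidence r u y)
      = (\<Sum>u\<in>cells r n B. incidence r u y * incidence r x u)"
    by (simp add: mult.commute)
  also have "\<dots> = (\<Sum>t<r. (- 1) ^ edges_below t y *
      (\<Sum>u\<in>star n (B t). star_inc u (y t) * incidence r x (y(t := u))))"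
    by (rule incidence_sum_faces[OF B y])
  also have "\<dots> = (\<Sum>t<r. \<Sum>k<r. A t k)"
  proof (rule sum.cong[OF refl])
    fix t assume "t \<in> {..<r}"
    then have t: "t < r" by simp
    define T where "T u k = (- 1) ^ edges_below t y * star_inc u (y t) *
        (of_bool (x = (y(t := u))(k := x k)) * (- 1) ^ edges_below k (y(t := u)) * star_inc (x k) ((y(t := u)) k))" for u k
    have "(- 1) ^ edges_below t y * (\<Sum>u\<in>star n (B t). star_inc u (y t) * incidence r x (y(t := u)))
        = (\<Sum>u\<in>star n (B t). \<Sum>k<r. T u k)"
      unfolding incidence_def sum_distrib_left T_def mult.assoc ..
    also have "\<dots> = (\<Sum>k<r. \<Sum>u\<in>star n (B t). T u k)"
      by (rule sum.swap)
    also have "\<dots> = (\<Sum>k<r. A t k)"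
    proof (rule sum.cong[OF refl])
      fix k assume "k \<in> {..<r}"
      show "(\<Sum>u\<in>star n (B t). T u k) = A t k"
      proof (cases "k = t")
        case True
        \<comment> \<open>A star is one-dimensional: u would have to be a vertex below y t and an
          edge above x t at once.\<close>
        have "T u k = 0" for u
          using star_inc_parity[of u "y t"] star_inc_parity[of "x t" u] by (auto simp: T_def True)
        with True show ?thesis by (simp add: A_def)
      next
        case False
        have "T u k = 0" if "u \<noteq> x t" for u
        proof -
          have "x \<noteq> (y(t := u))(k := x k)"
            using that False by (metis fun_upd_other fun_upd_same)
          then show ?thesis by (simp add: T_def)
        qed
        then have "(\<Sum>u\<in>star n (B t). T u k) = (\<Sum>u\<in>{x t}. T u k)"
          using cells_coordinate[OF x t] finite_star[OF B[OF t]]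
          by (intro sum.mono_neutral_right) auto
        also have "\<dots> = A t k"
          using False by (simp add: T_def A_def power_add mult_ac)
        finally show ?thesis .
      qed
    qed
    finally show "(- 1) ^ edges_below t y * (\<Sum>u\<in>star n (B t). star_inc u (y t) * incidence r x (y(t := u)))
        = (\<Sum>k<r. A t k)" .
  qed
  finally have eq: "(\<Sum>u\<in>cells r n B. incidence r x u * incidence r u y) = (\<Sum>t<r. \<Sum>k<r. A t k)" .
  have "(\<Sum>t<r. \<Sum>k<r. A t k) = (\<Sum>k<r. \<Sum>t<r. A t k)"
    by (rule sum.swap)
  also have "\<dots> = (\<Sum>k<r. \<Sum>t<r. - A k t)"
    by (subst anti) simp
  also have "\<dots> = - (\<Sum>k<r. \<Sum>t<r. A k t)"
    by (simp add: sum_negf)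
  finally show ?thesis unfolding eq by simp
qed

definition cell_dimension :: "nat \<Rightarrow> (nat \<Rightarrow> nat \<times> 'b) \<Rightarrow> nat" where
  "cell_dimension r c = card {t. t < r \<and> odd (fst (c t))}"

lemma incidence_nonzero:
  assumes "incidence r x y \<noteq> 0"
  obtains t where "t < r" "x = y(t := x t)" "star_inc (x t) (y t) \<noteq> 0"
proof -
  have "\<exists>t<r. of_bool (x = y(t := x t)) * (- 1) ^ edges_below t y * star_inc (x t) (y t) \<noteq> 0"
  proof (rule ccontr)
    assume "\<not> ?thesis"
    then have "incidence r x y = 0" unfolding incidence_def by (intro sum.neutral) auto
    with assms show False by simp
  qed
  then show ?thesis using that by auto
qed

lemma incidence_cell_dimension:
  assumes "incidence r x y \<noteq> 0"
  shows "cell_dimension r y = Suc (cell_dimension r x)"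
proof -
  obtain t where t: "t < r" "x = y(t := x t)" "star_inc (x t) (y t) \<noteq> 0"
    using incidence_nonzero[OF assms] .
  have par: "odd (fst (y t))" "even (fst (x t))"
    using star_inc_parity[OF t(3)] by auto
  have eq: "x k = y k" if "k \<noteq> t" for k
    using t(2) that by (metis fun_upd_other)
  have "{k. k < r \<and> odd (fst (y k))} = insert t {k. k < r \<and> odd (fst (x k))}"
    using t(1) par eq by force
  then show ?thesis
    using par by (simp add: cell_dimension_def)
qed

text \<open>The centre is on no leg and must be fixed, so its second component stays
  \<open>undefined\<close> instead of being moved by g.\<close>

definition star_act :: "('b \<Rightarrow> 'b) \<Rightarrow> nat \<times> 'b \<Rightarrow> nat \<times> 'b" where
  "star_act g u = (fst u, if fst u = 0 then undefined else g (snd u))"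

lemma fst_star_act [simp]: "fst (star_act g u) = fst u"
  by (simp add: star_act_def)

lemma snd_star: "u \<in> star n B \<Longrightarrow> fst u \<noteq> 0 \<Longrightarrow> snd u \<in> B"
  by (auto simp: star_def)

lemma star_act_in: "(\<And>b. b \<in> B \<Longrightarrow> g b \<in> B) \<Longrightarrow> u \<in> star n B \<Longrightarrow> star_act g u \<in> star n B"
  by (auto simp: star_def star_act_def)

lemma star_act_star_act:
  "(\<And>b. b \<in> B \<Longrightarrow> g (g' b) = b) \<Longrightarrow> u \<in> star n B \<Longrightarrow> star_act g (star_act g' u) = u"
  by (auto simp: star_def star_act_def)

lemma star_inc_star_act:
  assumes g: "inj_on g B" and x: "x \<in> star n B" and y: "y \<in> star n B"
  shows "star_inc (star_act g x) (star_act g y) = star_inc x y"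
proof (cases "odd (fst y)")
  case True
  have inj: "star_act g u = star_act g v \<longleftrightarrow> u = v" if "u \<in> star n B" "v \<in> star n B" for u v
  proof
    assume eq: "star_act g u = star_act g v"
    then have fst: "fst u = fst v" by (metis fst_star_act)
    show "u = v"
    proof (cases "fst u = 0")
      case True
      with fst that show ?thesis by (auto simp: star_def)
    next
      case False
      then have "g (snd u) = g (snd v)" using eq fst by (simp add: star_act_def)
      then have "snd u = snd v"
        using inj_onD[OF g] snd_star that False fst by metis
      with fst show ?thesis by (rule prod_eqI)
    qed
  qed simp
  have "(Suc (fst y), snd (star_act g y)) = star_act g (Suc (fst y), snd y)"
    using True by (auto simp: star_act_def elim: oddE)
  moreover have "inner_end (star_act g y) = star_act g (inner_end y)"
    using True by (auto simp: star_act_def inner_end_def elim: oddE)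
  ultimately show ?thesis
    using True star_endpoints[OF y True] x by (simp add: star_inc_def inj)
qed (simp add: star_inc_def)

section \<open>The outer boundary of the product of stars\<close>

lemma star_inc_outer:
  assumes "u \<in> star n B" "0 < n"
  shows "star_inc (2 * n, b) u = of_bool (u = (2 * n - 1, b))"
  using assms by (cases u) (auto simp: star_inc_def inner_end_def star_def of_bool_def)

text \<open>The join of the sets \<open>B t\<close> is the outer boundary of the product of the stars with legs \<open>B t\<close>.
  Weighting the cubes of the product by \<open>W\<close> of their legs gives a chain whose boundary is, modulo
  \<open>p\<close>, supported on the outer cells and is the subdivided cycle: at the centre of a star the
  line sums of \<open>W\<close> vanish.\<close>

locale subdivided_flags = weighted_flags r p B W ad neg act box
  for r p :: nat and B :: "nat \<Rightarrow> 'b set" and W :: "(nat \<Rightarrow> 'b) \<Rightarrow> int"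
    and ad :: "nat \<Rightarrow> nat \<Rightarrow> nat" and neg :: "nat \<Rightarrow> nat" and act :: "nat \<Rightarrow> 'b \<Rightarrow> 'b"
    and box :: "nat \<Rightarrow> 'b \<Rightarrow> nat" +
  fixes n :: nat
  assumes r_gt_1: "1 < r" and n_pos: "0 < n"
begin

abbreviation Cells :: "(nat \<Rightarrow> nat \<times> 'b) set" where "Cells \<equiv> cells r n B"

definition legs :: "(nat \<Rightarrow> nat \<times> 'b) \<Rightarrow> nat \<Rightarrow> 'b" where
  "legs c = (\<lambda>t\<in>{..<r}. snd (c t))"

definition solid :: "(nat \<Rightarrow> nat \<times> 'b) \<Rightarrow> int" where
  "solid c = (if \<forall>t<r. odd (fst (c t)) then W (legs c) else 0)"

text \<open>The boundary of the chain \<open>solid\<close>, as a function on cells.\<close>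

definition top_coeff :: "(nat \<Rightarrow> nat \<times> 'b) \<Rightarrow> int" where
  "top_coeff c = (\<Sum>\<rho>\<in>Cells. incidence r c \<rho> * solid \<rho>)"

definition outer :: "(nat \<Rightarrow> nat \<times> 'b) \<Rightarrow> bool" where
  "outer c \<longleftrightarrow> (\<exists>t<r. fst (c t) = 2 * n)"

definition outer_cells :: "nat \<Rightarrow> (nat \<Rightarrow> nat \<times> 'b) set" where
  "outer_cells i = {c \<in> Cells. cell_dimension r c = i \<and> outer c}"

definition flag_weight :: "(nat \<Rightarrow> nat \<Rightarrow> nat \<times> 'b) \<Rightarrow> int" where
  "flag_weight = chain_weight (r - 1) (incidence r) top_coeff"

definition cell_act :: "nat \<Rightarrow> (nat \<Rightarrow> nat \<times> 'b) \<Rightarrow> nat \<Rightarrow> nat \<times> 'b" where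
  "cell_act h c = (\<lambda>t\<in>{..<r}. star_act (act h) (c t))"

definition first_outer :: "(nat \<Rightarrow> nat \<times> 'b) \<Rightarrow> nat" where
  "first_outer c = (LEAST t. t < r \<and> fst (c t) = 2 * n)"

text \<open>With this labelling the only fully labelled flag over the legs \<open>b\<close> descends from the vertex with
  all coordinates outermost by moving the coordinates inwards in increasing order.\<close>

definition cell_box :: "nat \<Rightarrow> (nat \<Rightarrow> nat \<times> 'b) \<Rightarrow> nat" where
  "cell_box i c = box (first_outer c) (snd (c (first_outer c)))"

lemma finite_Cells: "finite Cells"
  by (rule finite_cells) (rule finite_V)

lemma cell_act_in: "h < r \<Longrightarrow> c \<in> Cells \<Longrightarrow> cell_act h c \<in> Cells"
  by (auto simp: cells_def cell_act_def PiE_iff act_in intro!: star_act_in)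

lemma cell_act_neg:
  assumes h: "h < r" and c: "c \<in> Cells"
  shows "cell_act h (cell_act (neg h) c) = c"
proof (rule extensionalityI[of _ "{..<r}"])
  fix t assume "t \<in> {..<r}"
  then have t: "t < r" by simp
  have "star_act (act h) (star_act (act (neg h)) (c t)) = c t"
    by (rule star_act_star_act[of "B t" "act h" "act (neg h)", OF act_neg[OF h t] cells_coordinate[OF c t]])
  with t show "cell_act h (cell_act (neg h) c) t = c t"
    by (simp add: cell_act_def)
qed (use c in \<open>auto simp: cells_def cell_act_def PiE_iff\<close>)

lemma neg_cell_act:
  assumes h: "h < r" and c: "c \<in> Cells"
  shows "cell_act (neg h) (cell_act h c) = c"
proof (rule extensionalityI[of _ "{..<r}"])
  fix t assume "t \<in> {..<r}"
  then have t: "t < r" by simp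
  have "star_act (act (neg h)) (star_act (act h) (c t)) = c t"
    by (rule star_act_star_act[of "B t" "act (neg h)" "act h", OF neg_act[OF h t] cells_coordinate[OF c t]])
  with t show "cell_act (neg h) (cell_act h c) t = c t"
    by (simp add: cell_act_def)
qed (use c in \<open>auto simp: cells_def cell_act_def PiE_iff\<close>)

lemma fst_cell_act: "t < r \<Longrightarrow> fst (cell_act h c t) = fst (c t)"
  by (simp add: cell_act_def)

lemma outer_cell_act: "outer (cell_act h c) \<longleftrightarrow> outer c"
  by (auto simp: outer_def fst_cell_act)

lemma dimension_cell_act: "cell_dimension r (cell_act h c) = cell_dimension r c"
  unfolding cell_dimension_def by (rule arg_cong[where f = card]) (auto simp: fst_cell_act)

lemma cell_act_in_outer: "h < r \<Longrightarrow> c \<in> outer_cells i \<Longrightarrow> cell_act h c \<in> outer_cells i"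
  by (simp add: outer_cells_def cell_act_in outer_cell_act dimension_cell_act)

lemma inj_act: "h < r \<Longrightarrow> t < r \<Longrightarrow> inj_on (act h) (B t)"
  by (rule inj_on_inverseI[of _ "act (neg h)"]) (rule neg_act)

lemma incidence_cell_act:
  assumes h: "h < r" and x: "x \<in> Cells" and y: "y \<in> Cells"
  shows "incidence r (cell_act h x) (cell_act h y) = incidence r x y"
  unfolding incidence_def
proof (rule sum.cong[OF refl])
  fix t assume "t \<in> {..<r}"
  then have t: "t < r" by simp
  have upd: "(cell_act h y)(t := cell_act h x t) = cell_act h (y(t := x t))"
    using t by (auto simp: cell_act_def)
  have "cell_act h x = cell_act h (y(t := x t)) \<longleftrightarrow> x = y(t := x t)"
    using neg_cell_act[OF h x] neg_cell_act[OF h cells_upd[OF y t cells_coordinate[OF x t]]] by metis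
  moreover have "edges_below t (cell_act h y) = edges_below t y"
    unfolding edges_below_def using t
    by (intro arg_cong[where f = card]) (auto simp: fst_cell_act)
  moreover have "star_inc (cell_act h x t) (cell_act h y t) = star_inc (x t) (y t)"
    using star_inc_star_act[OF inj_act[OF h t] cells_coordinate[OF x t] cells_coordinate[OF y t]] t
    by (simp add: cell_act_def)
  ultimately show "of_bool (cell_act h x = (cell_act h y)(t := cell_act h x t)) *
      (- 1) ^ edges_below t (cell_act h y) * star_inc (cell_act h x t) (cell_act h y t)
    = of_bool (x = y(t := x t)) * (- 1) ^ edges_below t y * star_inc (x t) (y t)"
    unfolding upd by simp
qed

lemma legs_in: "c \<in> Cells \<Longrightarrow> (\<And>t. t < r \<Longrightarrow> fst (c t) \<noteq> 0) \<Longrightarrow> legs c \<in> PiE {..<r} B"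
  by (auto simp: legs_def dest: cells_coordinate intro: snd_star)

lemma solid_cell_act:
  assumes h: "h < r" and c: "c \<in> Cells"
  shows "solid (cell_act h c) = solid c"
proof (cases "\<forall>t<r. odd (fst (c t))")
  case True
  then have nz: "fst (c t) \<noteq> 0" if "t < r" for t using that by (metis even_zero)
  have "legs (cell_act h c) = (\<lambda>t\<in>{..<r}. act h (legs c t))"
  proof
    fix t show "legs (cell_act h c) t = (\<lambda>t\<in>{..<r}. act h (legs c t)) t"
      using nz[of t] by (cases "t < r") (simp_all add: legs_def cell_act_def star_act_def)
  qed
  then show ?thesis
    using True w_act[OF h legs_in[OF c nz]] by (simp add: solid_def fst_cell_act)
next
  case False
  then show ?thesis by (auto simp: solid_def fst_cell_act)
qed

lemma top_coeff_cell_act: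
  assumes h: "h < r" and c: "c \<in> Cells"
  shows "top_coeff (cell_act h c) = top_coeff c"
proof -
  have "bij_betw (cell_act h) Cells Cells"
    by (rule bij_betw_byWitness[where f' = "cell_act (neg h)"])
       (use h neg_lt[OF h] in \<open>auto simp: neg_cell_act cell_act_neg cell_act_in\<close>)
  then have "top_coeff (cell_act h c)
      = (\<Sum>\<rho>\<in>Cells. incidence r (cell_act h c) (cell_act h \<rho>) * solid (cell_act h \<rho>))"
    unfolding top_coeff_def by (rule sum.reindex_bij_betw[symmetric])
  also have "\<dots> = top_coeff c"
    unfolding top_coeff_def by (rule sum.cong[OF refl]) (simp add: incidence_cell_act h c solid_cell_act)
  finally show ?thesis .
qed

text \<open>A face is taken at an edge coordinate, whereas an outermost coordinate is a vertex and
  survives. So the outer cells are a subcomplex, and sums over faces may be restricted to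
  them.\<close>

lemma incidence_faces_outer:
  assumes "y \<in> outer_cells (Suc i)" "x \<in> Cells" "incidence r x y \<noteq> 0"
  shows "x \<in> outer_cells i"
proof -
  obtain t where t: "t < r" "x = y(t := x t)" "star_inc (x t) (y t) \<noteq> 0"
    using incidence_nonzero[OF assms(3)] .
  obtain k where k: "k < r" "fst (y k) = 2 * n"
    using assms(1) by (auto simp: outer_cells_def outer_def)
  have "k \<noteq> t"
    using star_inc_parity[OF t(3)] k by auto
  then have "fst (x k) = 2 * n"
    using t(2) k by (metis fun_upd_other)
  with k assms incidence_cell_dimension[OF assms(3)] show ?thesis
    by (auto simp: outer_cells_def outer_def)
qed

lemma sum_over_outer_faces:
  assumes "y \<in> outer_cells (Suc i)"
  shows "(\<Sum>x\<in>outer_cells i. H x * incidence r x y) = (\<Sum>x\<in>Cells. H x * incidence r x y)"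
proof (rule sum.mono_neutral_left)
  show "\<forall>x\<in>Cells - outer_cells i. H x * incidence r x y = 0"
    using incidence_faces_outer[OF assms] by force
qed (auto simp: finite_Cells outer_cells_def)

text \<open>Coordinate by coordinate: if a coordinate besides t is a vertex, no full cube arises by
  changing t. Otherwise the two cubes at an inner vertex of a leg cancel, and at the centre the
  cubes add up to a line sum of W, which p divides by \<open>w_cycle\<close>.\<close>

lemma top_coeff_inner:
  assumes c: "c \<in> Cells" and inner: "\<not> outer c"
  shows "int p dvd top_coeff c"
proof -
  have "top_coeff c = (\<Sum>t<r. (- 1) ^ edges_below t c *
      (\<Sum>u\<in>star n (B t). star_inc (c t) u * solid (c(t := u))))"
    unfolding top_coeff_def by (rule incidence_sum_cofaces[OF finite_V c])
  also have "int p dvd \<dots>"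
  proof (rule dvd_sum, rule dvd_mult)
    fix t assume "t \<in> {..<r}"
    then have t: "t < r" by simp
    show "int p dvd (\<Sum>u\<in>star n (B t). star_inc (c t) u * solid (c(t := u)))"
    proof (cases "\<forall>k<r. k \<noteq> t \<longrightarrow> odd (fst (c k))")
      case True
      \<comment> \<open>Among the cubes that arise by changing coordinate t, \<open>solid\<close>
        depends only on the leg of that coordinate.\<close>
      define G where "G b = W ((legs c)(t := b))" for b
      have "star_inc (c t) u * solid (c(t := u)) = star_inc (c t) u * G (snd u)" for u
      proof (cases "star_inc (c t) u = 0")
        case False
        have "legs (c(t := u)) = (legs c)(t := snd u)"
          using t by (auto simp: legs_def)
        with True star_inc_parity[OF False] t show ?thesis
          by (auto simp: solid_def G_def)
      qed simp
      moreover have "int p dvd (\<Sum>u\<in>star n (B t). star_inc (c t) u * G (snd u))"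
      proof (rule sum_star_inc_cofaces[OF finite_V[OF t] cells_coordinate[OF c t]])
        show "fst (c t) \<noteq> 2 * n" using inner t by (auto simp: outer_def)
        show "int p dvd (\<Sum>b\<in>B t. G b)"
        proof (cases "B t = {}")
          case False
          then obtain b where "b \<in> B t" by blast
          moreover have "legs c k \<in> B k" if "k < r" "k \<noteq> t" for k
          proof -
            have "fst (c k) \<noteq> 0" using that True by (metis even_zero)
            then show ?thesis
              using that cells_coordinate[OF c \<open>k < r\<close>] snd_star[of "c k" n "B k"] by (simp add: legs_def)
          qed
          ultimately have "(legs c)(t := b) \<in> PiE {..<r} B"
            using t by (auto simp: PiE_iff legs_def extensional_def)
          from w_cycle[OF t this] show ?thesis by (simp add: G_def)
        qed simp
      qed
      ultimately show ?thesis by (simp only:)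
    next
      case False
      then have "solid (c(t := u)) = 0" for u by (auto simp: solid_def)
      then show ?thesis by simp
    qed
  qed
  finally show ?thesis .
qed

lemma incidence_top_coeff: "x \<in> Cells \<Longrightarrow> (\<Sum>u\<in>Cells. incidence r x u * top_coeff u) = 0"
proof -
  assume x: "x \<in> Cells"
  have "(\<Sum>u\<in>Cells. incidence r x u * top_coeff u)
      = (\<Sum>u\<in>Cells. \<Sum>\<rho>\<in>Cells. incidence r x u * incidence r u \<rho> * solid \<rho>)"
    unfolding top_coeff_def sum_distrib_left mult.assoc ..
  also have "\<dots> = (\<Sum>\<rho>\<in>Cells. \<Sum>u\<in>Cells. incidence r x u * incidence r u \<rho> * solid \<rho>)"
    by (rule sum.swap)
  also have "\<dots> = (\<Sum>\<rho>\<in>Cells. (\<Sum>u\<in>Cells. incidence r x u * incidence r u \<rho>) * solid \<rho>)"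
    unfolding sum_distrib_right ..
  also have "\<dots> = 0"
    by (rule sum.neutral) (use incidence_incidence[OF finite_V x] in auto)
  finally show ?thesis .
qed

text \<open>The bottom and middle conditions hold over the integers. Only the top one needs p: the
  boundary of \<open>top_coeff\<close> vanishes over all cells, and the cells dropped from the sum
  are inner ones, with coefficients divisible by p.\<close>

lemma flag_weight_cycle:
  assumes s: "s \<in> PiE {..<r} outer_cells" and j: "j < r"
  shows "int p dvd (\<Sum>u\<in>outer_cells j. flag_weight (s(j := u)))"
  unfolding flag_weight_def
proof (rule chain_weight_cycle)
  fix y assume y: "y \<in> outer_cells (Suc 0)"
  then have yC: "y \<in> Cells" by (simp add: outer_cells_def)
  have "(\<Sum>x\<in>outer_cells 0. incidence r x y) = (\<Sum>x\<in>Cells. incidence r x y * 1)"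
    using sum_over_outer_faces[OF y, of "\<lambda>_. 1"] by simp
  also have "\<dots> = (\<Sum>t<r. (- 1) ^ edges_below t y * (\<Sum>u\<in>star n (B t). star_inc u (y t) * 1))"
    by (rule incidence_sum_faces[OF finite_V yC])
  also have "\<dots> = 0"
    by (rule sum.neutral) (use sum_star_inc_faces[OF finite_V cells_coordinate[OF yC]] in auto)
  finally show "int p dvd (\<Sum>x\<in>outer_cells 0. incidence r x y)" by simp
next
  fix i x y
  assume x: "x \<in> outer_cells i" and y: "y \<in> outer_cells (Suc (Suc i))"
  have "(\<Sum>u\<in>outer_cells (Suc i). incidence r x u * incidence r u y) = 0"
    using sum_over_outer_faces[OF y] incidence_incidence[OF finite_V, where x = x and y = y and n = n] x y
    by (simp add: outer_cells_def)
  then show "int p dvd (\<Sum>u\<in>outer_cells (Suc i). incidence r x u * incidence r u y)" by simp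
next
  fix x assume x: "x \<in> outer_cells (r - 1 - 1)"
  have "int p dvd (\<Sum>u\<in>Cells - outer_cells (r - 1). incidence r x u * top_coeff u)"
  proof (rule dvd_sum)
    fix u assume u: "u \<in> Cells - outer_cells (r - 1)"
    show "int p dvd incidence r x u * top_coeff u"
    proof (cases "incidence r x u = 0")
      case False
      then have "cell_dimension r u = r - 1"
        using incidence_cell_dimension[OF False] x r_gt_1 by (simp add: outer_cells_def)
      with u have "\<not> outer u" by (auto simp: outer_cells_def)
      then show ?thesis using top_coeff_inner[of u] u by simp
    qed simp
  qed
  moreover have "(\<Sum>u\<in>Cells. incidence r x u * top_coeff u)
      = (\<Sum>u\<in>Cells - outer_cells (r - 1). incidence r x u * top_coeff u)
        + (\<Sum>u\<in>outer_cells (r - 1). incidence r x u * top_coeff u)"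
    by (rule sum.subset_diff) (auto simp: outer_cells_def finite_Cells)
  moreover have "(\<Sum>u\<in>Cells. incidence r x u * top_coeff u) = 0"
    using incidence_top_coeff x by (simp add: outer_cells_def)
  ultimately have "(\<Sum>u\<in>outer_cells (r - 1). incidence r x u * top_coeff u)
      = - (\<Sum>u\<in>Cells - outer_cells (r - 1). incidence r x u * top_coeff u)"
    by (simp only: eq_neg_iff_add_eq_0 add.commute)
  with \<open>int p dvd (\<Sum>u\<in>Cells - outer_cells (r - 1). incidence r x u * top_coeff u)\<close>
  show "int p dvd (\<Sum>u\<in>outer_cells (r - 1). incidence r x u * top_coeff u)"
    by (simp only: dvd_minus_iff)
next
  show "s i \<in> outer_cells i" if "i \<le> r - 1" for i
    using PiE_mem[OF s, of i] that r_gt_1 by simp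
qed (use j r_gt_1 in simp_all)

lemma flag_weight_act:
  assumes h: "h < r" and s: "s \<in> PiE {..<r} outer_cells"
  shows "flag_weight (\<lambda>i\<in>{..<r}. cell_act h (s i)) = flag_weight s"
proof -
  have C: "s i \<in> Cells" if "i < r" for i
    using PiE_mem[OF s, of i] that by (simp add: outer_cells_def)
  show ?thesis
    unfolding flag_weight_def chain_weight_def
  proof (intro arg_cong2[of _ _ _ _ "(*)"] prod.cong refl)
    show "top_coeff ((\<lambda>i\<in>{..<r}. cell_act h (s i)) (r - 1)) = top_coeff (s (r - 1))"
      using top_coeff_cell_act[OF h C] r_gt_1 by simp
    show "incidence r ((\<lambda>i\<in>{..<r}. cell_act h (s i)) i) ((\<lambda>i\<in>{..<r}. cell_act h (s i)) (Suc i))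
        = incidence r (s i) (s (Suc i))" if "i \<in> {..<r - 1}" for i
      using that incidence_cell_act[OF h C[of i] C[of "Suc i"]] by (cases "Suc i < r") auto
  qed
qed

lemma first_outer:
  assumes "outer c"
  shows "first_outer c < r" "fst (c (first_outer c)) = 2 * n"
    and "t < r \<Longrightarrow> fst (c t) = 2 * n \<Longrightarrow> first_outer c \<le> t"
  using LeastI_ex[of "\<lambda>t. t < r \<and> fst (c t) = 2 * n"] assms
  by (auto simp: outer_def first_outer_def intro: Least_le)

lemma first_outer_cell_act: "first_outer (cell_act h c) = first_outer c"
  unfolding first_outer_def by (rule arg_cong[where f = Least]) (auto simp: fst_cell_act)

lemma outer_leg:
  assumes "c \<in> outer_cells i"
  shows "snd (c (first_outer c)) \<in> B (first_outer c)"
  using assms first_outer[of c] n_pos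
  by (auto simp: outer_cells_def intro!: snd_star cells_coordinate)

sublocale outer: weighted_flags r p outer_cells flag_weight ad neg cell_act cell_box
proof
  show "finite (outer_cells i)" for i
    using finite_Cells by (simp add: outer_cells_def)
  show "cell_box i v < r" if "v \<in> outer_cells i" for i v
    unfolding cell_box_def
    using lab0_lt[OF first_outer(1) outer_leg[OF that]] that by (simp add: outer_cells_def)
  show "cell_box i (cell_act h v) = ad h (cell_box i v)" if "h < r" "v \<in> outer_cells i" for h i v
  proof -
    have "outer v" using that by (simp add: outer_cells_def)
    note f = first_outer[OF this]
    have "cell_act h v (first_outer v) = (2 * n, act h (snd (v (first_outer v))))"
      using f n_pos by (simp add: cell_act_def star_act_def)
    then show ?thesis
      using lab0_act[OF that(1) f(1) outer_leg[OF that(2)]]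
      by (simp add: cell_box_def first_outer_cell_act)
  qed
  show "cell_act h (cell_act (neg h) v) = v" "cell_act (neg h) (cell_act h v) = v"
    if "h < r" "v \<in> outer_cells i" for h i v
    using that by (simp_all add: outer_cells_def cell_act_neg neg_cell_act)
  show "cell_act h v \<in> outer_cells i" if "h < r" "v \<in> outer_cells i" for h i v
    using that by (rule cell_act_in_outer)
  show "flag_weight (\<lambda>i\<in>{..<r}. cell_act h (s i)) = flag_weight s"
    if "h < r" "s \<in> PiE {..<r} outer_cells" for h s
    using that by (rule flag_weight_act)
  show "int p dvd (\<Sum>x\<in>outer_cells i. flag_weight (s(i := x)))"
    if "i < r" "s \<in> PiE {..<r} outer_cells" for s i
    using that by (intro flag_weight_cycle)
qed (rule r_pos bij_ad sign_ad transitive bij_neg; assumption)+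

end

section \<open>Comparison of the fine count with the coarse count\<close>

context subdivided_flags
begin

text \<open>Going down a chain of faces, each coordinate changes at most once, from an edge to an
  endpoint, since a vertex has no proper face.\<close>

lemma chain_coordinates:
  assumes s: "\<And>i. Suc i < r \<Longrightarrow> incidence r (s i) (s (Suc i)) \<noteq> 0"
    and ij: "i \<le> j" "j < r"
  shows "s i t = s j t \<or> star_inc (s i t) (s j t) \<noteq> 0"
  using ij
proof (induction j rule: dec_induct)
  case base
  then show ?case by simp
next
  case (step j)
  obtain k where k: "s j = (s (Suc j))(k := s j k)" "star_inc (s j k) (s (Suc j) k) \<noteq> 0"
    using incidence_nonzero[OF s] step by metis
  show ?case
  proof (cases "t = k")
    case True
    have "star_inc (s i k) (s j k) = 0"
      using star_inc_parity[of "s i k" "s j k"] star_inc_parity[OF k(2)] by blast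
    then show ?thesis using step k True by simp
  next
    case False
    then have "s j t = s (Suc j) t" using k(1) by (metis fun_upd_other)
    then show ?thesis using step by simp
  qed
qed

definition outer_flag :: "(nat \<Rightarrow> 'b) \<Rightarrow> nat \<Rightarrow> nat \<Rightarrow> nat \<times> 'b" where
  "outer_flag b = (\<lambda>i\<in>{..<r}. \<lambda>t\<in>{..<r}. (if t < i then 2 * n - 1 else 2 * n, b t))"

lemma outer_flag_apply:
  "i < r \<Longrightarrow> t < r \<Longrightarrow> outer_flag b i t = (if t < i then 2 * n - 1 else 2 * n, b t)"
  by (simp add: outer_flag_def)

lemma outer_flag_Cells:
  "b \<in> PiE {..<r} B \<Longrightarrow> i < r \<Longrightarrow> outer_flag b i \<in> Cells"
  using n_pos by (auto simp: outer_flag_def cells_def star_def PiE_iff)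

lemma outer_flag_in:
  assumes b: "b \<in> PiE {..<r} B"
  shows "outer_flag b \<in> PiE {..<r} outer_cells"
proof (rule PiE_I)
  fix i assume "i \<in> {..<r}"
  then have i: "i < r" by simp
  have "{t. t < r \<and> odd (fst (outer_flag b i t))} = {..<i}"
    using i n_pos by (auto simp: outer_flag_apply split: if_splits)
  moreover have "outer (outer_flag b i)"
    unfolding outer_def using i by (intro exI[of _ i]) (simp add: outer_flag_apply)
  ultimately show "outer_flag b i \<in> outer_cells i"
    using outer_flag_Cells[OF b i] by (simp add: outer_cells_def cell_dimension_def)
qed (simp add: outer_flag_def)

lemma edges_below_outer_flag: "i < r \<Longrightarrow> t \<le> i \<Longrightarrow> edges_below t (outer_flag b i) = t"
proof -
  assume i: "i < r" "t \<le> i"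
  then have "{k. k < t \<and> odd (fst (outer_flag b i k))} = {..<t}"
    using n_pos by (auto simp: outer_flag_apply)
  then show ?thesis by (simp add: edges_below_def)
qed

lemma star_inc_outer_step: "star_inc (2 * n, b) (2 * n - 1, b) = 1"
  using n_pos by (auto simp: star_inc_def inner_end_def)

text \<open>The step moves coordinate i outwards, and exactly the i coordinates before it are edges;
  this is the Koszul sign.\<close>

lemma incidence_outer_flag:
  assumes i: "Suc i < r"
  shows "incidence r (outer_flag b i) (outer_flag b (Suc i)) = (- 1) ^ i"
proof -
  let ?x = "outer_flag b i" and ?y = "outer_flag b (Suc i)"
  have step: "?x = ?y(i := ?x i)"
    using i by (auto simp: outer_flag_def fun_eq_iff)
  have ne: "?x i \<noteq> ?y i"
    using i n_pos by (simp add: outer_flag_apply)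
  have "incidence r ?x ?y = (\<Sum>t\<in>{i}. of_bool (?x = ?y(t := ?x t)) * (- 1) ^ edges_below t ?y * star_inc (?x t) (?y t))"
    unfolding incidence_def
  proof (rule sum.mono_neutral_right)
    have "?x \<noteq> ?y(t := ?x t)" if "t \<noteq> i" for t
      using ne that by (metis fun_upd_other)
    then show "\<forall>t\<in>{..<r} - {i}. of_bool (?x = ?y(t := ?x t)) * (- 1) ^ edges_below t ?y * star_inc (?x t) (?y t) = 0"
      by auto
  qed (use i in auto)
  also have "\<dots> = (- 1) ^ i"
    using step i edges_below_outer_flag[of "Suc i" i b] star_inc_outer_step[of "b i"]
    by (simp add: outer_flag_apply)
  finally show ?thesis .
qed

text \<open>Only one cube contributes: the last coordinate is the only vertex of this cell, and
  being outermost it lies on a single edge.\<close>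

lemma top_coeff_outer_flag:
  assumes b: "b \<in> PiE {..<r} B"
  shows "top_coeff (outer_flag b (r - 1)) = (- 1) ^ (r - 1) * W b"
proof -
  let ?c = "outer_flag b (r - 1)"
  have last: "?c (r - 1) = (2 * n, b (r - 1))"
    using r_gt_1 by (simp add: outer_flag_apply)
  have c: "?c \<in> Cells" using outer_flag_Cells[OF b, of "r - 1"] r_gt_1 by simp
  have "top_coeff ?c = (\<Sum>t<r. (- 1) ^ edges_below t ?c *
      (\<Sum>u\<in>star n (B t). star_inc (?c t) u * solid (?c(t := u))))"
    unfolding top_coeff_def by (rule incidence_sum_cofaces[OF finite_V c])
  also have "\<dots> = (\<Sum>t\<in>{r - 1}. (- 1) ^ edges_below t ?c *
      (\<Sum>u\<in>star n (B t). star_inc (?c t) u * solid (?c(t := u))))"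
  proof (rule sum.mono_neutral_right)
    have "solid (?c(t := u)) = 0" if "t < r" "t \<noteq> r - 1" for t u
    proof -
      have "r - 1 < r" "even (fst ((?c(t := u)) (r - 1)))"
        using that last r_gt_1 by auto
      then show ?thesis unfolding solid_def by metis
    qed
    then show "\<forall>t\<in>{..<r} - {r - 1}. (- 1) ^ edges_below t ?c *
        (\<Sum>u\<in>star n (B t). star_inc (?c t) u * solid (?c(t := u))) = 0"
      by auto
  qed (use r_gt_1 in auto)
  also have "\<dots> = (- 1) ^ (r - 1) * (\<Sum>u\<in>star n (B (r - 1)). star_inc (?c (r - 1)) u * solid (?c(r - 1 := u)))"
    using edges_below_outer_flag[of "r - 1" "r - 1" b] r_gt_1 by simp
  also have "(\<Sum>u\<in>star n (B (r - 1)). star_inc (?c (r - 1)) u * solid (?c(r - 1 := u)))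
      = (\<Sum>u\<in>{(2 * n - 1, b (r - 1))}. solid (?c(r - 1 := u)))"
  proof (rule sum.mono_neutral_cong_right)
    show "finite (star n (B (r - 1)))"
      using finite_star[OF finite_V] r_gt_1 by simp
    show "{(2 * n - 1, b (r - 1))} \<subseteq> star n (B (r - 1))"
      using PiE_mem[OF b, of "r - 1"] r_gt_1 n_pos by (simp add: star_def)
    show "\<forall>u\<in>star n (B (r - 1)) - {(2 * n - 1, b (r - 1))}.
        star_inc (?c (r - 1)) u * solid (?c(r - 1 := u)) = 0"
      unfolding last using star_inc_outer[OF _ n_pos, of _ "B (r - 1)" "b (r - 1)"] by force
    show "star_inc (?c (r - 1)) u * solid (?c(r - 1 := u)) = solid (?c(r - 1 := u))"
      if "u \<in> {(2 * n - 1, b (r - 1))}" for u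
      unfolding last using that star_inc_outer_step[of "b (r - 1)"] by simp
  qed
  also have "\<dots> = W b"
  proof -
    have "legs (?c(r - 1 := (2 * n - 1, b (r - 1)))) = b"
    proof (rule extensionalityI[of _ "{..<r}"])
      show "b \<in> extensional {..<r}" using b by (simp add: PiE_iff)
    qed (auto simp: legs_def outer_flag_apply)
    moreover have "odd (fst ((?c(r - 1 := (2 * n - 1, b (r - 1)))) t))" if "t < r" for t
      using that n_pos by (auto simp: outer_flag_apply)
    ultimately show ?thesis by (simp add: solid_def)
  qed
  finally show ?thesis .
qed

definition orientation :: int where
  "orientation = (- 1) ^ (r - 1) * (\<Prod>i<r - 1. (- 1) ^ i)"

lemma abs_orientation: "\<bar>orientation\<bar> = 1"
  by (simp add: orientation_def abs_mult abs_prod power_abs)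

lemma flag_weight_outer_flag:
  assumes b: "b \<in> PiE {..<r} B"
  shows "flag_weight (outer_flag b) = orientation * W b"
  unfolding flag_weight_def chain_weight_def top_coeff_outer_flag[OF b] orientation_def
  using incidence_outer_flag by (simp add: mult_ac)

lemma first_outer_flag:
  assumes "i < r"
  shows "first_outer (outer_flag b i) = i"
  unfolding first_outer_def
proof (rule Least_equality)
  show "i < r \<and> fst (outer_flag b i i) = 2 * n"
    using assms by (simp add: outer_flag_apply)
  show "i \<le> t" if "t < r \<and> fst (outer_flag b i t) = 2 * n" for t
    using assms that n_pos by (cases "t < i") (auto simp: outer_flag_apply)
qed

lemma cell_box_outer_flag: "i < r \<Longrightarrow> cell_box i (outer_flag b i) = box i (b i)"
  by (simp add: cell_box_def first_outer_flag outer_flag_apply)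

lemma inj_outer_flag: "inj_on outer_flag (PiE {..<r} B)"
proof (rule inj_onI)
  fix b b' assume b: "b \<in> PiE {..<r} B" "b' \<in> PiE {..<r} B" and eq: "outer_flag b = outer_flag b'"
  show "b = b'"
  proof (rule PiE_ext[OF b])
    fix t assume "t \<in> {..<r}"
    with arg_cong[OF eq, of "\<lambda>s. s 0 t"] r_pos show "b t = b' t"
      by (simp add: outer_flag_apply)
  qed
qed

text \<open>Let f i be the first outermost coordinate of s i. Vertex coordinates pass to faces, so f
  is weakly increasing, and equal values of f would repeat a label. Thus f is a strictly increasing
  self-map of the places, that is the identity, and this determines every coordinate.\<close>

lemma fully_labelled_is_outer_flag:
  assumes s: "s \<in> PiE {..<r} outer_cells" and w: "flag_weight s \<noteq> 0"
    and inj: "inj_on (\<lambda>i. cell_box i (s i)) {..<r}"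
  shows "s \<in> outer_flag ` PiE {..<r} B"
proof -
  have inc: "incidence r (s i) (s (Suc i)) \<noteq> 0" if "Suc i < r" for i
    using w that by (auto simp: flag_weight_def chain_weight_def)
  have chain: "s i t = s j t \<or> star_inc (s i t) (s j t) \<noteq> 0" if "i \<le> j" "j < r" for i j t
    by (rule chain_coordinates[of s]) (use inc that in simp_all)
  have C: "s i \<in> Cells" and out: "outer (s i)" if "i < r" for i
    using PiE_mem[OF s, of i] that by (auto simp: outer_cells_def)
  define f where "f i = first_outer (s i)" for i
  have f: "f i < r" "fst (s i (f i)) = 2 * n" if "i < r" for i
    using first_outer[OF out[OF that]] by (auto simp: f_def)
  have down: "s i t = s j t" if "i \<le> j" "j < r" "fst (s j t) = 2 * n" for i j t
    using chain[OF that(1,2), of t] that(3) star_inc_parity[of "s i t" "s j t"] by auto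
  have f_mono: "f i \<le> f j" if "i \<le> j" "j < r" for i j
    using first_outer(3)[OF out, of i "f j"] f[OF that(2)] down[OF that f(2)[OF that(2)]] that
    by (auto simp: f_def)
  have f_inj: "i = j" if "i \<le> j" "j < r" "f i = f j" for i j
  proof -
    have "s i (f j) = s j (f j)" using down that f by simp
    then have "cell_box i (s i) = cell_box j (s j)"
      using that(3) by (simp add: cell_box_def f_def)
    then show ?thesis using inj that by (auto dest: inj_onD)
  qed
  have f_less: "f i < f (Suc i)" if "Suc i < r" for i
    using f_mono[of i "Suc i"] f_inj[of i "Suc i"] that by fastforce
  have lower: "i \<le> f i" if "i < r" for i
    using that
  proof (induction i)
    case (Suc i)
    with f_less[of i] show ?case by simp
  qed simp
  have upper: "f (r - 1 - k) \<le> r - 1 - k" if "k < r" for k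
    using that
  proof (induction k)
    case 0
    then show ?case using f(1)[of "r - 1"] by simp
  next
    case (Suc k)
    have "Suc (r - 1 - Suc k) = r - 1 - k" using Suc.prems by simp
    with f_less[of "r - 1 - Suc k"] Suc show ?case by simp
  qed
  have f_id: "f i = i" if "i < r" for i
    using lower[OF that] upper[of "r - 1 - i"] that by simp
  define b where "b = (\<lambda>t\<in>{..<r}. snd (s 0 t))"
  have outer_t: "s i t = (2 * n, b t)" if "i \<le> t" "t < r" for i t
  proof -
    have t: "fst (s t t) = 2 * n" using f[OF that(2)] f_id[OF that(2)] by simp
    have "s i t = s t t" by (rule down[OF that t])
    moreover have "s 0 t = s t t" by (rule down[OF _ that(2) t]) simp
    ultimately have "s i t = (fst (s t t), snd (s 0 t))" by simp
    then show ?thesis using t that by (simp add: b_def)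
  qed
  \<comment> \<open>Coordinate t is outermost in s t but not in the larger cell s i, so there it is
    the unique edge ending at that outer vertex.\<close>
  have inner_t: "s i t = (2 * n - 1, b t)" if "t < i" "i < r" for i t
  proof -
    have "fst (s i t) \<noteq> 2 * n"
      using first_outer(3)[OF out[OF that(2)], of t] f_id[OF that(2)] that by (auto simp: f_def)
    moreover have "s t t = (2 * n, b t)" using outer_t[of t t] that by simp
    moreover have "s t t = s i t \<or> star_inc (s t t) (s i t) \<noteq> 0"
      using chain[of t i t] that by simp
    ultimately have "star_inc (2 * n, b t) (s i t) \<noteq> 0" by (metis fst_conv)
    then show ?thesis
      using star_inc_outer[OF cells_coordinate[OF C[OF that(2)]] n_pos, of t "b t"] that
      by (auto split: if_splits)
  qed
  have "b \<in> PiE {..<r} B"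
  proof (rule PiE_I)
    fix t assume "t \<in> {..<r}"
    then have t: "t < r" by simp
    then show "b t \<in> B t"
      using snd_star[OF cells_coordinate[OF C[OF r_pos] t]] outer_t[of 0 t] n_pos by simp
  qed (simp add: b_def)
  moreover have "s = outer_flag b"
  proof (rule extensionalityI[of _ "{..<r}"])
    fix i assume "i \<in> {..<r}"
    then have i: "i < r" by simp
    show "s i = outer_flag b i"
    proof (rule extensionalityI[of _ "{..<r}"])
      show "s i \<in> extensional {..<r}"
        using C[OF i] by (simp add: cells_def PiE_iff)
      show "outer_flag b i \<in> extensional {..<r}"
        using i by (simp add: outer_flag_def)
      show "s i t = outer_flag b i t" if "t \<in> {..<r}" for t
        using that i outer_t[of i t] inner_t[of t i] by (auto simp: outer_flag_apply not_less)
    qed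
  next
    show "s \<in> extensional {..<r}" using s by (simp add: PiE_iff)
    show "outer_flag b \<in> extensional {..<r}" by (simp add: outer_flag_def)
  qed
  ultimately show ?thesis by blast
qed

text \<open>Above the legs b only \<open>outer_flag b\<close> can contribute. Its labels are those
  of b and its weight is W b, up to a sign that does not depend on b.\<close>

lemma count_outer: "outer.count 0 cell_box = orientation * count 0 box"
proof -
  let ?S = "PiE {..<r} B"
  have "outer.count 0 cell_box = (\<Sum>s\<in>outer_flag ` ?S. of_bool (cell_box 0 (s 0) = 0) *
      (flag_weight s * sgn_map r (\<lambda>i. cell_box i (s i))))"
    unfolding outer.count_def
  proof (rule sum.mono_neutral_right)
    show "finite (PiE {..<r} outer_cells)"
      by (intro finite_PiE) (auto intro: outer.finite_V)
    show "outer_flag ` ?S \<subseteq> PiE {..<r} outer_cells"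
      using outer_flag_in by blast
    show "\<forall>s\<in>PiE {..<r} outer_cells - outer_flag ` ?S. of_bool (cell_box 0 (s 0) = 0) *
      (flag_weight s * sgn_map r (\<lambda>i. cell_box i (s i))) = 0"
      using fully_labelled_is_outer_flag sgn_map_eq_0 by fastforce
  qed
  also have "\<dots> = (\<Sum>b\<in>?S. of_bool (cell_box 0 (outer_flag b 0) = 0) *
      (flag_weight (outer_flag b) * sgn_map r (\<lambda>i. cell_box i (outer_flag b i))))"
    by (simp add: sum.reindex[OF inj_outer_flag])
  also have "\<dots> = (\<Sum>b\<in>?S. orientation * (of_bool (box 0 (b 0) = 0) * (W b * sgn_map r (\<lambda>i. box i (b i)))))"
  proof (rule sum.cong[OF refl])
    fix b assume b: "b \<in> ?S"
    have "sgn_map r (\<lambda>i. cell_box i (outer_flag b i)) = sgn_map r (\<lambda>i. box i (b i))"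
      by (rule sgn_map_cong) (rule cell_box_outer_flag)
    then show "of_bool (cell_box 0 (outer_flag b 0) = 0) *
        (flag_weight (outer_flag b) * sgn_map r (\<lambda>i. cell_box i (outer_flag b i)))
      = orientation * (of_bool (box 0 (b 0) = 0) * (W b * sgn_map r (\<lambda>i. box i (b i))))"
      using flag_weight_outer_flag[OF b] cell_box_outer_flag[OF r_pos] by (simp add: mult_ac)
  qed
  also have "\<dots> = orientation * count 0 box"
    unfolding count_def sum_distrib_left ..
  finally show ?thesis .
qed

theorem exists_full_outer_flag:
  assumes "\<not> int p dvd count 0 box" and "outer.equivariant l"
  shows "\<exists>s\<in>PiE {..<r} outer_cells. flag_weight s \<noteq> 0 \<and> bij_betw (\<lambda>i. l i (s i)) {..<r} {..<r}"
proof (rule outer.exists_full_flag[OF _ assms(2)])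
  show "\<not> int p dvd outer.count 0 cell_box"
    unfolding count_outer using assms(1) abs_orientation
    by (metis abs_mult dvd_abs_iff mult.left_neutral)
qed

end

section \<open>Digitwise translations and the tensor product of minimal resolutions\<close>

text \<open>Addition of base p numerals without carries. It realises (Z/p)^n on the initial segment
  of length p^n, so that group elements and boxes share one index set; splitting off the lowest
  digit first suits the later recursion on Gray paths.\<close>

fun dig_add :: "nat \<Rightarrow> nat \<Rightarrow> nat \<Rightarrow> nat \<Rightarrow> nat" where
  "dig_add p 0 x y = 0"
| "dig_add p (Suc n) x y = (x mod p + y mod p) mod p + p * dig_add p n (x div p) (y div p)"

fun dig_neg :: "nat \<Rightarrow> nat \<Rightarrow> nat \<Rightarrow> nat" where
  "dig_neg p 0 x = 0"
| "dig_neg p (Suc n) x = (p - x mod p) mod p + p * dig_neg p n (x div p)"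

lemma digit_lt: "a < p \<Longrightarrow> b < p ^ n \<Longrightarrow> a + p * b < (p :: nat) ^ Suc n"
proof -
  assume a: "a < p" and b: "b < p ^ n"
  then have "a + p * b < p * Suc b" by simp
  also have "\<dots> \<le> p * p ^ n" using b by (intro mult_le_mono2) simp
  finally show ?thesis by simp
qed

lemma dig_add_lt: "0 < p \<Longrightarrow> dig_add p n x y < p ^ n"
proof (induction n arbitrary: x y)
  case (Suc n)
  then show ?case unfolding dig_add.simps by (intro digit_lt) auto
qed simp

lemma dig_neg_lt: "0 < p \<Longrightarrow> dig_neg p n x < p ^ n"
proof (induction n arbitrary: x)
  case (Suc n)
  then show ?case unfolding dig_neg.simps by (intro digit_lt) auto
qed simp

lemma dig_add_mod: "dig_add p (Suc n) x y mod p = (x + y) mod p"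
  by (simp add: mod_add_eq)

lemma dig_add_div: "0 < p \<Longrightarrow> dig_add p (Suc n) x y div p = dig_add p n (x div p) (y div p)"
  by (simp add: div_add1_eq)

lemma dig_neg_mod: "dig_neg p (Suc n) x mod p = (p - x mod p) mod p"
  by simp

lemma dig_neg_div: "0 < p \<Longrightarrow> dig_neg p (Suc n) x div p = dig_neg p n (x div p)"
  by (simp add: div_add1_eq)

lemma digit_eqI: "(x :: nat) mod p = y mod p \<Longrightarrow> x div p = y div p \<Longrightarrow> x = y"
  by (metis div_mult_mod_eq)

lemma dig_add_commute: "dig_add p n x y = dig_add p n y x"
  by (induction n arbitrary: x y) (simp_all add: add.commute)

lemma dig_add_assoc: "0 < p \<Longrightarrow> dig_add p n (dig_add p n x y) z = dig_add p n x (dig_add p n y z)"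
proof (induction n arbitrary: x y z)
  case (Suc n)
  show ?case
  proof (rule digit_eqI[of _ p])
    show "dig_add p (Suc n) (dig_add p (Suc n) x y) z mod p = dig_add p (Suc n) x (dig_add p (Suc n) y z) mod p"
      unfolding dig_add_mod
      by (metis dig_add_mod mod_add_left_eq mod_add_right_eq add.assoc)
    show "dig_add p (Suc n) (dig_add p (Suc n) x y) z div p = dig_add p (Suc n) x (dig_add p (Suc n) y z) div p"
      using Suc by (simp only: dig_add_div)
  qed
qed simp

lemma dig_add_left_commute:
  "0 < p \<Longrightarrow> dig_add p n x (dig_add p n y z) = dig_add p n y (dig_add p n x z)"
  by (metis dig_add_assoc dig_add_commute)

lemma dig_add_0: "0 < p \<Longrightarrow> x < p ^ n \<Longrightarrow> dig_add p n 0 x = x"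
proof (induction n arbitrary: x)
  case (Suc n)
  then have "x div p < p ^ n" by (simp add: less_mult_imp_div_less mult.commute)
  with Suc show ?case by simp
qed simp

lemma dig_add_neg: "0 < p \<Longrightarrow> dig_add p n (dig_neg p n x) x = 0"
proof (induction n arbitrary: x)
  case (Suc n)
  show ?case
  proof (rule digit_eqI[of _ p])
    have "((p - x mod p) mod p + x) mod p = (p - x mod p + x mod p) mod p"
      by (simp add: mod_simps)
    also have "\<dots> = 0" using Suc.prems by simp
    finally show "dig_add p (Suc n) (dig_neg p (Suc n) x) x mod p = 0 mod p"
      unfolding dig_add_mod by (metis dig_neg_mod mod_add_left_eq mod_0)
    show "dig_add p (Suc n) (dig_neg p (Suc n) x) x div p = 0 div p"
      using Suc by (simp only: dig_add_div dig_neg_div) simp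
  qed
qed simp

lemma dig_add_funpow:
  "0 < p \<Longrightarrow> x < p ^ Suc n \<Longrightarrow> (dig_add p (Suc n) h ^^ j) x
    = (x mod p + j * (h mod p)) mod p + p * (dig_add p n (h div p) ^^ j) (x div p)"
proof (induction j)
  case (Suc j)
  let ?y = "(dig_add p (Suc n) h ^^ j) x"
  have y: "?y = (x mod p + j * (h mod p)) mod p + p * (dig_add p n (h div p) ^^ j) (x div p)"
    by (rule Suc.IH[OF Suc.prems])
  have "dig_add p (Suc n) h ?y = (h mod p + ?y mod p) mod p + p * dig_add p n (h div p) (?y div p)"
    by simp
  also have "?y div p = (dig_add p n (h div p) ^^ j) (x div p)"
    unfolding y using Suc.prems by (simp add: div_add1_eq)
  also have "?y mod p = (x mod p + j * (h mod p)) mod p"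
    unfolding y by simp
  also have "(h mod p + (x mod p + j * (h mod p)) mod p) mod p = (x mod p + Suc j * (h mod p)) mod p"
  proof -
    have "h mod p + (x mod p + j * (h mod p)) = x mod p + Suc j * (h mod p)" by simp
    then show ?thesis by (simp only: mod_add_right_eq)
  qed
  finally show ?case by simp
qed simp

lemma dig_add_order: "0 < p \<Longrightarrow> x < p ^ n \<Longrightarrow> (dig_add p n h ^^ p) x = x"
proof (induction n arbitrary: x h)
  case 0
  have "(dig_add p 0 h ^^ j) 0 = 0" for j by (induction j) simp_all
  with 0 show ?case by (simp del: dig_add.simps)
next
  case (Suc n)
  have "x div p < p ^ n" using Suc.prems by (simp add: less_mult_imp_div_less mult.commute)
  then show ?case
    unfolding dig_add_funpow[OF Suc.prems] using Suc by simp
qed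

lemma dig_add_bij:
  assumes "0 < p"
  shows "bij_betw (dig_add p n h) {..<p ^ n} {..<p ^ n}"
proof (rule bij_betw_byWitness[where f' = "dig_add p n (dig_neg p n h)"])
  show "\<forall>x\<in>{..<p ^ n}. dig_add p n (dig_neg p n h) (dig_add p n h x) = x"
    using assms by (simp add: dig_add_neg dig_add_0 flip: dig_add_assoc)
  show "\<forall>x\<in>{..<p ^ n}. dig_add p n h (dig_add p n (dig_neg p n h) x) = x"
    using assms by (subst dig_add_left_commute) (simp_all add: dig_add_neg dig_add_0 flip: dig_add_assoc)
qed (use dig_add_lt[OF assms] in auto)

lemma sign_on_power:
  assumes f: "bij_betw f A A" and A: "finite A"
  shows "sign_on A (f ^^ j) = sign_on A f ^ j"
proof (induction j)
  case (Suc j)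
  have "bij_betw (f ^^ j) A A"
    using f by (rule bij_betw_funpow)
  then show ?case
    using Suc sign_on_compose[OF f _ A, of "f ^^ j"] by simp
qed simp

text \<open>For odd p the p-th power of a translation is the identity, so its sign has p-th power 1
  and is 1. For p = 2 the sign can be -1, which is congruent to 1.\<close>

lemma dig_add_sign:
  assumes "prime p"
  shows "[sign_on {..<p ^ n} (dig_add p n h) = 1] (mod int p)"
proof -
  let ?\<sigma> = "sign_on {..<p ^ n} (dig_add p n h)"
  have p: "0 < p" using assms by (simp add: prime_gt_0_nat)
  have cases: "?\<sigma> = 1 \<or> ?\<sigma> = - 1"
    unfolding sign_on_def by (metis sign_def)
  show ?thesis
  proof (cases "p = 2")
    case True
    then show ?thesis using cases by (auto simp: cong_def)
  next
    case False
    then have "odd p" using assms by (metis prime_odd_nat prime_ge_2_nat le_neq_implies_less)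
    have "?\<sigma> ^ p = sign_on {..<p ^ n} (dig_add p n h ^^ p)"
      by (rule sign_on_power[symmetric]) (simp_all add: dig_add_bij[OF p])
    also have "\<dots> = sign_on {..<p ^ n} (\<lambda>x. x)"
      by (rule sign_on_cong) (simp_all add: dig_add_order[OF p])
    finally have "?\<sigma> ^ p = 1" by simp
    with cases \<open>odd p\<close> have "?\<sigma> = 1" by auto
    then show ?thesis by simp
  qed
qed

lemma dig_neg_neg: "0 < p \<Longrightarrow> x < p ^ n \<Longrightarrow> dig_neg p n (dig_neg p n x) = x"
proof -
  assume p: "0 < p" and x: "x < p ^ n"
  have "dig_neg p n (dig_neg p n x) = dig_add p n (dig_neg p n (dig_neg p n x)) (dig_add p n (dig_neg p n x) x)"
    using p dig_neg_lt[OF p] by (simp add: dig_add_neg dig_add_0 dig_add_commute[of p n _ 0])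
  also have "\<dots> = dig_add p n (dig_add p n (dig_neg p n (dig_neg p n x)) (dig_neg p n x)) x"
    by (rule dig_add_assoc[OF p, symmetric])
  also have "\<dots> = x"
    unfolding dig_add_neg[OF p] by (rule dig_add_0[OF p x])
  finally show ?thesis .
qed

lemma dig_neg_bij: "0 < p \<Longrightarrow> bij_betw (dig_neg p n) {..<p ^ n} {..<p ^ n}"
  by (rule bij_betw_byWitness[where f' = "dig_neg p n"]) (auto simp: dig_neg_neg dig_neg_lt)

lemma dig_add_transitive:
  assumes p: "0 < p" and x: "x < p ^ n"
  shows "\<exists>!h. h < p ^ n \<and> dig_add p n h x = 0"
proof (rule ex1I[of _ "dig_neg p n x"])
  show "dig_neg p n x < p ^ n \<and> dig_add p n (dig_neg p n x) x = 0"
    using p by (simp add: dig_neg_lt dig_add_neg)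
  fix h assume h: "h < p ^ n \<and> dig_add p n h x = 0"
  have "h = dig_add p n (dig_add p n (dig_neg p n x) x) h"
    using p h by (simp add: dig_add_neg dig_add_0)
  also have "\<dots> = dig_add p n (dig_neg p n x) (dig_add p n h x)"
    using p by (simp add: dig_add_assoc dig_add_commute[of p n x h])
  also have "\<dots> = dig_neg p n x"
    using h p dig_neg_lt[OF p] by (simp add: dig_add_commute[of p n _ 0] dig_add_0)
  finally show "h = dig_neg p n x" .
qed


section \<open>The tensor product of minimal resolutions and its coarse flags\<close>

locale digit_translations =
  fixes p n :: nat
  assumes prime_p: "prime p" and n_pos: "0 < n"
begin

abbreviation q :: nat where "q \<equiv> p ^ n"
abbreviation ad :: "nat \<Rightarrow> nat \<Rightarrow> nat" where "ad \<equiv> dig_add p n"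
abbreviation shift :: "nat \<Rightarrow> nat \<Rightarrow> nat" where "shift k \<equiv> ad (p ^ k)"

lemma p_pos: "0 < p" and p_gt_1: "1 < p"
  using prime_p by (auto dest: prime_gt_0_nat prime_gt_1_nat)

lemma q_gt_1: "1 < q"
  using p_gt_1 n_pos by (rule one_less_power)

lemma ad_lt: "ad h x < q"
  by (rule dig_add_lt[OF p_pos])

lemma ad_eq_iff: "x < q \<Longrightarrow> y < q \<Longrightarrow> ad h x = ad h y \<longleftrightarrow> x = y"
  using bij_betw_imp_inj_on[OF dig_add_bij[OF p_pos]] by (auto simp: inj_on_def)

lemma funpow_lt: "x < q \<Longrightarrow> (ad h ^^ j) x < q"
  by (cases j) (simp_all add: ad_lt)

lemma ad_funpow: "(ad h ^^ j) (ad h' x) = ad h' ((ad h ^^ j) x)"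
  by (induction j) (simp_all add: dig_add_left_commute[OF p_pos])

text \<open>In the group ring of the translations the operator of step \<open>k\<close> is $T_k - 1$ or
  $1 + T_k + \dots + T_k^{p-1}$, so that two consecutive steps in the same direction compose to $0$.\<close>

definition step_coeff :: "nat \<Rightarrow> nat \<Rightarrow> nat \<Rightarrow> nat \<Rightarrow> int" where
  "step_coeff k e g h = (if even e then of_bool (h = shift k g) - of_bool (h = g)
     else (\<Sum>j<p. of_bool (h = (shift k ^^ j) g)))"

definition step_op :: "nat \<Rightarrow> nat \<Rightarrow> (nat \<Rightarrow> int) \<Rightarrow> nat \<Rightarrow> int" where
  "step_op k e G g = (if even e then G (shift k g) - G g else (\<Sum>j<p. G ((shift k ^^ j) g)))"

lemma sum_step_coeff:
  assumes g: "g < q"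
  shows "(\<Sum>h<q. step_coeff k e g h * G h) = step_op k e G g"
proof -
  have delta: "(\<Sum>h<q. of_bool (h = y) * G h) = G y" if "y < q" for y
  proof -
    have "(\<Sum>h<q. of_bool (h = y) * G h) = (\<Sum>h\<in>{y}. G h)"
      by (rule sum.mono_neutral_cong_right) (use that in auto)
    then show ?thesis by simp
  qed
  show ?thesis
  proof (cases "even e")
    case True
    then show ?thesis
      using delta[OF ad_lt] delta[OF g]
      by (simp add: step_coeff_def step_op_def left_diff_distrib sum_subtractf)
  next
    case False
    then have "(\<Sum>h<q. step_coeff k e g h * G h) = (\<Sum>h<q. \<Sum>j<p. of_bool (h = (shift k ^^ j) g) * G h)"
      by (simp only: step_coeff_def if_False sum_distrib_right)
    also have "\<dots> = (\<Sum>j<p. \<Sum>h<q. of_bool (h = (shift k ^^ j) g) * G h)"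
      by (rule sum.swap)
    also have "\<dots> = (\<Sum>j<p. G ((shift k ^^ j) g))"
      using delta[OF funpow_lt[OF g]] by simp
    finally show ?thesis using False by (simp add: step_op_def)
  qed
qed

lemma step_coeff_eq_op: "step_coeff k e g h = step_op k e (\<lambda>x. of_bool (h = x)) g"
  by (simp add: step_coeff_def step_op_def)

lemma step_op_commute: "step_op k e (step_op l f G) g = step_op l f (step_op k e G) g"
proof (cases "even e \<or> even f")
  case True
  then show ?thesis
    by (auto simp: step_op_def ad_funpow dig_add_left_commute[OF p_pos] sum_subtractf)
next
  case False
  have "(shift k ^^ i) ((shift l ^^ j) g) = (shift l ^^ j) ((shift k ^^ i) g)" for i j
    by (induction i) (simp_all add: ad_funpow)
  then have "(\<Sum>i<p. \<Sum>j<p. G ((shift l ^^ j) ((shift k ^^ i) g)))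
      = (\<Sum>i<p. \<Sum>j<p. G ((shift k ^^ i) ((shift l ^^ j) g)))"
    by simp
  also have "\<dots> = (\<Sum>j<p. \<Sum>i<p. G ((shift k ^^ i) ((shift l ^^ j) g)))"
    by (rule sum.swap)
  finally show ?thesis using False by (simp add: step_op_def)
qed

text \<open>This is (T - 1)(1 + T + ... + T^(p-1)) = T^p - 1 = 0: the sum telescopes and the p-fold
  shift is the identity.\<close>

lemma step_op_twice:
  assumes "g < q"
  shows "step_op k e (step_op k (Suc e) G) g = 0"
proof -
  have tel: "(\<Sum>j<p. G (shift k ((shift k ^^ j) g))) = (\<Sum>j<p. G ((shift k ^^ j) g))"
  proof -
    have "(\<Sum>j<p. G ((shift k ^^ Suc j) g) - G ((shift k ^^ j) g)) = G ((shift k ^^ p) g) - G ((shift k ^^ 0) g)"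
      by (rule sum_lessThan_telescope)
    then show ?thesis
      using dig_add_order[OF p_pos assms] by (simp add: sum_subtractf)
  qed
  show ?thesis
    using tel by (cases "even e") (simp_all add: step_op_def ad_funpow sum_subtractf)
qed

lemma step_coeff_translate:
  "g < q \<Longrightarrow> g' < q \<Longrightarrow> step_coeff k e (ad h g) (ad h g') = step_coeff k e g g'"
  unfolding step_coeff_def ad_funpow dig_add_left_commute[OF p_pos, of n "p ^ k" h]
  by (simp add: ad_eq_iff ad_lt funpow_lt)

text \<open>For k < n this is (p-1)p^(n-1-k), the number of positive integers below q of p-adic
  valuation k. Written as a difference it telescopes to q - 1, so the top degree is q - 1 and
  contains a single multidegree.\<close>

definition extent :: "nat \<Rightarrow> nat" where
  "extent k = (q - 1) div p ^ k - (q - 1) div p ^ Suc k"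

type_synonym grid_cell = "(nat \<Rightarrow> nat) \<times> nat"

text \<open>A basis over the integers of the degree i part of the truncated tensor product: a
  multidegree together with a group element.\<close>

definition grid_cells :: "nat \<Rightarrow> grid_cell set" where
  "grid_cells i = {d \<in> PiE {..<n} (\<lambda>k. {..extent k}). (\<Sum>k<n. d k) = i} \<times> {..<q}"

definition grid_incidence :: "grid_cell \<Rightarrow> grid_cell \<Rightarrow> int" where
  "grid_incidence x y = (\<Sum>k<n. of_bool (fst y = (fst x)(k := Suc (fst x k)))
     * (- 1) ^ (\<Sum>j<k. fst x j) * step_coeff k (fst x k) (snd x) (snd y))"

text \<open>The constant 1 is the invariant top chain: the sum of all translates of the cell of top
  multidegree.\<close>

definition grid_weight :: "(nat \<Rightarrow> grid_cell) \<Rightarrow> int" where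
  "grid_weight = chain_weight (q - 1) grid_incidence (\<lambda>_. 1)"

definition grid_act :: "nat \<Rightarrow> grid_cell \<Rightarrow> grid_cell" where
  "grid_act h x = (fst x, ad h (snd x))"

lemma grid_cells_iff:
  "x \<in> grid_cells i \<longleftrightarrow> fst x \<in> PiE {..<n} (\<lambda>k. {..extent k}) \<and> (\<Sum>k<n. fst x k) = i \<and> snd x < q"
  by (simp add: grid_cells_def mem_Times_iff)

lemma grid_cell_le_extent: "x \<in> grid_cells i \<Longrightarrow> k < n \<Longrightarrow> fst x k \<le> extent k"
  using PiE_mem[of "fst x" "{..<n}" "\<lambda>k. {..extent k}" k] by (simp add: grid_cells_iff)

lemma finite_grid_cells: "finite (grid_cells i)"
proof -
  have "finite (PiE {..<n} (\<lambda>k. {..extent k}))" by (intro finite_PiE) auto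
  then have "finite {d \<in> PiE {..<n} (\<lambda>k. {..extent k}). (\<Sum>k<n. d k) = i}"
    by (rule rev_finite_subset) blast
  then show ?thesis
    unfolding grid_cells_def by (intro finite_SigmaI) auto
qed

lemma sum_upd: "k < n \<Longrightarrow> (\<Sum>j<n. (d(k := Suc (d k))) j) = Suc (\<Sum>j<n. d j)"
proof -
  assume k: "k < n"
  have "(\<Sum>j<n. (d(k := Suc (d k))) j) = Suc (d k) + (\<Sum>j\<in>{..<n} - {k}. d j)"
    using k by (subst sum.remove[of _ k]) (auto intro!: sum.cong)
  moreover have "(\<Sum>j<n. d j) = d k + (\<Sum>j\<in>{..<n} - {k}. d j)"
    using k by (subst sum.remove[of _ k]) auto
  ultimately show ?thesis by simp
qed

lemma grid_incidence_sum:
  assumes x: "x \<in> grid_cells i"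
  shows "(\<Sum>u\<in>grid_cells (Suc i). grid_incidence x u * H u)
    = (\<Sum>k<n. of_bool (fst x k < extent k) * ((- 1) ^ (\<Sum>j<k. fst x j) *
        step_op k (fst x k) (\<lambda>g. H ((fst x)(k := Suc (fst x k)), g)) (snd x)))"
proof -
  define d where "d = fst x"
  define g where "g = snd x"
  have d: "d \<in> PiE {..<n} (\<lambda>k. {..extent k})" "(\<Sum>k<n. d k) = i" and g: "g < q"
    using x unfolding grid_cells_iff d_def g_def by blast+
  let ?T = "\<lambda>k u. of_bool (fst u = d(k := Suc (d k))) * (- 1) ^ (\<Sum>j<k. d j) * step_coeff k (d k) g (snd u)"
  have "(\<Sum>u\<in>grid_cells (Suc i). grid_incidence x u * H u)
      = (\<Sum>k<n. \<Sum>u\<in>grid_cells (Suc i). ?T k u * H u)"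
    unfolding grid_incidence_def sum_distrib_right d_def g_def by (rule sum.swap)
  also have "\<dots> = (\<Sum>k<n. of_bool (d k < extent k) * ((- 1) ^ (\<Sum>j<k. d j) *
        step_op k (d k) (\<lambda>g. H (d(k := Suc (d k)), g)) g))"
  proof (rule sum.cong[OF refl])
    fix k assume "k \<in> {..<n}"
    then have k: "k < n" by simp
    show "(\<Sum>u\<in>grid_cells (Suc i). ?T k u * H u)
      = of_bool (d k < extent k) * ((- 1) ^ (\<Sum>j<k. d j) * step_op k (d k) (\<lambda>g. H (d(k := Suc (d k)), g)) g)"
    proof (cases "d k < extent k")
      case True
      have d': "d(k := Suc (d k)) \<in> PiE {..<n} (\<lambda>k. {..extent k})"
        using d(1) k True by (simp add: PiE_iff extensional_def)
      have "(\<Sum>u\<in>grid_cells (Suc i). ?T k u * H u)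
          = (\<Sum>u\<in>Pair (d(k := Suc (d k))) ` {..<q}. (- 1) ^ (\<Sum>j<k. d j) * (step_coeff k (d k) g (snd u) * H u))"
      proof (rule sum.mono_neutral_cong_right[OF finite_grid_cells])
        have "(d(k := Suc (d k)), h) \<in> grid_cells (Suc i)" if "h < q" for h
          unfolding grid_cells_iff fst_conv snd_conv sum_upd[OF k] d(2) using d' that by blast
        then show "Pair (d(k := Suc (d k))) ` {..<q} \<subseteq> grid_cells (Suc i)"
          by blast
        show "\<forall>u\<in>grid_cells (Suc i) - Pair (d(k := Suc (d k))) ` {..<q}. ?T k u * H u = 0"
        proof
          fix u assume u: "u \<in> grid_cells (Suc i) - Pair (d(k := Suc (d k))) ` {..<q}"
          have "fst u \<noteq> d(k := Suc (d k))"
          proof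
            assume "fst u = d(k := Suc (d k))"
            then have "u = Pair (d(k := Suc (d k))) (snd u)" by (metis prod.collapse)
            moreover have "snd u < q" using u by (simp add: grid_cells_iff)
            ultimately show False using u by blast
          qed
          then show "?T k u * H u = 0" by simp
        qed
      qed auto
      also have "\<dots> = (- 1) ^ (\<Sum>j<k. d j) * (\<Sum>h<q. step_coeff k (d k) g h * H (d(k := Suc (d k)), h))"
        by (subst sum.reindex) (simp_all add: inj_on_def sum_distrib_left)
      also have "\<dots> = (- 1) ^ (\<Sum>j<k. d j) * step_op k (d k) (\<lambda>g. H (d(k := Suc (d k)), g)) g"
        unfolding sum_step_coeff[OF g] ..
      finally show ?thesis using True by simp
    next
      case False
      have "fst u \<noteq> d(k := Suc (d k))" if u: "u \<in> grid_cells (Suc i)" for u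
      proof
        assume "fst u = d(k := Suc (d k))"
        then have "Suc (d k) = fst u k" by simp
        also have "fst u k \<le> extent k" using u k by (rule grid_cell_le_extent)
        finally show False using False by simp
      qed
      then have "(\<Sum>u\<in>grid_cells (Suc i). ?T k u * H u) = 0"
        by (intro sum.neutral) simp
      with False show ?thesis by simp
    qed
  qed
  finally show ?thesis unfolding d_def g_def .
qed

text \<open>Two different directions cancel by the Koszul sign, because the step operators commute.
  Unlike for cubes, the same direction can occur twice, and then \<open>step_op_twice\<close>
  applies.\<close>

lemma grid_incidence_twice:
  assumes x: "x \<in> grid_cells i" and y: "y \<in> grid_cells (Suc (Suc i))"
  shows "(\<Sum>u\<in>grid_cells (Suc i). grid_incidence x u * grid_incidence u y) = 0"
proof -
  define d where "d = fst x"
  define g where "g = snd x"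
  have g: "g < q" using x by (simp add: grid_cells_iff g_def)
  define up where "up k d = d(k := Suc (d k))" for k and d :: "nat \<Rightarrow> nat"
  define sg where "sg k d = (- 1 :: int) ^ (\<Sum>j<k. d j)" for k and d :: "nat \<Rightarrow> nat"
  define A where "A k l = of_bool (fst y = up l (up k d)) * (sg k d * sg l (up k d) *
      step_op k (d k) (step_op l (up k d l) (\<lambda>x. of_bool (snd y = x))) g)" for k l
  have sg_up: "sg l (up k d) = (if k < l then - sg l d else sg l d)" for k l
  proof (cases "k < l")
    case True
    have "(\<Sum>j<l. up k d j) = Suc (d k) + (\<Sum>j\<in>{..<l} - {k}. d j)"
      using True unfolding up_def by (subst sum.remove[of _ k]) (auto intro!: sum.cong)
    moreover have "(\<Sum>j<l. d j) = d k + (\<Sum>j\<in>{..<l} - {k}. d j)"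
      using True by (subst sum.remove[of _ k]) auto
    ultimately show ?thesis using True by (simp add: sg_def)
  next
    case False
    then have "(\<Sum>j<l. up k d j) = (\<Sum>j<l. d j)"
      unfolding up_def by (intro sum.cong) auto
    with False show ?thesis by (simp add: sg_def)
  qed
  have anti: "A l k = - A k l" for k l
  proof (cases "k = l")
    case True
    then show ?thesis using step_op_twice[OF g] by (simp add: A_def up_def)
  next
    case False
    have "up l (up k d) = up k (up l d)" "up k d l = d l" "up l d k = d k"
      using False by (simp_all add: up_def fun_upd_twist)
    moreover have "sg l d * sg k (up l d) = - (sg k d * sg l (up k d))"
      using False by (auto simp: sg_up)
    ultimately show ?thesis
      by (simp add: A_def step_op_commute[of l])
  qed
  have "(\<Sum>u\<in>grid_cells (Suc i). grid_incidence x u * grid_incidence u y)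
      = (\<Sum>k<n. of_bool (d k < extent k) * (sg k d * step_op k (d k) (\<lambda>g. grid_incidence (up k d, g) y) g))"
    unfolding grid_incidence_sum[OF x] d_def g_def sg_def up_def ..
  also have "\<dots> = (\<Sum>k<n. \<Sum>l<n. A k l)"
  proof (rule sum.cong[OF refl])
    fix k assume "k \<in> {..<n}"
    then have k: "k < n" by simp
    have inc: "grid_incidence (up k d, h) y = (\<Sum>l<n. of_bool (fst y = up l (up k d)) * sg l (up k d) *
        step_op l (up k d l) (\<lambda>x. of_bool (snd y = x)) h)" for h
      unfolding grid_incidence_def fst_conv snd_conv step_coeff_eq_op up_def sg_def ..
    have lin: "step_op k e (\<lambda>h. \<Sum>l<n. c l * G l h) g = (\<Sum>l<n. c l * step_op k e (G l) g)" for e c G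
    proof (cases "even e")
      case False
      have "(\<Sum>j<p. \<Sum>l<n. c l * G l ((shift k ^^ j) g)) = (\<Sum>l<n. \<Sum>j<p. c l * G l ((shift k ^^ j) g))"
        by (rule sum.swap)
      with False show ?thesis by (simp add: step_op_def sum_distrib_left)
    qed (simp add: step_op_def sum_subtractf right_diff_distrib)
    \<comment> \<open>Since y lies within the extents, so does the intermediate cell; the truncation
      removes nothing.\<close>
    have "of_bool (d k < extent k) * A k l = A k l" for l
    proof (cases "fst y = up l (up k d)")
      case True
      have "d k < fst y k" unfolding True up_def by simp
      also have "fst y k \<le> extent k" using y k by (rule grid_cell_le_extent)
      finally show ?thesis by simp
    qed (simp add: A_def)
    then have gate: "(\<Sum>l<n. A k l) = of_bool (d k < extent k) * (\<Sum>l<n. A k l)"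
      by (simp only: sum_distrib_left)
    have eq: "(\<Sum>l<n. A k l) = sg k d * step_op k (d k) (\<lambda>g. grid_incidence (up k d, g) y) g"
      unfolding inc lin A_def sum_distrib_left by (rule sum.cong) (simp_all add: mult_ac)
    show "of_bool (d k < extent k) * (sg k d * step_op k (d k) (\<lambda>g. grid_incidence (up k d, g) y) g)
        = (\<Sum>l<n. A k l)"
      using gate unfolding eq by simp
  qed
  finally have eq: "(\<Sum>u\<in>grid_cells (Suc i). grid_incidence x u * grid_incidence u y) = (\<Sum>k<n. \<Sum>l<n. A k l)" .
  have "(\<Sum>k<n. \<Sum>l<n. A k l) = (\<Sum>l<n. \<Sum>k<n. A k l)"
    by (rule sum.swap)
  also have "\<dots> = (\<Sum>l<n. \<Sum>k<n. - A l k)"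
    by (subst anti) simp
  also have "\<dots> = - (\<Sum>l<n. \<Sum>k<n. A l k)"
    by (simp add: sum_negf)
  finally show ?thesis unfolding eq by simp
qed

text \<open>In degree 0 every step operator is T - 1, and its column sums vanish because a
  translation is a bijection.\<close>

lemma grid_incidence_bottom:
  assumes y: "y \<in> grid_cells (Suc 0)"
  shows "(\<Sum>x\<in>grid_cells 0. grid_incidence x y) = 0"
proof -
  define z where "z = (\<lambda>k\<in>{..<n}. 0 :: nat)"
  have "{d \<in> PiE {..<n} (\<lambda>k. {..extent k}). (\<Sum>k<n. d k) = 0} = {z}"
  proof (intro equalityI subsetI)
    fix d assume d: "d \<in> {d \<in> PiE {..<n} (\<lambda>k. {..extent k}). (\<Sum>k<n. d k) = 0}"
    then have "d = z"
      by (intro extensionalityI[of d "{..<n}" z]) (auto simp: z_def PiE_iff)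
    then show "d \<in> {z}" by simp
  qed (auto simp: z_def)
  then have "grid_cells 0 = Pair z ` {..<q}"
    unfolding grid_cells_def by auto
  then have "(\<Sum>x\<in>grid_cells 0. grid_incidence x y) = (\<Sum>g<q. grid_incidence (z, g) y)"
    by (simp add: sum.reindex inj_on_def)
  also have "\<dots> = (\<Sum>k<n. \<Sum>g<q. of_bool (fst y = z(k := Suc (z k)))
     * (- 1) ^ (\<Sum>j<k. z j) * step_coeff k (z k) g (snd y))"
    unfolding grid_incidence_def fst_conv snd_conv by (rule sum.swap)
  also have "\<dots> = 0"
  proof (rule sum.neutral, rule ballI)
    fix k assume "k \<in> {..<n}"
    then have zk: "z k = 0" by (simp add: z_def)
    have sy: "snd y < q" using y by (simp add: grid_cells_iff)
    have "(\<Sum>g<q. of_bool (snd y = shift k g) :: int) = (\<Sum>g<q. of_bool (snd y = g))"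
      by (rule sum.reindex_bij_betw[OF dig_add_bij[OF p_pos]])
    then have "(\<Sum>g<q. step_coeff k (z k) g (snd y)) = 0"
      unfolding zk step_coeff_def by (simp add: sum_subtractf)
    then show "(\<Sum>g<q. of_bool (fst y = z(k := Suc (z k))) * (- 1) ^ (\<Sum>j<k. z j) * step_coeff k (z k) g (snd y)) = 0"
      by (simp only: sum_distrib_left[symmetric] mult_zero_right)
  qed
  finally show ?thesis .
qed

text \<open>On a constant function T - 1 gives 0 and the norm multiplies by p. This is why the top
  chain is in general a cycle only modulo p.\<close>

lemma grid_incidence_top:
  assumes x: "x \<in> grid_cells i"
  shows "int p dvd (\<Sum>u\<in>grid_cells (Suc i). grid_incidence x u * 1)"
  unfolding grid_incidence_sum[OF x]
  by (intro dvd_sum dvd_mult) (simp add: step_op_def)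

lemma grid_incidence_act:
  assumes "snd x < q" "snd y < q"
  shows "grid_incidence (grid_act h x) (grid_act h y) = grid_incidence x y"
  unfolding grid_incidence_def grid_act_def fst_conv snd_conv step_coeff_translate[OF assms] ..

sublocale grid: weighted_flags q p grid_cells grid_weight ad "dig_neg p n" grid_act "\<lambda>_. snd"
proof
  show "0 < q" using p_pos by simp
  show "finite (grid_cells i)" for i by (rule finite_grid_cells)
  show "bij_betw (ad h) {..<q} {..<q}" for h by (rule dig_add_bij[OF p_pos])
  show "[sign_on {..<q} (ad h) = 1] (mod int p)" for h by (rule dig_add_sign[OF prime_p])
  show "\<exists>!h. h < q \<and> ad h x = 0" if "x < q" for x using that by (rule dig_add_transitive[OF p_pos])
  show "bij_betw (dig_neg p n) {..<q} {..<q}" by (rule dig_neg_bij[OF p_pos])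
  show "grid_act h v \<in> grid_cells i" if "v \<in> grid_cells i" for h i v
    using that ad_lt by (simp add: grid_cells_iff grid_act_def)
  show "grid_act h (grid_act (dig_neg p n h) v) = v" "grid_act (dig_neg p n h) (grid_act h v) = v"
    if "v \<in> grid_cells i" for h i v
  proof -
    have v: "snd v < q" using that by (simp add: grid_cells_iff)
    have "ad (dig_neg p n h) (ad h (snd v)) = snd v"
      using v by (simp add: dig_add_neg dig_add_0 p_pos flip: dig_add_assoc)
    then show "grid_act h (grid_act (dig_neg p n h) v) = v" "grid_act (dig_neg p n h) (grid_act h v) = v"
      using dig_add_left_commute[OF p_pos, of n h "dig_neg p n h"] by (simp_all add: grid_act_def)
  qed
  show "grid_weight (\<lambda>i\<in>{..<q}. grid_act h (s i)) = grid_weight s" if s: "s \<in> PiE {..<q} grid_cells" for h s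
  proof -
    have "snd (s i) < q" if "i < q" for i
      using PiE_mem[OF s, of i] that by (simp add: grid_cells_iff)
    then have "grid_incidence ((\<lambda>i\<in>{..<q}. grid_act h (s i)) i) ((\<lambda>i\<in>{..<q}. grid_act h (s i)) (Suc i))
        = grid_incidence (s i) (s (Suc i))" if "i < q - 1" for i
    proof -
      have "i < q" "Suc i < q" using that by linarith+
      then show ?thesis using \<open>\<And>i. i < q \<Longrightarrow> snd (s i) < q\<close> by (simp add: grid_incidence_act)
    qed
    moreover have "q - 1 < q" using p_pos by simp
    ultimately show ?thesis unfolding grid_weight_def chain_weight_def by simp
  qed
  show "int p dvd (\<Sum>x\<in>grid_cells i. grid_weight (s(i := x)))"
    if i: "i < q" and s: "s \<in> PiE {..<q} grid_cells" for i s
    unfolding grid_weight_def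
  proof (rule chain_weight_cycle)
    show "int p dvd (\<Sum>x\<in>grid_cells 0. grid_incidence x y)" if "y \<in> grid_cells (Suc 0)" for y
      using grid_incidence_bottom[OF that] by simp
    show "int p dvd (\<Sum>u\<in>grid_cells (Suc i). grid_incidence x u * grid_incidence u y)"
      if "x \<in> grid_cells i" "y \<in> grid_cells (Suc (Suc i))" for i x y
      using grid_incidence_twice[OF that] by simp
    have "Suc (q - 1 - 1) = q - 1" using q_gt_1 by linarith
    then show "int p dvd (\<Sum>u\<in>grid_cells (q - 1). grid_incidence x u * 1)" if "x \<in> grid_cells (q - 1 - 1)" for x
      using grid_incidence_top[OF that] by (simp only:)
    show "s i \<in> grid_cells i" if "i \<le> q - 1" for i
      using PiE_mem[OF s, of i] that q_gt_1 by simp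
  qed (use i q_gt_1 in simp_all)
  show "snd v < q" if "v \<in> grid_cells i" for i v
    using that by (simp add: grid_cells_iff)
  show "snd (grid_act h v) = ad h (snd v)" for h v
    by (simp add: grid_act_def)
qed

end

section \<open>Signs of permutations acting in blocks\<close>

lemma sign_blocks:
  assumes "finite C" "finite A"
    and "\<And>c c' a a'. c \<in> C \<Longrightarrow> c' \<in> C \<Longrightarrow> a \<in> A \<Longrightarrow> a' \<in> A \<Longrightarrow> f c a = f c' a' \<Longrightarrow> c = c' \<and> a = a'"
    and "\<And>c. c \<in> C \<Longrightarrow> \<sigma> c permutes A"
    and "\<And>c a. c \<in> C \<Longrightarrow> a \<in> A \<Longrightarrow> F (f c a) = f c (\<sigma> c a)"
    and "\<And>x. x \<notin> (\<Union>c\<in>C. f c ` A) \<Longrightarrow> F x = x"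
  shows "permutation F \<and> sign F = (\<Prod>c\<in>C. sign (\<sigma> c))"
  using assms(1,3-)
proof (induction C arbitrary: F rule: finite_induct)
  case empty
  then have "F = id" by (simp add: fun_eq_iff)
  then show ?case by simp
next
  case (insert c C)
  note inj = insert.prems(1) and perm = insert.prems(2) and blocks = insert.prems(3) and fixed = insert.prems(4)
  let ?M = "map_permutation A (f c) (\<sigma> c)"
  \<comment> \<open>F splits as \<open>G \<circ> ?M\<close>: the second factor acts on the block c
    alone, and G fixes that block and agrees with F elsewhere.\<close>
  define G where "G x = (if x \<in> f c ` A then x else F x)" for x
  have fc: "inj_on (f c) A" by (rule inj_onI) (use inj in blast)
  have "permutation G \<and> sign G = (\<Prod>c\<in>C. sign (\<sigma> c))"
  proof (rule insert.IH)
    show "G (f c' a) = f c' (\<sigma> c' a)" if "c' \<in> C" "a \<in> A" for c' a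
    proof -
      have "f c' a \<notin> f c ` A"
      proof
        assume "f c' a \<in> f c ` A"
        then obtain a' where "a' \<in> A" "f c' a = f c a'" by blast
        then have "c' = c" using inj[of c' c a a'] that by simp
        with that insert.hyps(2) show False by simp
      qed
      then show ?thesis using blocks[of c' a] that by (simp add: G_def)
    qed
    show "G x = x" if "x \<notin> (\<Union>c\<in>C. f c ` A)" for x
    proof (cases "x \<in> f c ` A")
      case False
      then have "x \<notin> (\<Union>c\<in>insert c C. f c ` A)" using that by simp
      from fixed[OF this] False show ?thesis by (simp add: G_def)
    qed (simp add: G_def)
    show "c1 = c2 \<and> a = a'" if "c1 \<in> C" "c2 \<in> C" "a \<in> A" "a' \<in> A" "f c1 a = f c2 a'" for c1 c2 a a'
      by (rule inj) (use that in simp_all)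
    show "\<sigma> c' permutes A" if "c' \<in> C" for c'
      by (rule perm) (use that in simp)
  qed
  moreover have "?M permutes f c ` A"
    by (rule map_permutation_permutes) (use fc perm in \<open>auto simp: bij_betw_def\<close>)
  then have "permutation ?M"
    using \<open>finite A\<close> by (intro permutes_imp_permutation[of "f c ` A"]) auto
  moreover have "sign ?M = sign (\<sigma> c)"
    by (rule sign_map_permutation[OF fc _ \<open>finite A\<close>]) (use perm in blast)
  moreover have "F = G \<circ> ?M"
  proof
    fix x
    show "F x = (G \<circ> ?M) x"
    proof (cases "x \<in> f c ` A")
      case True
      then obtain a where a: "a \<in> A" "x = f c a" by blast
      have "?M x = f c (\<sigma> c a)"
        using a fc by (simp add: map_permutation_def restrict_id_def)
      moreover have "\<sigma> c a \<in> A" using perm[of c] a permutes_in_image by fastforce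
      ultimately show ?thesis using a blocks[of c a] by (simp add: G_def)
    next
      case False
      then have "?M x = x" by (simp add: map_permutation_def restrict_id_def)
      with False show ?thesis by (simp add: G_def)
    qed
  qed
  moreover have "(\<Prod>c\<in>insert c C. sign (\<sigma> c)) = sign (\<sigma> c) * (\<Prod>c\<in>C. sign (\<sigma> c))"
    using insert.hyps by simp
  ultimately show ?case
    using permutation_compose[of G ?M] sign_compose[of G ?M] by (metis mult.commute)
qed

lemma sgn_map_blocks:
  assumes fin: "finite C" "finite A"
    and inj: "\<And>c c' a a'. c \<in> C \<Longrightarrow> c' \<in> C \<Longrightarrow> a \<in> A \<Longrightarrow> a' \<in> A \<Longrightarrow> f c a = f c' a' \<Longrightarrow> c = c' \<and> a = a'"
    and \<tau>: "\<And>c. c \<in> C \<Longrightarrow> bij_betw (\<tau> c) A A"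
    and g: "\<And>c a. c \<in> C \<Longrightarrow> a \<in> A \<Longrightarrow> f c a < N \<and> g (f c a) = f c (\<tau> c a)"
    and fixed: "\<And>x. x < N \<Longrightarrow> x \<notin> (\<Union>c\<in>C. f c ` A) \<Longrightarrow> g x = x"
  shows "bij_betw g {..<N} {..<N} \<and> sgn_map N g = (\<Prod>c\<in>C. sign_on A (\<tau> c))"
proof -
  let ?F = "restrict_id g {..<N}"
  have "permutation ?F \<and> sign ?F = (\<Prod>c\<in>C. sign (restrict_id (\<tau> c) A))"
  proof (rule sign_blocks[OF fin inj, where f = f])
    show "restrict_id (\<tau> c) A permutes A" if "c \<in> C" for c
      by (rule permutes_restrict_id[OF \<tau>[OF that]])
    show "?F (f c a) = f c (restrict_id (\<tau> c) A a)" if "c \<in> C" "a \<in> A" for c a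
      using g[OF that] that by (simp add: restrict_id_def)
    show "?F x = x" if "x \<notin> (\<Union>c\<in>C. f c ` A)" for x
      using fixed[OF _ that] by (simp add: restrict_id_def)
  qed auto
  then have F: "permutation ?F" "sign ?F = (\<Prod>c\<in>C. sign_on A (\<tau> c))"
    by (simp_all add: sign_on_def)
  have "inj_on ?F {..<N}"
    using permutation_bijective[OF F(1)] by (auto simp: bij_def intro: inj_on_subset)
  then have inj_g: "inj_on g {..<N}"
    by (rule inj_on_cong[THEN iffD1, rotated]) (simp add: restrict_id_def)
  have "g x < N" if "x < N" for x
  proof (cases "x \<in> (\<Union>c\<in>C. f c ` A)")
    case True
    then obtain c a where ca: "c \<in> C" "a \<in> A" "x = f c a" by blast
    then have "\<tau> c a \<in> A" using \<tau> by (auto simp: bij_betw_def)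
    with g ca show ?thesis by metis
  qed (use fixed that in simp)
  then have "g ` {..<N} \<subseteq> {..<N}" by auto
  with inj_g have bij: "bij_betw g {..<N} {..<N}"
    by (simp add: bij_betw_def endo_inj_surj)
  then show ?thesis
    using F(2) by (simp add: sgn_map_def sign_on_def)
qed

lemma mixed_radix_inj:
  "c < p \<Longrightarrow> c' < p \<Longrightarrow> c + p * h = c' + p * h' \<Longrightarrow> c = c' \<and> h = (h' :: nat)"
proof -
  assume c: "c < p" "c' < p" and eq: "c + p * h = c' + p * h'"
  from arg_cong[OF eq, of "\<lambda>x. x mod p"] c have "c = c'" by simp
  with eq c show ?thesis by simp
qed

lemma mixed_radix_lt: "c < p \<Longrightarrow> h < Q \<Longrightarrow> c + p * h < p * (Q :: nat)"
proof -
  assume c: "c < p" and h: "h < Q"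
  then have "c + p * h < p * Suc h" by simp
  also have "\<dots> \<le> p * Q" using h by (intro mult_le_mono2) simp
  finally show ?thesis .
qed

lemma mixed_radix_cover:
  assumes "x < p * (Q :: nat)"
  shows "x mod p < p" "x div p < Q" "x = x mod p + p * (x div p)"
  using assms by (cases "p = 0"; simp add: less_mult_imp_div_less mult.commute)+

text \<open>The map is F after D. D moves whole blocks by g', once for each residue, so its sign is
  a power of the sign of g'. F then acts inside the blocks, where \<open>inv\<close> recovers the
  block from which the points came.\<close>

lemma sgn_map_blockwise:
  assumes g': "bij_betw g' {..<Q} {..<Q}"
    and A: "\<And>b. b < Q \<Longrightarrow> bij_betw (\<lambda>c. A (p * b + c)) {..<p} {..<p}"
    and even: "\<And>b. b < Q \<Longrightarrow> sgn_map p (\<lambda>c. A (p * b + c)) = 1"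
    and "odd p" and sg: "sgn_map Q g' = 1"
  shows "sgn_map (p * Q) (\<lambda>t. A t + p * g' (t div p)) = 1"
proof -
  define inv where "inv = inv_into {..<Q} g'"
  have inv: "inv (g' h) = h" if "h < Q" for h
    using g' that by (simp add: inv_def bij_betw_def inv_into_f_f)
  have inv_lt: "inv h < Q" if "h < Q" for h
    using bij_betw_inv_into[OF g'] that by (auto simp: inv_def bij_betw_def)
  define D where "D t = t mod p + p * g' (t div p)" for t
  define F where "F x = A (p * inv (x div p) + x mod p) + p * (x div p)" for x
  have "bij_betw D {..<p * Q} {..<p * Q} \<and> sgn_map (p * Q) D = (\<Prod>c<p. sign_on {..<Q} g')"
  proof (rule sgn_map_blocks[of "{..<p}" "{..<Q}" "\<lambda>c h. c + p * h"])
    show "c + p * h < p * Q \<and> D (c + p * h) = c + p * g' h" if "c \<in> {..<p}" "h \<in> {..<Q}" for c h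
      using that mixed_radix_lt by (auto simp: D_def)
    show "D x = x" if "x < p * Q" "x \<notin> (\<Union>c<p. (\<lambda>h. c + p * h) ` {..<Q})" for x
      using that mixed_radix_cover[OF that(1)] by blast
    show "c = c' \<and> h = h'" if "c \<in> {..<p}" "c' \<in> {..<p}" "c + p * h = c' + p * h'" for c c' h h'
      using mixed_radix_inj[of c p c' h h'] that by simp
  qed (use g' in simp_all)
  then have D: "bij_betw D {..<p * Q} {..<p * Q}" "sgn_map (p * Q) D = (\<Prod>c<p. sign_on {..<Q} g')"
    by blast+
  have "bij_betw F {..<p * Q} {..<p * Q} \<and> sgn_map (p * Q) F = (\<Prod>h<Q. sign_on {..<p} (\<lambda>c. A (p * inv h + c)))"
  proof (rule sgn_map_blocks[of "{..<Q}" "{..<p}" "\<lambda>h c. c + p * h"])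
    show "c + p * h < p * Q \<and> F (c + p * h) = A (p * inv h + c) + p * h" if "h \<in> {..<Q}" "c \<in> {..<p}" for c h
      using that mixed_radix_lt by (auto simp: F_def)
    show "F x = x" if "x < p * Q" "x \<notin> (\<Union>h<Q. (\<lambda>c. c + p * h) ` {..<p})" for x
      using that mixed_radix_cover[OF that(1)] by blast
    show "bij_betw (\<lambda>c. A (p * inv h + c)) {..<p} {..<p}" if "h \<in> {..<Q}" for h
      using A[OF inv_lt] that by simp
    show "h = h' \<and> c = c'" if "c \<in> {..<p}" "c' \<in> {..<p}" "c + p * h = c' + p * h'" for c c' h h'
      using mixed_radix_inj[of c p c' h h'] that by simp
  qed simp_all
  then have F: "bij_betw F {..<p * Q} {..<p * Q}" "sgn_map (p * Q) F = (\<Prod>h<Q. sign_on {..<p} (\<lambda>c. A (p * inv h + c)))"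
    by blast+
  have "sgn_map (p * Q) F = 1"
    unfolding F(2) using even[OF inv_lt] A[OF inv_lt] by (intro prod.neutral) (auto simp: sgn_map_def)
  moreover have "sgn_map (p * Q) D = 1"
    unfolding D(2) using sg g' by (simp add: sgn_map_def)
  moreover have "sgn_map (p * Q) (\<lambda>t. F (D t)) = sign_on {..<p * Q} F * sgn_map (p * Q) D"
    by (rule sgn_map_comp[OF F(1)]) (use D(1) in \<open>auto simp: bij_betw_def\<close>)
  moreover have "sgn_map (p * Q) (\<lambda>t. A t + p * g' (t div p)) = sgn_map (p * Q) (\<lambda>t. F (D t))"
  proof (rule sgn_map_cong)
    fix t assume t: "t < p * Q"
    note c = mixed_radix_cover[OF t]
    have "D t div p = g' (t div p)" "D t mod p = t mod p"
      using c(1) by (simp_all add: D_def)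
    then show "A t + p * g' (t div p) = F (D t)"
      using inv[OF c(2)] c(3) by (simp add: F_def add.commute)
  qed
  ultimately show ?thesis using F(1) by (simp add: sgn_map_def)
qed

section \<open>Paths of the lowest digit\<close>

definition paired :: "nat \<Rightarrow> (nat \<Rightarrow> nat) \<Rightarrow> nat \<Rightarrow> nat" where
  "paired m \<pi> = (\<lambda>c\<in>{..<Suc (2 * m)}. if c = 2 * m then c else c mod 2 + 2 * \<pi> (c div 2))"

text \<open>Below 2 * m the permutation \<pi> acts once on the even and once on the odd points, so
  its sign enters squared.\<close>

lemma paired_sign:
  assumes \<pi>: "bij_betw \<pi> {..<m} {..<m}"
  shows "bij_betw (paired m \<pi>) {..<Suc (2 * m)} {..<Suc (2 * m)}" "sgn_map (Suc (2 * m)) (paired m \<pi>) = 1"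
proof -
  have "bij_betw (paired m \<pi>) {..<Suc (2 * m)} {..<Suc (2 * m)} \<and>
      sgn_map (Suc (2 * m)) (paired m \<pi>) = (\<Prod>c<2::nat. sign_on {..<m} \<pi>)"
  proof (rule sgn_map_blocks[of "{..<2}" "{..<m}" "\<lambda>c h. c + 2 * h"])
    show "c + 2 * h < Suc (2 * m) \<and> paired m \<pi> (c + 2 * h) = c + 2 * \<pi> h" if "c \<in> {..<2}" "h \<in> {..<m}" for c h
      using that mixed_radix_lt[of c 2 h m] by (auto simp: paired_def)
    show "paired m \<pi> x = x" if "x < Suc (2 * m)" "x \<notin> (\<Union>c<2. (\<lambda>h. c + 2 * h) ` {..<m})" for x
    proof (cases "x = 2 * m")
      case False
      then have "x < 2 * m" using that by simp
      from mixed_radix_cover[OF this] that(2) show ?thesis by blast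
    qed (simp add: paired_def)
    show "c = c' \<and> h = h'" if "c \<in> {..<2}" "c' \<in> {..<2}" "c + 2 * h = c' + 2 * h'" for c c' h h' :: nat
      using mixed_radix_inj[of c 2 c' h h'] that by simp
  qed (use \<pi> in simp_all)
  moreover have "(\<Prod>c<2::nat. sign_on {..<m} \<pi>) = 1"
    by (simp add: power2_eq_square sign_on_def)
  ultimately show "bij_betw (paired m \<pi>) {..<Suc (2 * m)} {..<Suc (2 * m)}"
    "sgn_map (Suc (2 * m)) (paired m \<pi>) = 1" by simp_all
qed

text \<open>The lowest digit at the times p * b + c. The number p * b + c - b counts the earlier
  steps in direction 0: if it is even the operator is T - 1 and the digit must grow by one, if it is
  odd the operator is the norm and any digit is allowed.\<close>

definition block_paths :: "nat \<Rightarrow> nat \<Rightarrow> nat \<Rightarrow> (nat \<Rightarrow> nat) set" where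
  "block_paths p b x = {y \<in> PiE {..<p} (\<lambda>_. {..<p}). inj_on y {..<p} \<and> y 0 = x \<and>
     (\<forall>c. Suc c < p \<longrightarrow> even (p * b + c - b) \<longrightarrow> y (Suc c) = Suc (y c) mod p)}"

text \<open>For odd p the parity no longer depends on the block. Prescribing the value at an
  arbitrary place k allows a path to be normalised at its end, where its structure is
  visible.\<close>

definition based_paths :: "nat \<Rightarrow> nat \<Rightarrow> nat \<Rightarrow> (nat \<Rightarrow> nat) set" where
  "based_paths p k x = {y \<in> PiE {..<p} (\<lambda>_. {..<p}). inj_on y {..<p} \<and> y k = x \<and>
     (\<forall>c. Suc c < p \<longrightarrow> even c \<longrightarrow> y (Suc c) = Suc (y c) mod p)}"

lemma block_paths_odd: "odd p \<Longrightarrow> block_paths p b x = based_paths p 0 x"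
proof -
  assume "odd p"
  then obtain m where m: "p = 2 * m + 1" by (rule oddE)
  have "p * b + c - b = 2 * (m * b) + c" for c
    by (simp add: m algebra_simps)
  then have "even (p * b + c - b) \<longleftrightarrow> even c" for c by simp
  then show ?thesis by (simp add: block_paths_def based_paths_def)
qed

lemma add_mod_cancel: "(a + s) mod p = (b + s) mod p \<Longrightarrow> a < p \<Longrightarrow> b < p \<Longrightarrow> a = (b :: nat)"
  using cong_add_rcancel_nat[of a s b p] cong_less_modulus_unique_nat[of a b p] by (simp add: cong_def)

definition rotated :: "nat \<Rightarrow> nat \<Rightarrow> (nat \<Rightarrow> nat) \<Rightarrow> nat \<Rightarrow> nat" where
  "rotated p s y = (\<lambda>c\<in>{..<p}. (y c + s) mod p)"

text \<open>The step condition is invariant under adding a constant modulo p. The constant is chosen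
  to take the value at k' to x'; the summand p keeps the natural subtraction exact.\<close>

lemma rotated_based:
  assumes y: "y \<in> based_paths p k x" and k: "k' < p" and x': "x' < p"
  shows "rotated p (x' + p - y k') y \<in> based_paths p k' x'"
proof -
  have yp: "y \<in> PiE {..<p} (\<lambda>_. {..<p})" "inj_on y {..<p}"
    and step: "\<And>c. Suc c < p \<Longrightarrow> even c \<Longrightarrow> y (Suc c) = Suc (y c) mod p"
    using y by (simp_all add: based_paths_def)
  have lt: "y c < p" if "c < p" for c using PiE_mem[OF yp(1), of c] that by simp
  let ?s = "x' + p - y k'"
  have "inj_on (rotated p ?s y) {..<p}"
  proof (rule inj_onI)
    fix c c' assume c: "c \<in> {..<p}" "c' \<in> {..<p}" and eq: "rotated p ?s y c = rotated p ?s y c'"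
    then have "y c = y c'" using add_mod_cancel[of "y c" ?s p "y c'"] lt by (simp add: rotated_def)
    with inj_onD[OF yp(2)] c show "c = c'" by blast
  qed
  moreover have "rotated p ?s y k' = x'"
  proof -
    have "y k' + ?s = x' + p" using lt[OF k] by simp
    then show ?thesis using k x' by (simp add: rotated_def)
  qed
  moreover have "rotated p ?s y (Suc c) = Suc (rotated p ?s y c) mod p" if c: "Suc c < p" "even c" for c
  proof -
    have "(Suc (y c) mod p + ?s) mod p = (Suc (y c) + ?s) mod p"
      by (rule mod_add_left_eq)
    then show ?thesis
      using step[OF c] c(1) by (simp add: rotated_def mod_Suc_eq)
  qed
  moreover have "rotated p ?s y \<in> PiE {..<p} (\<lambda>_. {..<p})"
    using k by (simp add: rotated_def PiE_iff)
  ultimately show ?thesis by (simp add: based_paths_def)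
qed

text \<open>The rotation depends on the path, but two paths with the same value at k and the same
  image must have been rotated by congruent amounts.\<close>

lemma rotated_based_inj:
  assumes k: "k < p" and k': "k' < p"
  shows "inj_on (\<lambda>y. rotated p (x' + p - y k') y) (based_paths p k x)"
proof (rule inj_onI)
  fix y z assume yz: "y \<in> based_paths p k x" "z \<in> based_paths p k x"
    and eq: "rotated p (x' + p - y k') y = rotated p (x' + p - z k') z"
  have yP: "y \<in> PiE {..<p} (\<lambda>_. {..<p})" and zP: "z \<in> PiE {..<p} (\<lambda>_. {..<p})" and yk: "y k = x" "z k = x"
    using yz by (simp_all add: based_paths_def)
  have lt: "y c < p" "z c < p" if "c < p" for c
    using PiE_mem[OF yP, of c] PiE_mem[OF zP, of c] that by simp_all
  let ?s = "x' + p - y k'" and ?t = "x' + p - z k'"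
  have e: "(y c + ?s) mod p = (z c + ?t) mod p" if "c < p" for c
    using fun_cong[OF eq, of c] that by (simp add: rotated_def)
  have "[?s = ?t] (mod p)"
    using e[OF k] yk by (simp add: cong_def cong_add_lcancel_nat[unfolded cong_def])
  show "y = z"
  proof (rule PiE_ext[OF yP zP])
    fix c assume "c \<in> {..<p}"
    then have c: "c < p" by simp
    have "[z c + ?t = z c + ?s] (mod p)"
      by (rule cong_add[OF cong_refl cong_sym[OF \<open>[?s = ?t] (mod p)\<close>]])
    with e[OF c] have "(y c + ?s) mod p = (z c + ?s) mod p" by (simp add: cong_def)
    then show "y c = z c" using add_mod_cancel lt[OF c] by blast
  qed
qed

lemma finite_based_paths: "finite (based_paths p k x)"
proof (rule finite_subset)
  show "based_paths p k x \<subseteq> PiE {..<p} (\<lambda>_. {..<p})" by (auto simp: based_paths_def)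
qed (intro finite_PiE; simp)

lemma card_based_paths_eq:
  assumes "k < p" "k' < p" "x < p" "x' < p"
  shows "card (based_paths p k x) = card (based_paths p k' x')"
proof (rule antisym)
  show "card (based_paths p k x) \<le> card (based_paths p k' x')"
    by (rule card_inj_on_le[OF rotated_based_inj[OF assms(1,2)] _ finite_based_paths])
       (use rotated_based[OF _ assms(2,4)] in blast)
  show "card (based_paths p k' x') \<le> card (based_paths p k x)"
    by (rule card_inj_on_le[OF rotated_based_inj[OF assms(2,1)] _ finite_based_paths])
       (use rotated_based[OF _ assms(1,3)] in blast)
qed

text \<open>A path ending in the last residue splits the remaining residues into the pairs
  $\{0, 1\}, \{2, 3\}, \dots$, in some order.\<close>

lemma based_paths_last:
  "based_paths (Suc (2 * m)) (2 * m) (2 * m) = paired m ` {\<pi>. \<pi> permutes {..<m}}" (is "?Z = ?R")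
proof (intro equalityI subsetI)
  let ?p = "Suc (2 * m)"
  fix z assume z: "z \<in> ?Z"
  have zP: "z \<in> PiE {..<?p} (\<lambda>_. {..<?p})" and inj: "inj_on z {..<?p}" and last: "z (2 * m) = 2 * m"
    and step: "\<And>c. Suc c < ?p \<Longrightarrow> even c \<Longrightarrow> z (Suc c) = Suc (z c) mod ?p"
    using z by (simp_all add: based_paths_def)
  have zlt: "z c < 2 * m" if "c < 2 * m" for c
  proof -
    have "z c < ?p" using PiE_mem[OF zP, of c] that by simp
    moreover have "z c \<noteq> z (2 * m)" using inj_onD[OF inj, of c "2 * m"] that by auto
    ultimately show ?thesis using last by simp
  qed
  \<comment> \<open>No wrap-around can occur: the value 2 * m belongs to the last place.\<close>
  have odd_pos: "z (Suc (2 * l)) = Suc (z (2 * l))" if "l < m" for l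
    using step[of "2 * l"] zlt[of "2 * l"] that by simp
  define S where "S = (\<lambda>l. z (2 * l)) ` {..<m}"
  have surj: "z ` {..<?p} = {..<?p}"
    by (rule endo_inj_surj) (use zP inj in \<open>auto simp: PiE_iff\<close>)
  have cover: "v \<in> S \<or> (\<exists>u\<in>S. v = Suc u)" if "v < 2 * m" for v
  proof -
    have "v \<in> z ` {..<?p}" using that by (subst surj) simp
    then obtain c where c: "c < ?p" "z c = v" by auto
    with last that have "c < 2 * m" by (cases "c = 2 * m") auto
    show ?thesis
    proof (cases "even c")
      case True
      then obtain l where "c = 2 * l" by (rule evenE)
      with c \<open>c < 2 * m\<close> show ?thesis by (auto simp: S_def)
    next
      case False
      then obtain l where "c = 2 * l + 1" by (rule oddE)
      with c \<open>c < 2 * m\<close> odd_pos[of l] show ?thesis by (auto simp: S_def)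
    qed
  qed
  have disj: "Suc u \<notin> S" if "u \<in> S" for u
  proof
    assume "Suc u \<in> S"
    with that obtain l l' where l: "l < m" "l' < m" "u = z (2 * l)" "Suc u = z (2 * l')"
      by (auto simp: S_def)
    then have "z (Suc (2 * l)) = z (2 * l')" using odd_pos by simp
    then have "Suc (2 * l) = 2 * l'" using inj_onD[OF inj] l by simp
    then show False by presburger
  qed
  \<comment> \<open>S consists of the lower elements of the pairs. Every value below 2 * m is such
    an element or the successor of one, never both, and 0 is no successor; hence they
    alternate.\<close>
  have S: "v \<in> S \<longleftrightarrow> even v" if "v < 2 * m" for v
    using that
  proof (induction v)
    case 0
    then show ?case using cover[of 0] by auto
  next
    case (Suc v)
    then show ?case using cover[of "Suc v"] disj[of v] by auto
  qed
  define \<pi> where "\<pi> h = (if h < m then z (2 * h) div 2 else h)" for h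
  have ev: "z (2 * h) = 2 * \<pi> h" if "h < m" for h
    using S[OF zlt[of "2 * h"]] that by (auto simp: S_def \<pi>_def)
  have "inj_on \<pi> {..<m}"
  proof (rule inj_onI)
    fix h h' assume h: "h \<in> {..<m}" "h' \<in> {..<m}" "\<pi> h = \<pi> h'"
    then have "z (2 * h) = z (2 * h')" using ev by simp
    then have "2 * h = 2 * h'" using inj_onD[OF inj, of "2 * h" "2 * h'"] h by simp
    then show "h = h'" by simp
  qed
  moreover have "\<pi> ` {..<m} \<subseteq> {..<m}"
  proof (rule image_subsetI)
    fix h assume "h \<in> {..<m}"
    then show "\<pi> h \<in> {..<m}" using zlt[of "2 * h"] ev[of h] by simp
  qed
  ultimately have "bij_betw \<pi> {..<m} {..<m}"
    by (simp add: bij_betw_def endo_inj_surj)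
  then have "\<pi> permutes {..<m}"
    by (rule bij_imp_permutes) (simp add: \<pi>_def)
  moreover have "z = paired m \<pi>"
  proof (rule extensionalityI[of _ "{..<?p}"])
    fix c assume c: "c \<in> {..<?p}"
    consider "c = 2 * m" | h where "h < m" "c = 2 * h" | h where "h < m" "c = Suc (2 * h)"
    proof (cases "even c")
      case True
      then obtain l where "c = 2 * l" by (rule evenE)
      with c that(1) that(2)[of l] show ?thesis by (cases "l = m") simp_all
    next
      case False
      then obtain l where "c = 2 * l + 1" by (rule oddE)
      with c that(3)[of l] show ?thesis by simp
    qed
    then show "z c = paired m \<pi> c"
      by cases (use last ev odd_pos in \<open>auto simp: paired_def\<close>)
  qed (use zP in \<open>auto simp: PiE_iff paired_def\<close>)
  ultimately show "z \<in> ?R" by blast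
next
  let ?p = "Suc (2 * m)"
  fix z assume "z \<in> ?R"
  then obtain \<pi> where \<pi>: "\<pi> permutes {..<m}" and z: "z = paired m \<pi>" by blast
  have bij: "bij_betw z {..<?p} {..<?p}"
    unfolding z by (rule paired_sign(1)[OF permutes_imp_bij[OF \<pi>]])
  have "z \<in> PiE {..<?p} (\<lambda>_. {..<?p})"
    using bij by (auto simp: PiE_iff bij_betw_def z paired_def)
  moreover have "z (Suc c) = Suc (z c) mod ?p" if c: "Suc c < ?p" "even c" for c
  proof -
    obtain h where h: "c = 2 * h" using c(2) by (rule evenE)
    with c have "h < m" by simp
    then have "\<pi> h < m" using permutes_in_image[OF \<pi>, of h] by simp
    with h \<open>h < m\<close> show ?thesis by (simp add: z paired_def)
  qed
  ultimately show "z \<in> ?Z"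
    using bij by (simp add: based_paths_def bij_betw_def) (simp add: z paired_def)
qed

lemma card_based_paths:
  assumes "x < Suc (2 * m)"
  shows "card (based_paths (Suc (2 * m)) 0 x) = fact m"
proof -
  have "inj_on (paired m) {\<pi>. \<pi> permutes {..<m}}"
  proof (rule inj_onI)
    fix \<pi> \<pi>' assume p: "\<pi> \<in> {\<pi>. \<pi> permutes {..<m}}" "\<pi>' \<in> {\<pi>. \<pi> permutes {..<m}}"
      and eq: "paired m \<pi> = paired m \<pi>'"
    show "\<pi> = \<pi>'"
    proof
      fix h show "\<pi> h = \<pi>' h"
      proof (cases "h < m")
        case True
        with fun_cong[OF eq, of "2 * h"] show ?thesis by (simp add: paired_def)
      next
        case False
        with p show ?thesis by (simp add: permutes_def)
      qed
    qed
  qed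
  then have "card (based_paths (Suc (2 * m)) (2 * m) (2 * m)) = card {\<pi>. \<pi> permutes {..<m}}"
    unfolding based_paths_last by (rule card_image)
  also have "\<dots> = fact m"
    by (rule card_permutations) simp_all
  finally show ?thesis
    using card_based_paths_eq[of 0 "Suc (2 * m)" "2 * m" x "2 * m"] assms by simp
qed

text \<open>K is 1 for p = 2, where the second value is the only one left, and the factorial of
  (p-1)/2 for odd p, all of whose factors are smaller than p.\<close>

lemma block_paths_card:
  assumes "prime p"
  obtains K where "\<not> p dvd K" "\<And>b x. x < p \<Longrightarrow> card (block_paths p b x) = K"
proof (cases "p = 2")
  case True
  have "block_paths p b x = {\<lambda>c\<in>{..<2}. if c = 0 then x else 1 - x}" if "x < p" for b x
  proof (intro equalityI subsetI)
    fix y assume y: "y \<in> block_paths p b x"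
    then have yP: "y \<in> PiE {..<2} (\<lambda>_. {..<2})" and inj: "inj_on y {..<2}" and y0: "y 0 = x"
      by (simp_all add: block_paths_def True)
    have "y 1 < 2" using PiE_mem[OF yP, of 1] by simp
    moreover have "y 1 \<noteq> y 0" using inj_onD[OF inj, of 1 0] by auto
    ultimately have y1: "y 1 = 1 - x" using y0 that True by simp
    have "y = (\<lambda>c\<in>{..<2}. if c = 0 then x else 1 - x)"
    proof (rule extensionalityI[of _ "{..<2}"])
      show "y \<in> extensional {..<2}" using yP by (simp add: PiE_iff)
      show "y c = (\<lambda>c\<in>{..<2}. if c = 0 then x else 1 - x) c" if "c \<in> {..<2}" for c
        using that y0 y1 by (auto simp: less_2_cases_iff)
    qed simp
    then show "y \<in> {\<lambda>c\<in>{..<2}. if c = 0 then x else 1 - x}" by simp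
  next
    fix y assume "y \<in> {\<lambda>c\<in>{..<2::nat}. if c = 0 then x else 1 - x}"
    then have y: "y = (\<lambda>c\<in>{..<2}. if c = 0 then x else 1 - x)" by simp
    show "y \<in> block_paths p b x"
      unfolding block_paths_def y using that
      by (auto simp: True inj_on_def PiE_iff less_2_cases_iff mod_Suc)
  qed
  then have "card (block_paths p b x) = 1" if "x < p" for b x using that by simp
  moreover have "\<not> p dvd 1" using True by simp
  ultimately show ?thesis using that by blast
next
  case False
  then have "odd p" using assms by (metis prime_odd_nat prime_ge_2_nat le_neq_implies_less)
  then obtain m where m: "p = 2 * m + 1" by (rule oddE)
  have "card (block_paths p b x) = fact m" if "x < p" for b x
    using card_based_paths[of x m] that \<open>odd p\<close> by (simp add: block_paths_odd m)
  moreover have "\<not> p dvd fact m"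
    using assms m by (simp add: prime_dvd_fact_iff)
  ultimately show ?thesis using that by blast
qed

text \<open>Rotated so that it ends in 2 * m, the path is a \<open>paired\<close> map and hence
  even. The rotation is a translation modulo the odd prime p, hence even as well.\<close>

lemma block_paths_sign:
  assumes "prime p" "odd p" and y: "y \<in> block_paths p b x"
  shows "sgn_map p y = 1"
proof -
  obtain m where m: "p = Suc (2 * m)" using \<open>odd p\<close> by (auto elim: oddE)
  let ?s = "2 * m + p - y (2 * m)"
  have yb: "y \<in> based_paths p 0 x" using y block_paths_odd[OF \<open>odd p\<close>] by simp
  have z: "rotated p ?s y \<in> based_paths p (2 * m) (2 * m)"
    by (rule rotated_based[OF yb]) (simp_all add: m)
  then obtain \<pi> where \<pi>: "\<pi> permutes {..<m}" "rotated p ?s y = paired m \<pi>"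
    unfolding m based_paths_last by blast
  have one: "sgn_map p (rotated p ?s y) = 1"
    unfolding \<pi>(2) unfolding m by (rule paired_sign(2)[OF permutes_imp_bij[OF \<pi>(1)]])
  have p: "0 < p" by (simp add: m)
  have y_lt: "y c < p" if "c < p" for c
    using yb PiE_mem[of y "{..<p}" "\<lambda>_. {..<p}" c] that by (simp add: based_paths_def)
  have rot: "sgn_map p (rotated p ?s y) = sgn_map p (\<lambda>c. dig_add p 1 ?s (y c))"
    by (rule sgn_map_cong) (use y_lt in \<open>simp add: rotated_def mod_add_right_eq add.commute\<close>)
  have "sgn_map p (\<lambda>c. dig_add p 1 ?s (y c)) = sign_on {..<p} (dig_add p 1 ?s) * sgn_map p y"
  proof (rule sgn_map_comp)
    show "bij_betw (dig_add p 1 ?s) {..<p} {..<p}" using dig_add_bij[OF p, of 1 ?s] unfolding power_one_right .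
    show "y ` {..<p} \<subseteq> {..<p}" using y_lt by auto
  qed
  moreover have "sign_on {..<p} (dig_add p 1 ?s) = 1"
  proof -
    have "[sign_on {..<p} (dig_add p 1 ?s) = 1] (mod int p)"
      using dig_add_sign[OF assms(1), of 1 ?s] unfolding power_one_right .
    moreover have "sign_on {..<p} (dig_add p 1 ?s) = 1 \<or> sign_on {..<p} (dig_add p 1 ?s) = - 1"
      unfolding sign_on_def by (metis sign_def)
    moreover have "\<not> [- 1 = 1] (mod int p)"
    proof
      assume "[- 1 = 1] (mod int p)"
      then have "int p dvd 2" by (simp add: cong_iff_dvd_diff)
      then have "p dvd 2" by (metis int_dvd_int_iff of_nat_numeral)
      then have "p = 2" using dvd_imp_le[of p 2] prime_ge_2_nat[OF assms(1)] by simp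
      with assms(2) show False by simp
    qed
    ultimately show ?thesis by auto
  qed
  ultimately show ?thesis using one rot by simp
qed

text \<open>The step into a multiple of p is made by a higher digit and leaves the lowest one alone.
  All other steps have direction 0, and \<open>i - i div p\<close> of them come before.\<close>

definition digit_ok :: "nat \<Rightarrow> nat \<Rightarrow> nat \<Rightarrow> nat \<Rightarrow> bool" where
  "digit_ok p i x y \<longleftrightarrow> (if p dvd Suc i then y = x else (even (i - i div p) \<longrightarrow> y = Suc x mod p))"

definition digit_paths :: "nat \<Rightarrow> nat \<Rightarrow> (nat \<Rightarrow> nat) set" where
  "digit_paths p Q = {A \<in> PiE {..<p * Q} (\<lambda>_. {..<p}). (0 < Q \<longrightarrow> A 0 = 0) \<and>
     (\<forall>i. Suc i < p * Q \<longrightarrow> digit_ok p i (A i) (A (Suc i))) \<and>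
     (\<forall>b<Q. inj_on (\<lambda>c. A (p * b + c)) {..<p})}"

lemma digit_ok_inside:
  assumes "Suc c < p"
  shows "digit_ok p (p * b + c) x y \<longleftrightarrow> (even (p * b + c - b) \<longrightarrow> y = Suc x mod p)"
proof -
  have "Suc (p * b + c) = p * b + Suc c" by simp
  moreover have "\<not> p dvd Suc c" using assms by (simp add: nat_dvd_not_less)
  ultimately have "\<not> p dvd Suc (p * b + c)" using dvd_add_right_iff[of p "p * b" "Suc c"] by simp
  moreover have "(p * b + c) div p = b" using assms by simp
  ultimately show ?thesis by (simp add: digit_ok_def)
qed

lemma digit_paths_mem:
  assumes "A \<in> digit_paths p Q"
  shows "A \<in> PiE {..<p * Q} (\<lambda>_. {..<p})" "0 < Q \<Longrightarrow> A 0 = 0"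
    "Suc i < p * Q \<Longrightarrow> digit_ok p i (A i) (A (Suc i))" "b < Q \<Longrightarrow> inj_on (\<lambda>c. A (p * b + c)) {..<p}"
    "t < p * Q \<Longrightarrow> A t < p"
  using assms PiE_mem[of A "{..<p * Q}" "\<lambda>_. {..<p}" t] by (simp_all add: digit_paths_def)

lemma block_of_digit_path:
  assumes A: "A \<in> digit_paths p Q" and b: "b < Q" and p: "0 < p"
  shows "(\<lambda>c\<in>{..<p}. A (p * b + c)) \<in> block_paths p b (A (p * b))"
proof -
  have lt: "p * b + c < p * Q" if "c < p" for c
    using mixed_radix_lt[OF that b] by (simp add: add.commute)
  have "A (p * b + Suc c) = Suc (A (p * b + c)) mod p" if "Suc c < p" "even (p * b + c - b)" for c
  proof -
    have "Suc (p * b + c) < p * Q" using lt[OF that(1)] by simp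
    from digit_paths_mem(3)[OF A this] that(2) show ?thesis
      unfolding digit_ok_inside[OF that(1)] add_Suc_right by blast
  qed
  then show ?thesis
    unfolding block_paths_def mem_Collect_eq using p digit_paths_mem(4)[OF A b] digit_paths_mem(5)[OF A] lt
    by (simp add: PiE_iff inj_on_def)
qed

definition path_join :: "nat \<Rightarrow> nat \<Rightarrow> (nat \<Rightarrow> nat) \<times> (nat \<Rightarrow> nat) \<Rightarrow> nat \<Rightarrow> nat" where
  "path_join p Q = (\<lambda>(A, y). \<lambda>t\<in>{..<p * Suc Q}. if t < p * Q then A t else y (t - p * Q))"

lemma path_join_apply:
  "t < p * Q \<Longrightarrow> path_join p Q (A, y) t = A t"
  "c < p \<Longrightarrow> path_join p Q (A, y) (p * Q + c) = y c"
  by (simp_all add: path_join_def)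

text \<open>Entering a new block keeps the lowest digit, so the appended block starts where the
  previous one ended, or at 0 if it is the first. As the number of block paths does not depend on
  the start, the numbers multiply.\<close>

lemma digit_paths_Suc:
  assumes p: "1 < p"
  shows "bij_betw (path_join p Q)
    (SIGMA A:digit_paths p Q. block_paths p Q (if Q = 0 then 0 else A (p * Q - 1))) (digit_paths p (Suc Q))"
    (is "bij_betw ?f ?X ?Y")
proof (rule bij_betw_byWitness[where f' = "\<lambda>B. (restrict B {..<p * Q}, \<lambda>c\<in>{..<p}. B (p * Q + c))"])
  let ?g = "\<lambda>B. (restrict B {..<p * Q}, \<lambda>c\<in>{..<p}. B (p * Q + c))"
  show "\<forall>x\<in>?X. ?g (?f x) = x"
  proof
    fix x assume "x \<in> ?X"
    then obtain A y where x: "x = (A, y)" and A: "A \<in> digit_paths p Q" and y: "y \<in> block_paths p Q (if Q = 0 then 0 else A (p * Q - 1))"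
      by auto
    have "restrict (?f (A, y)) {..<p * Q} = A"
    proof (rule extensionalityI[of _ "{..<p * Q}"])
      show "A \<in> extensional {..<p * Q}" using digit_paths_mem(1)[OF A] by (simp add: PiE_iff)
    qed (simp_all add: path_join_apply)
    moreover have "(\<lambda>c\<in>{..<p}. ?f (A, y) (p * Q + c)) = y"
    proof (rule extensionalityI[of _ "{..<p}"])
      show "y \<in> extensional {..<p}" using y by (simp add: block_paths_def PiE_iff)
    qed (simp_all add: path_join_apply)
    ultimately show "?g (?f x) = x" unfolding x by simp
  qed
  show "\<forall>B\<in>?Y. ?f (?g B) = B"
  proof
    fix B assume B: "B \<in> ?Y"
    show "?f (?g B) = B"
    proof (rule extensionalityI[of _ "{..<p * Suc Q}"])
      show "B \<in> extensional {..<p * Suc Q}" using digit_paths_mem(1)[OF B] by (simp add: PiE_iff)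
      show "?f (?g B) \<in> extensional {..<p * Suc Q}" by (simp add: path_join_def)
      fix t assume t: "t \<in> {..<p * Suc Q}"
      show "?f (?g B) t = B t"
      proof (cases "t < p * Q")
        case False
        then obtain c where "t = p * Q + c" by (metis le_iff_add not_less)
        with t show ?thesis by (simp add: path_join_apply)
      qed (simp add: path_join_apply)
    qed
  qed
  show "?f ` ?X \<subseteq> ?Y"
  proof (rule image_subsetI)
    fix x assume "x \<in> ?X"
    then obtain A y where x: "x = (A, y)" and A: "A \<in> digit_paths p Q" and y: "y \<in> block_paths p Q (if Q = 0 then 0 else A (p * Q - 1))"
      by auto
    let ?B = "?f (A, y)"
    have y0: "y 0 = (if Q = 0 then 0 else A (p * Q - 1))" and y_inj: "inj_on y {..<p}"
      and y_step: "\<And>c. Suc c < p \<Longrightarrow> even (p * Q + c - Q) \<Longrightarrow> y (Suc c) = Suc (y c) mod p"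
      and yP: "y \<in> PiE {..<p} (\<lambda>_. {..<p})"
      using y unfolding block_paths_def mem_Collect_eq by blast+
    have "?B t < p" if t: "t < p * Suc Q" for t
    proof (cases "t < p * Q")
      case True
      then show ?thesis using digit_paths_mem(5)[OF A True] by (simp add: path_join_apply)
    next
      case False
      then obtain c where "t = p * Q + c" by (metis le_iff_add not_less)
      with t PiE_mem[OF yP, of c] show ?thesis by (simp add: path_join_apply)
    qed
    then have "?B \<in> PiE {..<p * Suc Q} (\<lambda>_. {..<p})"
      by (simp add: PiE_iff path_join_def)
    moreover have "?B 0 = 0"
    proof (cases "Q = 0")
      case True
      with y0 p path_join_apply(2)[of 0 p Q A y] show ?thesis by simp
    next
      case False
      with p digit_paths_mem(2)[OF A] show ?thesis by (simp add: path_join_apply)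
    qed
    moreover have "digit_ok p i (?B i) (?B (Suc i))" if i: "Suc i < p * Suc Q" for i
    proof -
      consider "Suc i < p * Q" | "Suc i = p * Q" | "p * Q \<le> i" by linarith
      then show ?thesis
      proof cases
        case 1
        then show ?thesis using digit_paths_mem(3)[OF A 1] by (simp add: path_join_apply)
      next
        case 2
        then have "i = p * Q - 1" "i < p * Q" by simp_all
        then have "?B i = A (p * Q - 1)" using path_join_apply(1)[of i p Q A y] by simp
        moreover have "?B (Suc i) = y 0" using path_join_apply(2)[of 0 p Q A y] p 2 by simp
        ultimately show ?thesis using y0 2 by (cases "Q = 0") (simp_all add: digit_ok_def)
      next
        case 3
        then obtain c where c: "i = p * Q + c" by (metis le_iff_add)
        with i have "Suc c < p" by simp
        then have "?B i = y c" "?B (Suc i) = y (Suc c)"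
          using path_join_apply(2)[of c p Q A y] path_join_apply(2)[of "Suc c" p Q A y] c by simp_all
        then show ?thesis
          unfolding c digit_ok_inside[OF \<open>Suc c < p\<close>] using y_step[OF \<open>Suc c < p\<close>] by metis
      qed
    qed
    moreover have "inj_on (\<lambda>c. ?B (p * b + c)) {..<p}" if b: "b < Suc Q" for b
    proof (cases "b = Q")
      case True
      then show ?thesis using y_inj by (simp add: inj_on_def path_join_apply)
    next
      case False
      then have "b < Q" using b by simp
      have "?B (p * b + c) = A (p * b + c)" if "c < p" for c
        using mixed_radix_lt[OF that \<open>b < Q\<close>] by (simp add: path_join_apply add.commute)
      then show ?thesis using digit_paths_mem(4)[OF A \<open>b < Q\<close>] by (simp add: inj_on_def)
    qed
    ultimately show "?f x \<in> ?Y" unfolding x digit_paths_def by blast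
  qed
  show "?g ` ?Y \<subseteq> ?X"
  proof (rule image_subsetI)
    fix B assume B: "B \<in> ?Y"
    have lt: "t < p * Suc Q" if "t < p * Q" for t using that by simp
    have "restrict B {..<p * Q} \<in> digit_paths p Q"
      unfolding digit_paths_def
    proof (intro CollectI conjI allI impI)
      show "restrict B {..<p * Q} \<in> PiE {..<p * Q} (\<lambda>_. {..<p})"
        using digit_paths_mem(5)[OF B] lt by (simp add: PiE_iff)
      show "restrict B {..<p * Q} 0 = 0" if "0 < Q"
        using digit_paths_mem(2)[OF B] that p by simp
      show "digit_ok p i (restrict B {..<p * Q} i) (restrict B {..<p * Q} (Suc i))" if "Suc i < p * Q" for i
        using digit_paths_mem(3)[OF B lt[OF that]] that by simp
      show "inj_on (\<lambda>c. restrict B {..<p * Q} (p * b + c)) {..<p}" if "b < Q" for b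
      proof -
        have "p * b + c < p * Q" if "c < p" for c
          using mixed_radix_lt[OF that \<open>b < Q\<close>] by (simp add: add.commute)
        then show ?thesis using digit_paths_mem(4)[OF B, of b] that by (simp add: inj_on_def)
      qed
    qed
    moreover have "B (p * Q) = (if Q = 0 then 0 else B (p * Q - 1))"
    proof (cases "Q = 0")
      case True
      then show ?thesis using digit_paths_mem(2)[OF B] by simp
    next
      case False
      then have "Suc (p * Q - 1) = p * Q" using p by simp
      then show ?thesis
        using digit_paths_mem(3)[OF B, of "p * Q - 1"] False p by (simp add: digit_ok_def)
    qed
    then have "(\<lambda>c\<in>{..<p}. B (p * Q + c))
        \<in> block_paths p Q (if Q = 0 then 0 else restrict B {..<p * Q} (p * Q - 1))"
      using block_of_digit_path[OF B, of Q] p by (cases "Q = 0") simp_all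
    ultimately show "?g B \<in> ?X" by simp
  qed
qed

lemma finite_digit_paths: "finite (digit_paths p Q)"
proof (rule finite_subset)
  show "digit_paths p Q \<subseteq> PiE {..<p * Q} (\<lambda>_. {..<p})" by (auto simp: digit_paths_def)
qed (intro finite_PiE; simp)

lemma finite_block_paths: "finite (block_paths p b x)"
proof (rule finite_subset)
  show "block_paths p b x \<subseteq> PiE {..<p} (\<lambda>_. {..<p})" by (auto simp: block_paths_def)
qed (intro finite_PiE; simp)

lemma card_digit_paths:
  assumes p: "1 < p" and K: "\<And>b x. x < p \<Longrightarrow> card (block_paths p b x) = K"
  shows "card (digit_paths p Q) = K ^ Q"
proof (induction Q)
  case 0
  have "digit_paths p 0 = {\<lambda>x. undefined}" by (auto simp: digit_paths_def)
  then show ?case by simp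
next
  case (Suc Q)
  have "card (digit_paths p (Suc Q))
      = card (SIGMA A:digit_paths p Q. block_paths p Q (if Q = 0 then 0 else A (p * Q - 1)))"
    by (rule bij_betw_same_card[OF digit_paths_Suc[OF p], symmetric])
  also have "\<dots> = (\<Sum>A\<in>digit_paths p Q. card (block_paths p Q (if Q = 0 then 0 else A (p * Q - 1))))"
    by (rule card_SigmaI) (simp_all add: finite_digit_paths finite_block_paths)
  also have "\<dots> = (\<Sum>A\<in>digit_paths p Q. K)"
  proof (rule sum.cong[OF refl], rule K)
    fix A assume "A \<in> digit_paths p Q"
    then show "(if Q = 0 then 0 else A (p * Q - 1)) < p"
      using digit_paths_mem(5)[of A p Q "p * Q - 1"] p by simp
  qed
  finally show ?case using Suc by simp
qed

section \<open>Gray paths\<close>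

text \<open>The number of t in {1..i} of p-adic valuation k, that is, how often a Gray code has
  changed the digit k in its first i steps.\<close>

definition depth :: "nat \<Rightarrow> nat \<Rightarrow> nat \<Rightarrow> nat" where
  "depth p i k = i div p ^ k - i div p ^ Suc k"

text \<open>The support of the step operator in the direction given by the valuation of
  \<open>Suc i\<close>, without the stationary term of T - 1, which an injective path never
  uses.\<close>

definition gray_step :: "nat \<Rightarrow> nat \<Rightarrow> nat \<Rightarrow> nat \<Rightarrow> nat \<Rightarrow> bool" where
  "gray_step p n i x y \<longleftrightarrow> (let k = multiplicity p (Suc i) in
     if even (depth p i k) then y = dig_add p n (p ^ k) x else (\<exists>j<p. y = (dig_add p n (p ^ k) ^^ j) x))"

definition gray_paths :: "nat \<Rightarrow> nat \<Rightarrow> (nat \<Rightarrow> nat) set" where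
  "gray_paths p n = {g \<in> PiE {..<p ^ n} (\<lambda>_. {..<p ^ n}). bij_betw g {..<p ^ n} {..<p ^ n} \<and> g 0 = 0 \<and>
     (\<forall>i. Suc i < p ^ n \<longrightarrow> gray_step p n i (g i) (g (Suc i)))}"

lemma gray_paths_mem:
  assumes "g \<in> gray_paths p n"
  shows "g \<in> PiE {..<p ^ n} (\<lambda>_. {..<p ^ n})" "bij_betw g {..<p ^ n} {..<p ^ n}" "g 0 = 0"
    "Suc i < p ^ n \<Longrightarrow> gray_step p n i (g i) (g (Suc i))" "t < p ^ n \<Longrightarrow> g t < p ^ n"
  using assms PiE_mem[of g "{..<p ^ n}" "\<lambda>_. {..<p ^ n}" t] by (simp_all add: gray_paths_def)

lemma mixed_radix_div: "c < p \<Longrightarrow> (p * b + c) div p = (b :: nat)"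
  by simp

lemma mixed_radix_iff: "c < p \<Longrightarrow> y = c + p * z \<longleftrightarrow> y mod p = c \<and> y div p = (z :: nat)"
  using mod_mult_div_eq[of y p] by auto

lemma gray_step_digit:
  assumes p: "1 < p" and i: "\<not> p dvd Suc i" and x: "x < p ^ Suc n"
  shows "gray_step p (Suc n) i x y \<longleftrightarrow>
    y div p = x div p \<and> (if even (i - i div p) then y mod p = Suc (x mod p) mod p else True)"
proof -
  have k: "multiplicity p (Suc i) = 0" using i by (rule not_dvd_imp_multiplicity_0)
  have d: "depth p i 0 = i - i div p" by (simp add: depth_def)
  have xd: "x div p < p ^ n" using x by (simp add: less_mult_imp_div_less mult.commute)
  have z: "(dig_add p n 0 ^^ j) (x div p) = x div p" for j
    by (induction j) (use dig_add_0[OF _ xd] p in simp_all)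
  have pow: "(dig_add p (Suc n) 1 ^^ j) x = (x mod p + j) mod p + p * (x div p)" for j
    using dig_add_funpow[where p = p and x = x and n = n and h = 1 and j = j] p x z[of j] by (simp del: dig_add.simps)
  show ?thesis
  proof (cases "even (i - i div p)")
    case True
    have "gray_step p (Suc n) i x y \<longleftrightarrow> y = (x mod p + 1) mod p + p * (x div p)"
      using pow[of 1] True by (simp add: gray_step_def k d)
    also have "\<dots> \<longleftrightarrow> y mod p = Suc (x mod p) mod p \<and> y div p = x div p"
      using p by (subst mixed_radix_iff) simp_all
    finally show ?thesis using True by auto
  next
    case False
    have "gray_step p (Suc n) i x y \<longleftrightarrow> (\<exists>j<p. y = (x mod p + j) mod p + p * (x div p))"
      unfolding gray_step_def k d Let_def power_0 pow using False by (simp only: if_False)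
    also have "\<dots> \<longleftrightarrow> y div p = x div p"
    proof
      assume y: "y div p = x div p"
      \<comment> \<open>The number of unit shifts from x mod p to y mod p, with p added before
        subtracting to stay in the naturals.\<close>
      let ?j = "(y mod p + (p - x mod p)) mod p"
      have "x mod p < p" using p by simp
      then have "x mod p + (y mod p + (p - x mod p)) = y mod p + p" by simp
      then have "(x mod p + ?j) mod p = y mod p" by (simp add: mod_add_right_eq)
      then have "y = (x mod p + ?j) mod p + p * (x div p)" using y by (metis mod_mult_div_eq)
      moreover have "?j < p" using p by simp
      ultimately show "\<exists>j<p. y = (x mod p + j) mod p + p * (x div p)" by blast
    qed (use p in auto)
    finally show ?thesis using False by auto
  qed
qed

text \<open>Dropping the lowest digit lowers the valuation by one and turns step i into step
  \<open>i div p\<close> of a path with one digit less, of the same depth in the shifted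
  direction.\<close>

lemma gray_step_carry:
  assumes p: "1 < p" and i: "p dvd Suc i" and x: "x < p ^ Suc n"
  shows "gray_step p (Suc n) i x y \<longleftrightarrow>
    y mod p = x mod p \<and> gray_step p n (i div p) (x div p) (y div p)"
proof -
  obtain b where b: "Suc i = p * Suc b"
    using i by (metis dvdE mult_0_right nat.distinct(1) not0_implies_Suc)
  have "i = p * b + (p - 1)" using b p by simp
  then have ib: "i div p = b" using p mixed_radix_div[of "p - 1" p b] by simp
  have "multiplicity p (p * Suc b) = Suc (multiplicity p (Suc b))"
    by (rule multiplicity_times_same) (use p in auto)
  then have k: "multiplicity p (Suc i) = Suc (multiplicity p (Suc b))" using b by simp
  have d: "depth p i (Suc k) = depth p b k" for k
    unfolding depth_def ib[symmetric] by (simp add: div_mult2_eq)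
  have pow: "(dig_add p (Suc n) (p ^ Suc k) ^^ j) x = x mod p + p * (dig_add p n (p ^ k) ^^ j) (x div p)" for j k
    using dig_add_funpow[where p = p and x = x and n = n and h = "p ^ Suc k" and j = j] p x by simp
  have pow1: "dig_add p (Suc n) (p ^ Suc k) x = x mod p + p * dig_add p n (p ^ k) (x div p)" for k
    using pow[of k 1] by simp
  have split: "y = x mod p + p * z \<longleftrightarrow> y mod p = x mod p \<and> y div p = z" for z
    using p by (intro mixed_radix_iff) simp
  show ?thesis
    unfolding gray_step_def Let_def k d ib pow pow1 split by auto
qed

definition radix_join :: "nat \<Rightarrow> nat \<Rightarrow> (nat \<Rightarrow> nat) \<times> (nat \<Rightarrow> nat) \<Rightarrow> nat \<Rightarrow> nat" where
  "radix_join p n = (\<lambda>(g, A). \<lambda>t\<in>{..<p ^ Suc n}. A t + p * g (t div p))"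

lemma radix_join_apply: "t < p ^ Suc n \<Longrightarrow> radix_join p n (g, A) t = A t + p * g (t div p)"
  by (simp add: radix_join_def)

lemma radix_join_in:
  assumes p: "1 < p" and g: "g \<in> gray_paths p n" and A: "A \<in> digit_paths p (p ^ n)"
  shows "radix_join p n (g, A) \<in> gray_paths p (Suc n)"
proof -
  let ?q = "p ^ n" and ?G = "radix_join p n (g, A)"
  have A_lt: "A t < p" if "t < p ^ Suc n" for t using digit_paths_mem(5)[OF A] that by simp
  have cov: "t mod p < p" "t div p < ?q" "t = t mod p + p * (t div p)" if "t < p ^ Suc n" for t
    using mixed_radix_cover[of t p ?q] that by simp_all
  have md: "?G t mod p = A t" "?G t div p = g (t div p)" if "t < p ^ Suc n" for t
    using A_lt[OF that] by (simp_all add: radix_join_apply[OF that])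
  have lt: "?G t < p ^ Suc n" if "t < p ^ Suc n" for t
    using mixed_radix_lt[OF A_lt[OF that] gray_paths_mem(5)[OF g cov(2)[OF that]]]
    by (simp add: radix_join_apply[OF that])
  have "inj_on ?G {..<p ^ Suc n}"
  proof (rule inj_onI)
    fix t t' assume t: "t \<in> {..<p ^ Suc n}" "t' \<in> {..<p ^ Suc n}" and eq: "?G t = ?G t'"
    then have "A t = A t'" "g (t div p) = g (t' div p)" using md[of t] md[of t'] by simp_all
    moreover have d: "t div p = t' div p"
      using inj_onD[OF bij_betw_imp_inj_on[OF gray_paths_mem(2)[OF g]] \<open>g (t div p) = g (t' div p)\<close>]
        cov[of t] cov[of t'] t by simp
    ultimately have "A (p * (t div p) + t mod p) = A (p * (t div p) + t' mod p)"
      by (metis mult_div_mod_eq)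
    then have "t mod p = t' mod p"
      using inj_onD[OF digit_paths_mem(4)[OF A cov(2)[of t]], of "t mod p" "t' mod p"] cov[of t] cov[of t'] t by simp
    with d show "t = t'" by (rule digit_eqI[rotated])
  qed
  moreover have "?G ` {..<p ^ Suc n} \<subseteq> {..<p ^ Suc n}" using lt by auto
  ultimately have "bij_betw ?G {..<p ^ Suc n} {..<p ^ Suc n}"
    by (simp add: bij_betw_def endo_inj_surj)
  moreover have "?G 0 = 0"
    using digit_paths_mem(2)[OF A] gray_paths_mem(3)[OF g] p by (simp add: radix_join_apply)
  moreover have "?G \<in> PiE {..<p ^ Suc n} (\<lambda>_. {..<p ^ Suc n})"
    using lt by (simp add: PiE_iff radix_join_def)
  moreover have "gray_step p (Suc n) i (?G i) (?G (Suc i))" if i: "Suc i < p ^ Suc n" for i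
  proof -
    have i': "i < p ^ Suc n" using i by simp
    have "Suc i < p * ?q" using i by simp
    note ok = digit_paths_mem(3)[OF A this]
    show ?thesis
    proof (cases "p dvd Suc i")
      case False
      then have "Suc i div p = i div p" using p by (simp add: div_Suc dvd_eq_mod_eq_0)
      then show ?thesis
        unfolding gray_step_digit[OF p False lt[OF i']] md[OF i'] md[OF i]
        using ok False by (auto simp: digit_ok_def)
    next
      case True
      then have d: "Suc i div p = Suc (i div p)" using p by (simp add: div_Suc dvd_eq_mod_eq_0)
      then have "Suc (i div p) < ?q" using cov(2)[OF i] by simp
      from gray_paths_mem(4)[OF g this] show ?thesis
        unfolding gray_step_carry[OF p True lt[OF i']] md[OF i'] md[OF i] d
        using ok True by (auto simp: digit_ok_def)
    qed
  qed
  ultimately show ?thesis unfolding gray_paths_def by blast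
qed

text \<open>Inside a block of p consecutive times only the lowest digit moves, so the higher digits
  are constant there. Sampled at the multiples of p they form a Gray path with one digit less, onto
  because G is. As G is injective, the lowest digits within a block are distinct.\<close>

lemma radix_join_surj:
  assumes p: "1 < p" and G: "G \<in> gray_paths p (Suc n)"
  shows "G \<in> radix_join p n ` (gray_paths p n \<times> digit_paths p (p ^ n))"
proof -
  let ?q = "p ^ n"
  have lt: "G t < p ^ Suc n" if "t < p ^ Suc n" for t using gray_paths_mem(5)[OF G that] .
  have cov: "t mod p < p" "t div p < ?q" "t = t mod p + p * (t div p)" if "t < p ^ Suc n" for t
    using mixed_radix_cover[of t p ?q] that by simp_all
  have pb: "p * b + c < p ^ Suc n" if "b < ?q" "c < p" for b c
    using mixed_radix_lt[OF that(2,1)] by (simp add: add.commute)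
  note step = gray_paths_mem(4)[OF G]
  have digit: "G (Suc i) div p = G i div p \<and> (if even (i - i div p) then G (Suc i) mod p = Suc (G i mod p) mod p else True)"
    if "Suc i < p ^ Suc n" "\<not> p dvd Suc i" for i
    using step[OF that(1)] lt[of i] that gray_step_digit[OF p that(2), of "G i" n "G (Suc i)"] by simp
  have carry: "G (Suc i) mod p = G i mod p \<and> gray_step p n (i div p) (G i div p) (G (Suc i) div p)"
    if "Suc i < p ^ Suc n" "p dvd Suc i" for i
    using step[OF that(1)] lt[of i] that gray_step_carry[OF p that(2), of "G i" n "G (Suc i)"] by simp
  have block: "G (p * b + c) div p = G (p * b) div p" if b: "b < ?q" and c: "c < p" for b c
    using c
  proof (induction c)
    case (Suc c)
    have "\<not> p dvd Suc c" using Suc.prems by (simp add: nat_dvd_not_less)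
    then have "\<not> p dvd Suc (p * b + c)" using dvd_add_right_iff[of p "p * b" "Suc c"] by simp
    moreover have "Suc (p * b + c) < p ^ Suc n" using pb[OF b Suc.prems] by simp
    ultimately show ?case using digit[of "p * b + c"] Suc by simp
  qed simp
  have div_eq: "G t div p = G (p * (t div p)) div p" if "t < p ^ Suc n" for t
    using block[OF cov(2,1)[OF that]] cov(3)[OF that] by (simp add: add.commute)
  define g where "g = (\<lambda>b\<in>{..<?q}. G (p * b) div p)"
  define A where "A = (\<lambda>t\<in>{..<p ^ Suc n}. G t mod p)"
  have g_div: "g (t div p) = G t div p" if "t < p ^ Suc n" for t
    using div_eq[OF that] cov(2)[OF that] by (simp add: g_def)
  have g_lt: "g b < ?q" if "b < ?q" for b
    using lt[of "p * b"] pb[OF that, of 0] p that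
    by (simp add: g_def less_mult_imp_div_less mult.commute)
  have "g ` {..<?q} = {..<?q}"
  proof (intro equalityI subsetI)
    fix h assume "h \<in> {..<?q}"
    then have "p * h \<in> G ` {..<p ^ Suc n}"
      using gray_paths_mem(2)[OF G] pb[of h 0] p by (simp add: bij_betw_def)
    then obtain t where t: "t < p ^ Suc n" "G t = p * h" by auto
    then have "g (t div p) = h" using g_div p by simp
    with cov(2)[OF t(1)] show "h \<in> g ` {..<?q}" by blast
  qed (use g_lt in auto)
  then have "bij_betw g {..<?q} {..<?q}"
    by (simp add: bij_betw_def finite_surj_inj)
  moreover have "g 0 = 0" using gray_paths_mem(3)[OF G] p by (simp add: g_def)
  moreover have "g \<in> PiE {..<?q} (\<lambda>_. {..<?q})" using g_lt by (simp add: PiE_iff g_def)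
  moreover have "gray_step p n b (g b) (g (Suc b))" if b: "Suc b < ?q" for b
  proof -
    let ?i = "p * b + (p - 1)"
    have i: "Suc ?i = p * Suc b" using p by simp
    have lt_i: "Suc ?i < p ^ Suc n" unfolding i using pb[OF b, of 0] p by simp
    have ib: "?i div p = b" using p by (intro mixed_radix_div) simp
    have "gray_step p n b (G ?i div p) (G (Suc ?i) div p)"
      using carry[OF lt_i] ib by (metis i dvd_triv_left)
    moreover have "G ?i div p = g b" using g_div[of ?i] lt_i ib by simp
    moreover have "G (Suc ?i) div p = g (Suc b)" using g_div[OF lt_i] i p by simp
    ultimately show ?thesis by simp
  qed
  ultimately have g: "g \<in> gray_paths p n" unfolding gray_paths_def by blast
  have A: "A \<in> digit_paths p ?q"
    unfolding digit_paths_def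
  proof (intro CollectI conjI allI impI)
    show "A \<in> PiE {..<p * ?q} (\<lambda>_. {..<p})" using p by (simp add: A_def PiE_iff)
    show "A 0 = 0" using gray_paths_mem(3)[OF G] p by (simp add: A_def)
    show "digit_ok p i (A i) (A (Suc i))" if "Suc i < p * ?q" for i
      using digit[of i] carry[of i] that by (auto simp: digit_ok_def A_def)
    show "inj_on (\<lambda>c. A (p * b + c)) {..<p}" if b: "b < ?q" for b
    proof (rule inj_onI)
      fix c c' assume c: "c \<in> {..<p}" "c' \<in> {..<p}" and eq: "A (p * b + c) = A (p * b + c')"
      then have "G (p * b + c) mod p = G (p * b + c') mod p"
        using pb[OF b] by (simp add: A_def)
      moreover have "G (p * b + c) div p = G (p * b + c') div p"
        using block[OF b] c by simp
      ultimately have "G (p * b + c) = G (p * b + c')" by (rule digit_eqI)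
      then have "p * b + c = p * b + c'"
        using inj_onD[OF bij_betw_imp_inj_on[OF gray_paths_mem(2)[OF G]], of "p * b + c" "p * b + c'"] pb[OF b] c
        by simp
      then show "c = c'" by simp
    qed
  qed
  have "G = radix_join p n (g, A)"
  proof (rule extensionalityI[of _ "{..<p ^ Suc n}"])
    show "G \<in> extensional {..<p ^ Suc n}" using gray_paths_mem(1)[OF G] by (simp add: PiE_iff)
    show "radix_join p n (g, A) \<in> extensional {..<p ^ Suc n}" by (simp add: radix_join_def)
    show "G t = radix_join p n (g, A) t" if "t \<in> {..<p ^ Suc n}" for t
      using that g_div[of t] by (simp add: radix_join_def A_def)
  qed
  with g A show ?thesis by blast
qed

lemma radix_join_inj:
  assumes p: "1 < p"
  shows "inj_on (radix_join p n) (gray_paths p n \<times> digit_paths p (p ^ n))"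
proof (rule inj_onI)
  fix x y assume "x \<in> gray_paths p n \<times> digit_paths p (p ^ n)" "y \<in> gray_paths p n \<times> digit_paths p (p ^ n)"
    and eq: "radix_join p n x = radix_join p n y"
  then obtain g A h B where x: "x = (g, A)" "g \<in> gray_paths p n" "A \<in> digit_paths p (p ^ n)"
    and y: "y = (h, B)" "h \<in> gray_paths p n" "B \<in> digit_paths p (p ^ n)" by blast
  have e: "A t + p * g (t div p) = B t + p * h (t div p)" if "t < p ^ Suc n" for t
    using fun_cong[OF eq, of t] that by (simp add: x(1) y(1) radix_join_def)
  have lt: "A t < p" "B t < p" if "t < p ^ Suc n" for t
    using digit_paths_mem(5)[OF x(3)] digit_paths_mem(5)[OF y(3)] that by simp_all
  have "A = B"
    by (rule PiE_ext[OF digit_paths_mem(1)[OF x(3)] digit_paths_mem(1)[OF y(3)]])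
       (use mixed_radix_inj[OF lt e] in simp)
  moreover have "g = h"
  proof (rule PiE_ext[OF gray_paths_mem(1)[OF x(2)] gray_paths_mem(1)[OF y(2)]])
    fix b assume "b \<in> {..<p ^ n}"
    then have "p * b < p ^ Suc n" using p by simp
    from mixed_radix_inj[OF lt[OF this] e[OF this]] p show "g b = h b" by simp
  qed
  ultimately show "x = y" using x y by simp
qed

text \<open>Each further digit multiplies the number by a power of K, which is prime to p.\<close>

lemma gray_paths_card:
  assumes "prime p"
  shows "\<not> p dvd card (gray_paths p n)"
proof -
  have p: "1 < p" using assms by (rule prime_gt_1_nat)
  obtain K where K: "\<not> p dvd K" "\<And>b x. x < p \<Longrightarrow> card (block_paths p b x) = K"
    by (rule block_paths_card[OF assms], rule that; simp)
  show ?thesis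
  proof (induction n)
    case 0
    have "gray_paths p 0 = {\<lambda>t\<in>{..<1}. 0}"
    proof (intro equalityI subsetI)
      fix g assume "g \<in> gray_paths p 0"
      from gray_paths_mem(1,3)[OF this] show "g \<in> {\<lambda>t\<in>{..<1}. 0}"
        by (auto intro!: extensionalityI[of g "{..<1}"] simp: PiE_iff)
    qed (auto simp: gray_paths_def bij_betw_def inj_on_def)
    with p show ?case by simp
  next
    case (Suc n)
    have "gray_paths p (Suc n) = radix_join p n ` (gray_paths p n \<times> digit_paths p (p ^ n))"
    proof
      show "gray_paths p (Suc n) \<subseteq> radix_join p n ` (gray_paths p n \<times> digit_paths p (p ^ n))"
        using radix_join_surj[OF p] by blast
      show "radix_join p n ` (gray_paths p n \<times> digit_paths p (p ^ n)) \<subseteq> gray_paths p (Suc n)"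
        using radix_join_in[OF p] by (simp add: image_subset_iff split_paired_all)
    qed
    then have "card (gray_paths p (Suc n)) = card (gray_paths p n) * K ^ (p ^ n)"
      by (simp add: card_image[OF radix_join_inj[OF p]] card_cartesian_product card_digit_paths[OF p K(2)])
    with Suc K(1) assms show ?case
      by (auto simp: prime_dvd_mult_iff dest: prime_dvd_power)
  qed
qed

lemma gray_paths_sign:
  assumes "prime p" "odd p" "g \<in> gray_paths p n"
  shows "sgn_map (p ^ n) g = 1"
  using assms(3)
proof (induction n arbitrary: g)
  case 0
  have "sgn_map 1 g = sgn_map 1 id"
    by (rule sgn_map_cong) (use gray_paths_mem(3)[OF 0] in simp)
  then show ?case by (simp add: sgn_map_def)
next
  case (Suc n)
  have p: "1 < p" using assms(1) by (rule prime_gt_1_nat)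
  obtain h A where h: "h \<in> gray_paths p n" and A: "A \<in> digit_paths p (p ^ n)" and g: "g = radix_join p n (h, A)"
    using radix_join_surj[OF p Suc.prems] by blast
  have "sgn_map (p * p ^ n) (\<lambda>t. A t + p * h (t div p)) = 1"
  proof (rule sgn_map_blockwise[OF gray_paths_mem(2)[OF h] _ _ assms(2) Suc.IH[OF h]])
    fix b assume b: "b < p ^ n"
    have "A (p * b + c) < p" if "c < p" for c
      using digit_paths_mem(5)[OF A, of "p * b + c"] mixed_radix_lt[OF that b] by (simp add: add.commute)
    then have "(\<lambda>c. A (p * b + c)) ` {..<p} \<subseteq> {..<p}" by auto
    then show "bij_betw (\<lambda>c. A (p * b + c)) {..<p} {..<p}"
      using digit_paths_mem(4)[OF A b] by (simp add: bij_betw_def endo_inj_surj)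
    have "sgn_map p (\<lambda>c\<in>{..<p}. A (p * b + c)) = 1"
      by (rule block_paths_sign[OF assms(1,2) block_of_digit_path[OF A b]]) (use p in simp)
    moreover have "sgn_map p (\<lambda>c\<in>{..<p}. A (p * b + c)) = sgn_map p (\<lambda>c. A (p * b + c))"
      by (rule sgn_map_cong) simp
    ultimately show "sgn_map p (\<lambda>c. A (p * b + c)) = 1" by simp
  qed
  moreover have "sgn_map (p ^ Suc n) g = sgn_map (p ^ Suc n) (\<lambda>t. A t + p * h (t div p))"
    by (rule sgn_map_cong) (simp add: g radix_join_def)
  ultimately show ?case by simp
qed

section \<open>Forcing the directions of a full flag\<close>

lemma dig_add_div_above:
  "1 < p \<Longrightarrow> k < K \<Longrightarrow> x < p ^ N \<Longrightarrow> dig_add p N (p ^ k) x div p ^ K = x div p ^ K"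
proof (induction N arbitrary: k K x)
  case 0
  then show ?case by simp
next
  case (Suc N)
  obtain K' where K: "K = Suc K'" using Suc.prems by (cases K) auto
  have x: "x div p < p ^ N" using Suc.prems by (simp add: less_mult_imp_div_less mult.commute)
  have "dig_add p (Suc N) (p ^ k) x div p ^ K = dig_add p N (p ^ k div p) (x div p) div p ^ K'"
    unfolding K power_Suc div_mult2_eq using Suc.prems(1) by (subst dig_add_div) simp_all
  also have "\<dots> = (x div p) div p ^ K'"
  proof (cases k)
    case 0
    then show ?thesis using Suc.prems(1) dig_add_0[OF _ x] by simp
  next
    case (Suc k')
    then show ?thesis using Suc.IH[of k' K' "x div p"] Suc.prems x K by simp
  qed
  finally show ?case by (simp add: K div_mult2_eq)
qed

lemma dig_add_funpow_inj:
  "1 < p \<Longrightarrow> k < N \<Longrightarrow> x < p ^ N \<Longrightarrow> inj_on (\<lambda>j. (dig_add p N (p ^ k) ^^ j) x) {..<p}"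
proof (induction N arbitrary: k x)
  case (Suc N)
  have x: "x div p < p ^ N" using Suc.prems by (simp add: less_mult_imp_div_less mult.commute)
  have pow: "(dig_add p (Suc N) h ^^ j) x
      = (x mod p + j * (h mod p)) mod p + p * (dig_add p N (h div p) ^^ j) (x div p)" for h j
    by (rule dig_add_funpow) (use Suc.prems in simp_all)
  show ?case
  proof (rule inj_onI)
    fix i j assume ij: "i \<in> {..<p}" "j \<in> {..<p}"
      and eq: "(dig_add p (Suc N) (p ^ k) ^^ i) x = (dig_add p (Suc N) (p ^ k) ^^ j) x"
    show "i = j"
    proof (cases k)
      case 0
      have "(i + x mod p) mod p = (j + x mod p) mod p"
        using arg_cong[OF eq, of "\<lambda>y. y mod p"] Suc.prems(1) unfolding pow by (simp add: 0 add.commute)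
      then show ?thesis using add_mod_cancel[of i "x mod p" p j] ij by simp
    next
      case (Suc k')
      have "(dig_add p N (p ^ k') ^^ i) (x div p) = (dig_add p N (p ^ k') ^^ j) (x div p)"
        using arg_cong[OF eq, of "\<lambda>y. y div p"] Suc.prems(1) unfolding pow by (simp add: Suc)
      then show ?thesis
        using inj_onD[OF Suc.IH[of k' "x div p"], of i j] Suc.prems x ij Suc by simp
    qed
  qed
qed simp

lemma sum_antimono_telescope:
  fixes f :: "nat \<Rightarrow> nat"
  assumes "\<And>k. f (Suc k) \<le> f k" "K \<le> n"
  shows "(\<Sum>k\<in>{K..<n}. f k - f (Suc k)) = f K - f n"
  using assms(2)
proof (induction n rule: dec_induct)
  case (step n)
  have "f n \<le> f K" using lift_Suc_antimono_le[of f] assms(1) step.hyps by blast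
  with step assms(1)[of n] show ?case by simp
qed simp

lemma div_power_antimono: "0 < p \<Longrightarrow> i div p ^ Suc k \<le> i div (p :: nat) ^ k"
  by (rule div_le_mono2) simp_all

context digit_translations
begin

lemma step_coeff_nonzero:
  assumes "step_coeff k e g h \<noteq> 0"
  shows "\<exists>j. h = (shift k ^^ j) g"
proof (rule ccontr)
  assume no: "\<not> ?thesis"
  then have "h \<noteq> (shift k ^^ 1) g" "h \<noteq> (shift k ^^ 0) g" "\<And>j. h \<noteq> (shift k ^^ j) g" by blast+
  then have "step_coeff k e g h = 0" by (simp add: step_coeff_def)
  with assms show False by simp
qed

lemma shift_funpow_div:
  "k < K \<Longrightarrow> x < q \<Longrightarrow> (shift k ^^ j) x div p ^ K = x div p ^ K"
proof (induction j)
  case (Suc j)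
  then show ?case using dig_add_div_above[OF p_gt_1, of k K "(shift k ^^ j) x" n] funpow_lt by simp
qed simp

lemma card_fibres_le:
  fixes u :: "nat \<Rightarrow> nat"
  assumes "\<And>c. card {i. i < q \<and> u i = c} \<le> P"
  shows "card {i. i < q \<and> a \<le> u i \<and> u i < b} \<le> (b - a) * P"
proof -
  have "{i. i < q \<and> a \<le> u i \<and> u i < b} = (\<Union>c\<in>{a..<b}. {i. i < q \<and> u i = c})" by auto
  then have "card {i. i < q \<and> a \<le> u i \<and> u i < b} \<le> (\<Sum>c\<in>{a..<b}. card {i. i < q \<and> u i = c})"
    using card_UN_le[of "{a..<b}" "\<lambda>c. {i. i < q \<and> u i = c}"] by simp
  also have "\<dots> \<le> (\<Sum>c\<in>{a..<b}. P)" by (rule sum_mono) (rule assms)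
  finally show ?thesis by simp
qed

text \<open>The projection of the path to the digits from \<open>K\<close> upwards changes only in directions
  \<open>k \<ge> K\<close>. The extents leave so few such steps that every value of the projection is taken on
  one block of consecutive times, of length exactly $p^K$.\<close>

lemma high_steps:
  fixes d :: "nat \<Rightarrow> nat \<Rightarrow> nat" and g :: "nat \<Rightarrow> nat"
  assumes K: "K \<le> n"
    and d0: "(\<Sum>k<n. d 0 k) = 0"
    and d_le: "\<And>k. k < n \<Longrightarrow> d (q - 1) k \<le> extent k"
    and step: "\<And>i. Suc i < q \<Longrightarrow> \<exists>k<n. d (Suc i) = (d i)(k := Suc (d i k)) \<and> (\<exists>j. g (Suc i) = (shift k ^^ j) (g i))"
    and g: "bij_betw g {..<q} {..<q}" and i: "i < q"
  shows "(\<Sum>k\<in>{K..<n}. d i k) = i div p ^ K"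
proof -
  define u where "u i = (\<Sum>k\<in>{K..<n}. d i k)" for i
  let ?P = "p ^ K" and ?M = "p ^ (n - K)"
  have q: "q = ?M * ?P" using K by (simp flip: power_add)
  have g_lt: "g i < q" if "i < q" for i using g that by (auto simp: bij_betw_def)
  have u0: "u 0 = 0" using d0 by (simp add: u_def)
  have u_Suc: "u i \<le> u (Suc i) \<and> (u (Suc i) = u i \<longrightarrow> g (Suc i) div ?P = g i div ?P)" if Si: "Suc i < q" for i
  proof -
    obtain k j where k: "k < n" "d (Suc i) = (d i)(k := Suc (d i k))" "g (Suc i) = (shift k ^^ j) (g i)"
      using step[OF Si] by blast
    show ?thesis
    proof (cases "K \<le> k")
      case True
      then have "u (Suc i) = Suc (d i k) + (\<Sum>l\<in>{K..<n} - {k}. d i l)"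
        using k unfolding u_def by (subst sum.remove[of _ k]) (auto intro!: sum.cong)
      moreover have "u i = d i k + (\<Sum>l\<in>{K..<n} - {k}. d i l)"
        using k True unfolding u_def by (subst sum.remove[of _ k]) auto
      ultimately show ?thesis by simp
    next
      case False
      then have "u (Suc i) = u i" unfolding u_def k(2) by (intro sum.cong) auto
      moreover have "g (Suc i) div ?P = g i div ?P"
        using shift_funpow_div[of k K "g i" j] k False g_lt[of i] Si by simp
      ultimately show ?thesis by simp
    qed
  qed
  have u_mono: "u i \<le> u j" if "i \<le> j" "j < q" for i j
    using that
  proof (induction j rule: dec_induct)
    case (step j)
    then show ?case using u_Suc[of j] by simp
  qed simp
  have g_const: "g j div ?P = g i div ?P" if "i \<le> j" "j < q" "u j = u i" for i j
    using that
  proof (induction j rule: dec_induct)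
    case (step j)
    have "u i \<le> u j" using u_mono step by simp
    then have "u j = u i" "u (Suc j) = u j" using u_Suc[of j] step by simp_all
    then show ?case using u_Suc[of j] step by simp
  qed simp
  have "u (q - 1) \<le> (\<Sum>k\<in>{K..<n}. extent k)"
    unfolding u_def using d_le by (intro sum_mono) simp
  also have "\<dots> = (q - 1) div ?P - (q - 1) div q"
    unfolding extent_def using sum_antimono_telescope[of "\<lambda>k. (q - 1) div p ^ k", OF _ K] div_power_antimono[OF p_pos] .
  also have "\<dots> < ?M"
  proof -
    have "(q - 1) div ?P < ?M" using p_pos by (simp add: q less_mult_imp_div_less)
    then show ?thesis by simp
  qed
  finally have u_last: "u (q - 1) < ?M" .
  have u_lt: "u i < ?M" if "i < q" for i
  proof -
    have "i \<le> q - 1" "q - 1 < q" using that by linarith+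
    from u_mono[OF this] u_last show ?thesis by (rule le_less_trans)
  qed
  have fibre: "card {i. i < q \<and> u i = c} \<le> ?P" for c
  proof (cases "{i. i < q \<and> u i = c} = {}")
    case True
    then show ?thesis by (simp only: card.empty)
  next
    case False
    then obtain i0 where i0: "i0 < q" "u i0 = c" by blast
    let ?h = "g i0 div ?P"
    have "g i div ?P = ?h" if "i < q" "u i = c" for i
      using g_const[of i i0] g_const[of i0 i] that i0 by (cases "i \<le> i0") simp_all
    moreover have "y \<in> {?h * ?P..<?h * ?P + ?P}" if "y div ?P = ?h" for y
    proof -
      have "y = ?h * ?P + y mod ?P" using div_mult_mod_eq[of y ?P] that by simp
      moreover have "y mod ?P < ?P" using p_pos by simp
      ultimately show ?thesis by (metis atLeastLessThan_iff le_add1 nat_add_left_cancel_less)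
    qed
    ultimately have "g ` {i. i < q \<and> u i = c} \<subseteq> {?h * ?P..<?h * ?P + ?P}"
      by blast
    moreover have "inj_on g {i. i < q \<and> u i = c}"
      using bij_betw_imp_inj_on[OF g] by (rule inj_on_subset) auto
    ultimately have "card {i. i < q \<and> u i = c} \<le> card {?h * ?P..<?h * ?P + ?P}"
      by (intro card_inj_on_le) auto
    then show ?thesis by simp
  qed
  \<comment> \<open>The fibres of u have at most p^K elements and u has at most p^(n-K) values,
    while q is the product of the two. Counting the times up to i and the times from i on squeezes i
    between u i and Suc (u i) multiples of p^K.\<close>
  have "card {..i} \<le> card {j. j < q \<and> 0 \<le> u j \<and> u j < Suc (u i)}"
    using u_mono[of _ i] i by (intro card_mono) (auto simp: less_Suc_eq_le)
  also have "\<dots> \<le> (Suc (u i) - 0) * ?P" by (rule card_fibres_le[OF fibre])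
  finally have upper: "i < Suc (u i) * ?P" by simp
  have "card {i..<q} \<le> card {j. j < q \<and> u i \<le> u j \<and> u j < ?M}"
    using u_mono[of i] u_lt by (intro card_mono) auto
  also have "\<dots> \<le> (?M - u i) * ?P" by (rule card_fibres_le[OF fibre])
  also have "(?M - u i) * ?P = q - u i * ?P" unfolding diff_mult_distrib q[symmetric] ..
  finally have "q - i \<le> q - u i * ?P" unfolding card_atLeastLessThan .
  moreover have "u i * ?P < ?M * ?P" using u_lt[OF i] p_pos by simp
  then have "u i * ?P < q" unfolding q[symmetric] .
  ultimately have "u i * ?P \<le> i" using i by linarith
  then have "i div ?P = u i" using upper by (intro div_nat_eqI) (simp_all add: mult.commute)
  then show ?thesis by (simp add: u_def)
qed

text \<open>A nonzero weight makes successive cells differ by one degree in a direction k and by a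
  power of the shift in that direction, as \<open>high_steps\<close> demands. Subtracting its
  results for k and Suc k isolates the degree in direction k.\<close>

lemma forced_depth:
  assumes s: "s \<in> PiE {..<q} grid_cells" and w: "grid_weight s \<noteq> 0"
    and bij: "bij_betw (\<lambda>i. snd (s i)) {..<q} {..<q}" and i: "i < q" and k: "k < n"
  shows "fst (s i) k = depth p i k"
proof -
  have cell: "s i \<in> grid_cells i" if "i < q" for i using PiE_mem[OF s, of i] that by simp
  have step: "\<exists>k<n. fst (s (Suc i)) = (fst (s i))(k := Suc (fst (s i) k)) \<and> (\<exists>j. snd (s (Suc i)) = (shift k ^^ j) (snd (s i)))"
    if "Suc i < q" for i
  proof -
    have "i < q - 1" using that by simp
    then have "grid_incidence (s i) (s (Suc i)) \<noteq> 0"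
      using w by (auto simp: grid_weight_def chain_weight_def)
    then obtain k where "k < n" "of_bool (fst (s (Suc i)) = (fst (s i))(k := Suc (fst (s i) k)))
        * (- 1) ^ (\<Sum>j<k. fst (s i) j) * step_coeff k (fst (s i) k) (snd (s i)) (snd (s (Suc i))) \<noteq> 0"
      unfolding grid_incidence_def by (metis (no_types, lifting) lessThan_iff sum.neutral)
    then show ?thesis using step_coeff_nonzero by (intro exI[of _ k]) auto
  qed
  have high: "(\<Sum>k\<in>{K..<n}. fst (s i) k) = i div p ^ K" if "K \<le> n" for K
  proof (rule high_steps[OF that, where d = "\<lambda>i. fst (s i)" and g = "\<lambda>i. snd (s i)"])
    show "(\<Sum>k<n. fst (s 0) k) = 0" using cell[of 0] p_pos by (simp add: grid_cells_iff)
    show "fst (s (q - 1)) k \<le> extent k" if "k < n" for k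
      by (rule grid_cell_le_extent[OF cell that]) (use p_pos in simp)
  qed (use step bij i in simp_all)
  have "(\<Sum>l\<in>{k..<n}. fst (s i) l) = fst (s i) k + (\<Sum>l\<in>{Suc k..<n}. fst (s i) l)"
    by (rule sum.atLeast_Suc_lessThan[OF k])
  then show ?thesis
    using high[of k] high[of "Suc k"] k by (simp add: depth_def)
qed

end

section \<open>Evaluation of the coarse count by Gray paths\<close>

context digit_translations
begin

definition forced_cell :: "nat \<Rightarrow> nat \<Rightarrow> nat" where
  "forced_cell i = (\<lambda>k\<in>{..<n}. depth p i k)"

definition forced_flag :: "(nat \<Rightarrow> nat) \<Rightarrow> nat \<Rightarrow> grid_cell" where
  "forced_flag g = (\<lambda>i\<in>{..<q}. (forced_cell i, g i))"

lemma direction_lt: "Suc i < q \<Longrightarrow> multiplicity p (Suc i) < n"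
proof -
  assume i: "Suc i < q"
  have "p ^ multiplicity p (Suc i) \<le> Suc i"
    by (rule dvd_imp_le[OF multiplicity_dvd]) simp
  then have "p ^ multiplicity p (Suc i) < p ^ n" using i by simp
  then show ?thesis using p_gt_1 by simp
qed

text \<open>The quotient by p^k grows exactly when p^k divides \<open>Suc i\<close>. In the
  difference of two consecutive quotients this leaves only k equal to the valuation.\<close>

lemma depth_Suc: "depth p (Suc i) k = depth p i k + of_bool (k = multiplicity p (Suc i))"
proof -
  have dvd: "p ^ k dvd Suc i \<longleftrightarrow> k \<le> multiplicity p (Suc i)" for k
    using p_gt_1 by (intro power_dvd_iff_le_multiplicity) auto
  have Suc_div: "Suc i div p ^ k = i div p ^ k + of_bool (k \<le> multiplicity p (Suc i))" for k
    by (simp add: div_Suc dvd dvd_eq_mod_eq_0[symmetric])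
  have "i div p ^ Suc k \<le> i div p ^ k" by (rule div_power_antimono[OF p_pos])
  then show ?thesis
    unfolding depth_def Suc_div by (auto simp: of_bool_def)
qed

lemma depth_mono: "i \<le> j \<Longrightarrow> depth p i k \<le> depth p j k"
  by (rule lift_Suc_mono_le[of "\<lambda>i. depth p i k"]) (simp_all add: depth_Suc)

lemma forced_cell_in: "i < q \<Longrightarrow> x < q \<Longrightarrow> (forced_cell i, x) \<in> grid_cells i"
proof -
  assume i: "i < q" and x: "x < q"
  have "depth p i k \<le> extent k" for k
    using depth_mono[of i "q - 1" k] i by (simp add: extent_def depth_def)
  then have "forced_cell i \<in> PiE {..<n} (\<lambda>k. {..extent k})"
    by (simp add: forced_cell_def)
  moreover have "(\<Sum>k<n. forced_cell i k) = i"
  proof -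
    have "(\<Sum>k<n. forced_cell i k) = (\<Sum>k\<in>{0..<n}. i div p ^ k - i div p ^ Suc k)"
      by (rule sum.cong) (auto simp: forced_cell_def depth_def)
    also have "\<dots> = i div p ^ 0 - i div p ^ n"
      by (rule sum_antimono_telescope) (simp_all only: div_power_antimono[OF p_pos] le0)
    finally show ?thesis using i by simp
  qed
  ultimately show ?thesis using x by (simp add: grid_cells_iff)
qed

definition step_sign :: "nat \<Rightarrow> int" where
  "step_sign i = (- 1) ^ (\<Sum>j<multiplicity p (Suc i). depth p i j)"

lemma grid_incidence_forced:
  assumes i: "Suc i < q"
  shows "grid_incidence (forced_cell i, x) (forced_cell (Suc i), y)
    = step_sign i * step_coeff (multiplicity p (Suc i)) (depth p i (multiplicity p (Suc i))) x y"
proof -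
  let ?k = "multiplicity p (Suc i)" and ?d = "forced_cell i"
  have k: "?k < n" by (rule direction_lt[OF i])
  have up: "forced_cell (Suc i) = ?d(k := Suc (?d k)) \<longleftrightarrow> k = ?k" if "k < n" for k
  proof
    assume "forced_cell (Suc i) = ?d(k := Suc (?d k))"
    from fun_cong[OF this, of k] that show "k = ?k"
      by (cases "k = ?k") (simp_all add: forced_cell_def depth_Suc)
  next
    assume "k = ?k"
    then show "forced_cell (Suc i) = ?d(k := Suc (?d k))"
      using k by (auto simp: forced_cell_def fun_eq_iff depth_Suc)
  qed
  have "grid_incidence (?d, x) (forced_cell (Suc i), y)
      = (\<Sum>k<n. of_bool (k = ?k) * (- 1) ^ (\<Sum>j<k. ?d j) * step_coeff k (?d k) x y)"
    unfolding grid_incidence_def fst_conv snd_conv by (rule sum.cong) (simp_all add: up)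
  also have "\<dots> = (\<Sum>k\<in>{?k}. (- 1) ^ (\<Sum>j<k. ?d j) * step_coeff k (?d k) x y)"
    by (rule sum.mono_neutral_cong_right) (use k in auto)
  finally have inc: "grid_incidence (?d, x) (forced_cell (Suc i), y)
      = (- 1) ^ (\<Sum>j<?k. ?d j) * step_coeff ?k (?d ?k) x y" by simp
  have "(\<Sum>j<?k. ?d j) = (\<Sum>j<?k. depth p i j)"
    by (rule sum.cong) (use k in \<open>auto simp: forced_cell_def\<close>)
  moreover have "?d ?k = depth p i ?k" using k by (simp add: forced_cell_def)
  ultimately show ?thesis unfolding inc step_sign_def by simp
qed

text \<open>The coefficient is 0 or 1: the negative term of T - 1 would need x = y, and in the norm
  the p powers of the shift take x to different places.\<close>

lemma step_coeff_gray:
  assumes i: "Suc i < q" and x: "x < q" and xy: "x \<noteq> y"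
  shows "step_coeff (multiplicity p (Suc i)) (depth p i (multiplicity p (Suc i))) x y = of_bool (gray_step p n i x y)"
proof (cases "even (depth p i (multiplicity p (Suc i)))")
  case True
  then show ?thesis using xy by (auto simp: step_coeff_def gray_step_def)
next
  case odd: False
  let ?k = "multiplicity p (Suc i)"
  let ?f = "\<lambda>j. (shift ?k ^^ j) x"
  have inj: "inj_on ?f {..<p}"
    by (rule dig_add_funpow_inj[OF p_gt_1 direction_lt[OF i] x])
  have step: "gray_step p n i x y \<longleftrightarrow> y \<in> ?f ` {..<p}"
    using odd by (auto simp: gray_step_def Let_def)
  have "step_coeff ?k (depth p i ?k) x y = (\<Sum>j<p. of_bool (y = ?f j))"
    using odd by (simp only: step_coeff_def if_False)
  also have "\<dots> = (\<Sum>z\<in>?f ` {..<p}. of_bool (y = z))"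
    by (simp add: sum.reindex[OF inj])
  also have "\<dots> = of_bool (y \<in> ?f ` {..<p})"
    by simp
  finally show ?thesis unfolding step .
qed

definition path_sign :: int where
  "path_sign = (\<Prod>i<q - 1. step_sign i)"

lemma abs_path_sign: "\<bar>path_sign\<bar> = 1"
  by (simp add: path_sign_def step_sign_def abs_prod power_abs)

lemma grid_weight_forced_flag:
  assumes g: "inj_on g {..<q}" "\<And>i. i < q \<Longrightarrow> g i < q"
  shows "grid_weight (forced_flag g)
    = path_sign * of_bool (\<forall>i. Suc i < q \<longrightarrow> gray_step p n i (g i) (g (Suc i)))"
proof -
  have "grid_weight (forced_flag g) = (\<Prod>i<q - 1. step_sign i * of_bool (gray_step p n i (g i) (g (Suc i))))"
    unfolding grid_weight_def chain_weight_def mult_1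
  proof (rule prod.cong[OF refl])
    fix i assume "i \<in> {..<q - 1}"
    then have i: "Suc i < q" by (simp add: less_diff_conv)
    then have "g i \<noteq> g (Suc i)" using inj_onD[OF g(1), of i "Suc i"] by auto
    with i show "grid_incidence (forced_flag g i) (forced_flag g (Suc i))
        = step_sign i * of_bool (gray_step p n i (g i) (g (Suc i)))"
      using grid_incidence_forced[OF i, of "g i" "g (Suc i)"] step_coeff_gray[OF i g(2)[of i], of "g (Suc i)"]
      by (simp add: forced_flag_def)
  qed
  also have "\<dots> = path_sign * (\<Prod>i<q - 1. of_bool (gray_step p n i (g i) (g (Suc i))))"
    by (simp only: prod.distrib path_sign_def)
  also have "(\<Prod>i<q - 1. of_bool (gray_step p n i (g i) (g (Suc i))) :: int)
      = of_bool (\<forall>i. Suc i < q \<longrightarrow> gray_step p n i (g i) (g (Suc i)))"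
  proof (cases "\<forall>i. Suc i < q \<longrightarrow> gray_step p n i (g i) (g (Suc i))")
    case True
    then have "(\<Prod>i<q - 1. of_bool (gray_step p n i (g i) (g (Suc i))) :: int) = 1"
      by (intro prod.neutral) (simp add: less_diff_conv)
    with True show ?thesis by simp
  next
    case False
    then obtain i where "Suc i < q" "\<not> gray_step p n i (g i) (g (Suc i))" by blast
    then have "(\<Prod>i<q - 1. of_bool (gray_step p n i (g i) (g (Suc i))) :: int) = 0"
      by (intro prod_zero) (auto intro!: bexI[of _ i])
    with False show ?thesis by simp
  qed
  finally show ?thesis .
qed

lemma inj_forced_flag: "inj_on forced_flag (gray_paths p n)"
proof (rule inj_onI)
  fix g h assume g: "g \<in> gray_paths p n" and h: "h \<in> gray_paths p n" and eq: "forced_flag g = forced_flag h"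
  show "g = h"
  proof (rule PiE_ext[OF gray_paths_mem(1)[OF g] gray_paths_mem(1)[OF h]])
    fix i assume "i \<in> {..<q}"
    with fun_cong[OF eq, of i] show "g i = h i" by (simp add: forced_flag_def)
  qed
qed

lemma contributing_flag_is_forced:
  assumes s: "s \<in> PiE {..<q} grid_cells" and w: "grid_weight s \<noteq> 0"
    and bij: "bij_betw (\<lambda>i. snd (s i)) {..<q} {..<q}" and s0: "snd (s 0) = 0"
  shows "s \<in> forced_flag ` gray_paths p n"
proof -
  define g where "g = (\<lambda>i\<in>{..<q}. snd (s i))"
  have cell: "s i \<in> grid_cells i" if "i < q" for i using PiE_mem[OF s, of i] that by simp
  have g_lt: "g i < q" if "i < q" for i using cell[OF that] that by (simp add: g_def grid_cells_iff)
  have bij_g: "bij_betw g {..<q} {..<q}"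
    using bij by (rule bij_betw_cong[THEN iffD1, rotated]) (simp add: g_def)
  have "s = forced_flag g"
  proof (rule extensionalityI[of _ "{..<q}"])
    show "s \<in> extensional {..<q}" using s by (simp add: PiE_iff)
    show "forced_flag g \<in> extensional {..<q}" by (simp add: forced_flag_def)
    fix i assume "i \<in> {..<q}"
    then have i: "i < q" by simp
    have "fst (s i) = forced_cell i"
    proof (rule extensionalityI[of _ "{..<n}"])
      show "fst (s i) \<in> extensional {..<n}" using cell[OF i] by (simp add: grid_cells_iff PiE_iff)
      show "forced_cell i \<in> extensional {..<n}" by (simp add: forced_cell_def)
      show "fst (s i) k = forced_cell i k" if "k \<in> {..<n}" for k
        using forced_depth[OF s w bij i, of k] that by (simp add: forced_cell_def)
    qed
    then show "s i = forced_flag g i"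
      using i by (simp add: forced_flag_def g_def prod_eq_iff)
  qed
  moreover have "g \<in> gray_paths p n"
    unfolding gray_paths_def
  proof (intro CollectI conjI)
    show "g \<in> PiE {..<q} (\<lambda>_. {..<q})" using g_lt by (simp add: PiE_iff g_def)
    show "bij_betw g {..<q} {..<q}" by (rule bij_g)
    show "g 0 = 0" using s0 p_pos by (simp add: g_def)
    show "\<forall>i. Suc i < q \<longrightarrow> gray_step p n i (g i) (g (Suc i))"
    proof (rule ccontr)
      assume no: "\<not> ?thesis"
      have "grid_weight (forced_flag g)
          = path_sign * of_bool (\<forall>i. Suc i < q \<longrightarrow> gray_step p n i (g i) (g (Suc i)))"
        by (rule grid_weight_forced_flag) (use bij_g g_lt in \<open>simp_all add: bij_betw_def\<close>)
      also have "\<dots> = 0" using no by (simp only: of_bool_eq mult_zero_right)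
      finally have "grid_weight (forced_flag g) = 0" .
      with w \<open>s = forced_flag g\<close> show False by simp
    qed
  qed
  ultimately show ?thesis by blast
qed

lemma forced_flag_in:
  assumes g: "g \<in> gray_paths p n"
  shows "forced_flag g \<in> PiE {..<q} grid_cells"
  using forced_cell_in gray_paths_mem(5)[OF g] by (simp add: PiE_iff forced_flag_def)

lemma grid_count: "grid.count 0 (\<lambda>_. snd) = path_sign * (\<Sum>g\<in>gray_paths p n. sgn_map q g)"
proof -
  have "grid.count 0 (\<lambda>_. snd) = (\<Sum>s\<in>forced_flag ` gray_paths p n. of_bool (snd (s 0) = 0) *
      (grid_weight s * sgn_map q (\<lambda>i. snd (s i))))"
    unfolding grid.count_def
  proof (rule sum.mono_neutral_right)
    show "finite (PiE {..<q} grid_cells)" by (intro finite_PiE) (simp_all add: finite_grid_cells)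
    show "forced_flag ` gray_paths p n \<subseteq> PiE {..<q} grid_cells"
      using forced_flag_in by (rule image_subsetI)
    show "\<forall>s\<in>PiE {..<q} grid_cells - forced_flag ` gray_paths p n.
        of_bool (snd (s 0) = 0) * (grid_weight s * sgn_map q (\<lambda>i. snd (s i))) = 0"
    proof
      fix s assume s: "s \<in> PiE {..<q} grid_cells - forced_flag ` gray_paths p n"
      then have "grid_weight s = 0 \<or> \<not> bij_betw (\<lambda>i. snd (s i)) {..<q} {..<q} \<or> snd (s 0) \<noteq> 0"
        using contributing_flag_is_forced by blast
      then show "of_bool (snd (s 0) = 0) * (grid_weight s * sgn_map q (\<lambda>i. snd (s i))) = 0"
        by (auto simp: sgn_map_def)
    qed
  qed
  also have "\<dots> = (\<Sum>g\<in>gray_paths p n. of_bool (snd (forced_flag g 0) = 0) *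
      (grid_weight (forced_flag g) * sgn_map q (\<lambda>i. snd (forced_flag g i))))"
    by (simp add: sum.reindex[OF inj_forced_flag])
  also have "\<dots> = (\<Sum>g\<in>gray_paths p n. path_sign * sgn_map q g)"
  proof (rule sum.cong[OF refl])
    fix g assume g: "g \<in> gray_paths p n"
    have "grid_weight (forced_flag g)
        = path_sign * of_bool (\<forall>i. Suc i < q \<longrightarrow> gray_step p n i (g i) (g (Suc i)))"
      by (rule grid_weight_forced_flag)
         (use gray_paths_mem(2)[OF g] gray_paths_mem(5)[OF g] in \<open>simp_all add: bij_betw_def\<close>)
    also have "(\<forall>i. Suc i < q \<longrightarrow> gray_step p n i (g i) (g (Suc i))) \<longleftrightarrow> True"
      using gray_paths_mem(4)[OF g] by simp
    finally have "grid_weight (forced_flag g) = path_sign" by simp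
    moreover have "sgn_map q (\<lambda>i. snd (forced_flag g i)) = sgn_map q g"
      by (rule sgn_map_cong) (simp add: forced_flag_def)
    moreover have "snd (forced_flag g 0) = 0"
      using gray_paths_mem(3)[OF g] p_pos by (simp add: forced_flag_def)
    ultimately show "of_bool (snd (forced_flag g 0) = 0) *
      (grid_weight (forced_flag g) * sgn_map q (\<lambda>i. snd (forced_flag g i))) = path_sign * sgn_map q g"
      by simp
  qed
  finally show ?thesis by (simp add: sum_distrib_left)
qed

text \<open>Modulo p every Gray path counts as 1, since its sign is 1 for odd p and an odd number
  for p = 2. Up to a global sign the count is therefore the number of Gray paths.\<close>

theorem grid_count_nonzero: "\<not> int p dvd grid.count 0 (\<lambda>_. snd)"
proof
  assume "int p dvd grid.count 0 (\<lambda>_. snd)"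
  then have "int p dvd (\<Sum>g\<in>gray_paths p n. sgn_map q g)"
    unfolding grid_count using abs_path_sign by (metis abs_mult dvd_abs_iff mult.left_neutral)
  moreover have "int p dvd (\<Sum>g\<in>gray_paths p n. 1 - sgn_map q g)"
  proof (rule dvd_sum)
    fix g assume g: "g \<in> gray_paths p n"
    show "int p dvd 1 - sgn_map q g"
    proof (cases "odd p")
      case True
      then show ?thesis using gray_paths_sign[OF prime_p True g] by simp
    next
      case False
      then have "p = 2" using prime_p by (metis prime_odd_nat prime_ge_2_nat le_neq_implies_less)
      moreover have "sgn_map q g = 1 \<or> sgn_map q g = - 1"
        using gray_paths_mem(2)[OF g] unfolding sgn_map_def sign_on_def by (metis sign_def)
      ultimately show ?thesis by auto
    qed
  qed
  ultimately have "int p dvd (\<Sum>g\<in>gray_paths p n. sgn_map q g) + (\<Sum>g\<in>gray_paths p n. 1 - sgn_map q g)"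
    by (rule dvd_add)
  then have "int p dvd int (card (gray_paths p n))"
    by (simp add: sum_subtractf)
  then show False
    using gray_paths_card[OF prime_p] by simp
qed

end

section \<open>From labelled flags to envy-free divisions\<close>

lemma tendsto_fun_iff:
  fixes f :: "'c \<Rightarrow> 'a \<Rightarrow> 'b::topological_space"
  shows "(f \<longlongrightarrow> l) F \<longleftrightarrow> (\<forall>v. ((\<lambda>c. f c v) \<longlongrightarrow> l v) F)"
  using limitin_componentwise[of "\<lambda>_. euclidean" UNIV f l F]
  by (simp add: euclidean_product_topology)

text \<open>Replacing the support by a fixed finite index set and implications by disjunctions
  exhibits each clause as a closed condition on coordinates.\<close>

lemma C3_iff:
  "w \<in> C3 r \<longleftrightarrow> (\<forall>v. 0 \<le> w v) \<and> (\<forall>v. v \<in> {1..r} \<times> {1..r} \<or> w v = 0) \<and>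
     (\<forall>t b b'. b = b' \<or> w (t, b) = 0 \<or> w (t, b') = 0) \<and> (\<Sum>v\<in>{1..r} \<times> {1..r}. w v) = 1"
proof -
  let ?I = "{1..r} \<times> {1..r}"
  have supp: "{v. w v \<noteq> 0} \<in> join_complex r \<longleftrightarrow>
      (\<forall>v. v \<in> ?I \<or> w v = 0) \<and> (\<forall>t b b'. b = b' \<or> w (t, b) = 0 \<or> w (t, b') = 0)"
    unfolding join_complex_def by blast
  show ?thesis
  proof (cases "\<forall>v. v \<in> ?I \<or> w v = 0")
    case True
    then have "{v. w v \<noteq> 0} \<subseteq> ?I" by blast
    then have eq: "(\<Sum>v | w v \<noteq> 0. w v) = (\<Sum>v\<in>?I. w v)"
      by (rule sum.mono_neutral_left[rotated]) auto
    show ?thesis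
      unfolding C3_def geometric_realization_def mem_Collect_eq supp eq by argo
  next
    case False
    then show ?thesis
      unfolding C3_def geometric_realization_def mem_Collect_eq supp by argo
  qed
qed

lemma closed_C3: "closed (C3 r)"
proof -
  have "C3 r = {w. (\<forall>v. 0 \<le> w v) \<and> (\<forall>v. v \<in> {1..r} \<times> {1..r} \<or> w v = 0) \<and>
     (\<forall>t b b'. b = b' \<or> w (t, b) = 0 \<or> w (t, b') = 0) \<and> (\<Sum>v\<in>{1..r} \<times> {1..r}. w v) = 1}"
    by (rule set_eqI) (simp only: C3_iff mem_Collect_eq)
  also have "closed \<dots>"
    by (intro closed_Collect_conj closed_Collect_all closed_Collect_disj closed_Collect_const
          closed_Collect_le closed_Collect_eq continuous_on_const continuous_on_sum continuous_on_product_coordinates)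
  finally show ?thesis .
qed

lemma compact_C3: "compact (C3 r)"
proof -
  have "compactin (product_topology (\<lambda>_. euclidean) UNIV) (PiE (UNIV :: (nat \<times> nat) set) (\<lambda>_. {0..1::real}))"
    unfolding compactin_PiE by simp
  then have "compact (PiE (UNIV :: (nat \<times> nat) set) (\<lambda>_. {0..1::real}))"
    by (simp add: euclidean_product_topology)
  moreover have "C3 r \<subseteq> PiE UNIV (\<lambda>_. {0..1})"
  proof
    fix w assume w: "w \<in> C3 r"
    have nonneg: "0 \<le> w v" for v using w unfolding C3_iff by blast
    have total: "(\<Sum>v\<in>{1..r} \<times> {1..r}. w v) = 1" using w unfolding C3_iff by blast
    have "w v \<le> 1" for v
    proof (cases "v \<in> {1..r} \<times> {1..r}")
      case True
      then have "w v \<le> (\<Sum>v\<in>{1..r} \<times> {1..r}. w v)"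
        by (rule member_le_sum) (simp_all only: nonneg finite_cartesian_product finite_atLeastAtMost)
      then show ?thesis unfolding total .
    next
      case False
      then have "w v = 0" using w unfolding C3_iff by blast
      then show ?thesis by simp
    qed
    then show "w \<in> PiE UNIV (\<lambda>_. {0..1})" using nonneg by (simp add: PiE_iff)
  qed
  ultimately show ?thesis
    using closed_C3 compact_Int_closed[of "PiE UNIV (\<lambda>_. {0..1})" "C3 r"] by (simp add: Int_absorb1)
qed

text \<open>A subsequence of the points of player 1 converges by compactness. The points of the
  other players come arbitrarily near to it, so closedness puts the one limit into all the sets
  \<open>D i i\<close>.\<close>

lemma envy_free_limit:
  assumes closed: "closed_preferences r D" and r: "0 < r"
    and approx: "\<And>e. 0 < e \<Longrightarrow> \<exists>x. (\<forall>i\<in>{1..r}. x i \<in> D i i) \<and> (\<forall>i\<in>{1..r}. \<forall>v. \<bar>x i v - x 1 v\<bar> \<le> e)"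
  shows "\<exists>w\<in>C3 r. \<forall>i\<in>{1..r}. w \<in> D i i"
proof -
  have clo: "closedin (top_of_set (C3 r)) (D i i)" if "i \<in> {1..r}" for i
    using closed that by (simp add: closed_preferences_def)
  then have sub: "D i i \<subseteq> C3 r" if "i \<in> {1..r}" for i
    using closedin_imp_subset that by blast
  have "\<exists>x. (\<forall>i\<in>{1..r}. x i \<in> D i i) \<and> (\<forall>i\<in>{1..r}. \<forall>v. \<bar>x i v - x 1 v\<bar> \<le> inverse (real (Suc k)))" for k
    by (rule approx) simp
  then obtain X where X: "\<And>k i. i \<in> {1..r} \<Longrightarrow> X k i \<in> D i i"
    "\<And>k i v. i \<in> {1..r} \<Longrightarrow> \<bar>X k i v - X k 1 v\<bar> \<le> inverse (real (Suc k))"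
    by metis
  have "seq_compact (C3 r)"
    using compact_C3 by (simp add: compact_eq_seq_compact_metric)
  moreover have one: "1 \<in> {1..r}" using r by simp
  have "X k 1 \<in> C3 r" for k using X(1)[OF one] sub[OF one] by blast
  ultimately obtain w \<rho> where w: "w \<in> C3 r" and \<rho>: "strict_mono \<rho>" and lim: "((\<lambda>k. X k 1) \<circ> \<rho>) \<longlonglongrightarrow> w"
    using seq_compactE[of "C3 r" "\<lambda>k. X k 1"] by metis
  have "w \<in> D i i" if i: "i \<in> {1..r}" for i
  proof -
    have "(\<lambda>k. X (\<rho> k) i) \<longlonglongrightarrow> w"
      unfolding tendsto_fun_iff
    proof
      fix v
      have "(\<lambda>k. inverse (real (Suc (\<rho> k)))) \<longlonglongrightarrow> 0"
        using LIMSEQ_subseq_LIMSEQ[OF LIMSEQ_inverse_real_of_nat \<rho>] by (simp add: o_def)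
      then have "(\<lambda>k. X (\<rho> k) i v - X (\<rho> k) 1 v) \<longlonglongrightarrow> 0"
        by (rule Lim_null_comparison[rotated]) (use X(2)[OF i] in simp)
      moreover have "(\<lambda>k. X (\<rho> k) 1 v) \<longlonglongrightarrow> w v"
        using lim unfolding tendsto_fun_iff o_def by blast
      ultimately have "(\<lambda>k. (X (\<rho> k) i v - X (\<rho> k) 1 v) + X (\<rho> k) 1 v) \<longlonglongrightarrow> 0 + w v"
        by (rule tendsto_add)
      then show "(\<lambda>k. X (\<rho> k) i v) \<longlonglongrightarrow> w v" by simp
    qed
    moreover obtain T where T: "closed T" "D i i = C3 r \<inter> T"
      using clo[OF i] by (auto simp: closedin_closed)
    moreover have "X (\<rho> k) i \<in> T" for k using X(1)[OF i] T(2) by blast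
    ultimately have "w \<in> T" using closed_sequentially[of T "\<lambda>k. X (\<rho> k) i"] by blast
    with w T(2) show ?thesis by blast
  qed
  with w show ?thesis by blast
qed

section \<open>Preferences as an equivariant labelling of the fine cells\<close>

locale subdivided_translations = digit_translations p n for p n :: nat +
  fixes N :: nat
  assumes N_pos: "0 < N"
begin

sublocale fine: subdivided_flags q p grid_cells grid_weight ad "dig_neg p n" grid_act "\<lambda>_. snd" N
  by unfold_locales (use q_gt_1 N_pos in simp_all)

lemma cell_act_cell_act:
  assumes "c \<in> fine.Cells"
  shows "fine.cell_act h (fine.cell_act h' c) = fine.cell_act (ad h h') c"
proof (rule extensionalityI[of _ "{..<q}"])
  show "fine.cell_act h (fine.cell_act h' c) t = fine.cell_act (ad h h') c t" if "t \<in> {..<q}" for t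
    using that by (simp add: fine.cell_act_def star_act_def grid_act_def dig_add_assoc[OF p_pos])
qed (simp_all add: fine.cell_act_def)

text \<open>Independent choices at all cells need not be equivariant. So a preferred box is chosen
  only at the translate \<open>base i c\<close>, whose reference label is 0 and which is the same
  for the whole orbit, and is carried back to c by translation.\<close>

lemma preferred_flag:
  assumes act: "\<And>h i c b. h < q \<Longrightarrow> i < q \<Longrightarrow> c \<in> fine.outer_cells i \<Longrightarrow> b < q \<Longrightarrow> pref i c b \<Longrightarrow>
      pref i (fine.cell_act h c) (ad h b)"
    and ex: "\<And>i c. i < q \<Longrightarrow> c \<in> fine.outer_cells i \<Longrightarrow> \<exists>b<q. pref i c b"
  obtains s l where "s \<in> PiE {..<q} fine.outer_cells" "fine.flag_weight s \<noteq> 0"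
    "bij_betw l {..<q} {..<q}" "\<And>i. i < q \<Longrightarrow> pref i (s i) (l i)"
proof -
  define base where "base i c = fine.cell_act (dig_neg p n (fine.cell_box i c)) c" for i c
  define pick where "pick i c = (SOME b. b < q \<and> pref i c b)" for i c
  define l where "l i c = ad (fine.cell_box i c) (pick i (base i c))" for i c
  have pick: "pick i c < q" "pref i c (pick i c)" if "i < q" "c \<in> fine.outer_cells i" for i c
    using someI_ex[of "\<lambda>b. b < q \<and> pref i c b"] ex[OF that] by (auto simp: pick_def)
  have base_in: "base i c \<in> fine.outer_cells i" if "i < q" "c \<in> fine.outer_cells i" for i c
    unfolding base_def using that by (intro fine.cell_act_in_outer dig_neg_lt[OF p_pos])
  have Cells: "c \<in> fine.Cells" if "c \<in> fine.outer_cells i" for i c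
    using that by (simp add: fine.outer_cells_def)
  have l_pref: "pref i c (l i c)" if i: "i < q" and c: "c \<in> fine.outer_cells i" for i c
  proof -
    have b: "fine.cell_box i c < q" by (rule fine.outer.lab0_lt[OF i c])
    have "fine.cell_act (fine.cell_box i c) (base i c) = c"
      unfolding base_def by (rule fine.cell_act_neg[OF b Cells[OF c]])
    with act[OF b i base_in[OF i c] pick[OF i base_in[OF i c]]] show ?thesis by (simp add: l_def)
  qed
  have "fine.outer.equivariant l"
    unfolding fine.outer.equivariant_def
  proof (intro allI impI ballI conjI)
    fix i c assume i: "i < q" and c: "c \<in> fine.outer_cells i"
    show "l i c < q" by (simp add: l_def ad_lt)
    fix h assume h: "h < q"
    let ?b = "fine.cell_box i c"
    have b: "?b < q" by (rule fine.outer.lab0_lt[OF i c])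
    have box: "fine.cell_box i (fine.cell_act h c) = ad h ?b" by (rule fine.outer.lab0_act[OF h i c])
    have "ad (dig_neg p n (ad h ?b)) h = dig_neg p n ?b"
    proof -
      have "ad (ad (dig_neg p n (ad h ?b)) h) ?b = 0"
        by (simp add: dig_add_assoc[OF p_pos] dig_add_neg[OF p_pos])
      moreover have "ad (dig_neg p n ?b) ?b = 0" by (rule dig_add_neg[OF p_pos])
      ultimately show ?thesis
        using dig_add_transitive[OF p_pos b] ad_lt dig_neg_lt[OF p_pos] by blast
    qed
    then have "base i (fine.cell_act h c) = base i c"
      unfolding base_def box cell_act_cell_act[OF Cells[OF c]] by simp
    then show "l i (fine.cell_act h c) = ad h (l i c)"
      unfolding l_def box by (simp add: dig_add_assoc[OF p_pos])
  qed
  from fine.exists_full_outer_flag[OF grid_count_nonzero this]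
  obtain s where s: "s \<in> PiE {..<q} fine.outer_cells" "fine.flag_weight s \<noteq> 0" "bij_betw (\<lambda>i. l i (s i)) {..<q} {..<q}"
    by blast
  have "pref i (s i) (l i (s i))" if "i < q" for i
    by (rule l_pref[OF that]) (use PiE_mem[OF s(1), of i] that in simp)
  with s that show ?thesis by blast
qed

section \<open>Fine cells as nearby points of the configuration space\<close>

definition total :: "(nat \<Rightarrow> nat \<times> grid_cell) \<Rightarrow> real" where
  "total c = (\<Sum>t<q. real (fst (c t)))"

text \<open>The radial projection of the outer boundary onto the join. First components are
  distances from the centre in half edges, so an odd value is the midpoint of its edge and the
  projected point is the barycentre of the cell. Tiles count from 1, coordinates from 0.\<close>

definition height :: "(nat \<Rightarrow> nat \<times> grid_cell) \<Rightarrow> nat \<Rightarrow> real" where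
  "height c t = real (fst (c (t - 1))) / total c"

text \<open>A leg is itself a coarse cell; its group element is a box, counted from 0.\<close>

definition allocation :: "(nat \<Rightarrow> nat \<times> grid_cell) \<Rightarrow> nat \<Rightarrow> nat" where
  "allocation c t = Suc (snd (snd (c (t - 1))))"

definition cell_point :: "(nat \<Rightarrow> nat \<times> grid_cell) \<Rightarrow> nat \<times> nat \<Rightarrow> real" where
  "cell_point c = config_point q (height c) (allocation c)"

definition translate :: "nat \<Rightarrow> nat \<Rightarrow> nat" where
  "translate h b = (if b \<in> {1..q} then Suc (ad h (b - 1)) else b)"

lemma translate_permutes: "translate h permutes {1..q}"
proof (rule bij_imp_permutes)
  have "inj_on (translate h) {1..q}"
  proof (rule inj_onI)
    fix x y assume "x \<in> {1..q}" "y \<in> {1..q}" "translate h x = translate h y"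
    then have "ad h (x - 1) = ad h (y - 1)" "x - 1 < q" "y - 1 < q" "1 \<le> x" "1 \<le> y"
      by (auto simp: translate_def)
    then show "x = y" using ad_eq_iff[of "x - 1" "y - 1" h] by simp
  qed
  moreover have "translate h ` {1..q} \<subseteq> {1..q}"
    using ad_lt[of h] by (auto simp: translate_def Suc_le_eq)
  ultimately show "bij_betw (translate h) {1..q} {1..q}"
    by (simp add: bij_betw_def endo_inj_surj)
qed (auto simp: translate_def)

text \<open>One coordinate is outermost. This keeps the denominators of the projection of order N,
  so bounded differences of coordinates become differences of order 1/N.\<close>

lemma total_ge:
  assumes "c \<in> fine.outer_cells i"
  shows "2 * real N \<le> total c"
proof -
  obtain t where t: "t < q" "fst (c t) = 2 * N"
    using assms by (auto simp: fine.outer_cells_def fine.outer_def)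
  then have "real (fst (c t)) \<le> total c"
    unfolding total_def by (intro member_le_sum) auto
  with t show ?thesis by simp
qed

lemma sum_height:
  assumes "0 < total c"
  shows "(\<Sum>t\<in>{1..q}. height c t) = 1"
proof -
  have "(\<Sum>t\<in>{1..q}. height c t) = (\<Sum>t<q. height c (Suc t))"
    by (rule sum.reindex_bij_witness[of _ Suc "\<lambda>t. t - 1"]) auto
  also have "\<dots> = total c / total c"
    unfolding height_def sum_divide_distrib[symmetric] by (simp add: total_def)
  finally show ?thesis using assms by simp
qed

lemma allocation_in:
  assumes "c \<in> fine.Cells" "t \<in> {1..q}" "fst (c (t - 1)) \<noteq> 0"
  shows "allocation c t \<in> {1..q}"
proof -
  have "t - 1 < q" using assms(2) p_pos by auto
  then have "snd (c (t - 1)) \<in> grid_cells (t - 1)"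
    using snd_star[OF cells_coordinate[OF assms(1)]] assms(3) by blast
  then show ?thesis by (simp add: grid_cells_iff allocation_def Suc_le_eq)
qed

lemma cell_point_C3:
  assumes "c \<in> fine.outer_cells i"
  shows "cell_point c \<in> C3 q"
  unfolding cell_point_def
proof (rule config_point_in_C3)
  have pos: "0 < total c" using total_ge[OF assms] N_pos by simp
  show "0 \<le> height c t" for t using pos by (simp add: height_def)
  show "(\<Sum>t\<in>{1..q}. height c t) = 1" by (rule sum_height[OF pos])
  show "is_allocation q (height c) (allocation c)"
    unfolding is_allocation_def
  proof (intro ballI impI)
    fix t assume t: "t \<in> {1..q}" and h: "0 < height c t"
    then have "fst (c (t - 1)) \<noteq> 0" by (metis height_def div_0 of_nat_0 less_irrefl)
    with t assms show "allocation c t \<in> {1..q}"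
      by (intro allocation_in) (simp_all only: fine.outer_cells_def mem_Collect_eq not_False_eq_True)
  qed
qed

lemma config_point_cong:
  assumes "\<And>t. t \<in> {1..r} \<Longrightarrow> z t = z' t" "\<And>t. t \<in> {1..r} \<Longrightarrow> z t \<noteq> 0 \<Longrightarrow> \<alpha> t = \<alpha>' t"
  shows "config_point r z \<alpha> = config_point r z' \<alpha>'"
proof
  fix v :: "nat \<times> nat"
  obtain t b where v: "v = (t, b)" by fastforce
  show "config_point r z \<alpha> v = config_point r z' \<alpha>' v"
  proof (cases "t \<in> {1..r}")
    case True
    then show ?thesis
      using assms(1)[OF True] assms(2)[OF True] by (cases "z t = 0") (simp_all add: v config_point_def)
  qed (auto simp: v config_point_def)
qed

lemma cell_point_act:
  assumes c: "c \<in> fine.outer_cells i"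
  shows "cell_point (fine.cell_act h c) = box_action (translate h) (cell_point c)"
proof -
  have C: "c \<in> fine.Cells" using c by (simp add: fine.outer_cells_def)
  have idx: "t - 1 < q" if "t \<in> {1..q}" for t using that p_pos by auto
  have "total (fine.cell_act h c) = total c"
    unfolding total_def by (rule sum.cong) (simp_all add: fine.fst_cell_act)
  then have height: "height (fine.cell_act h c) t = height c t" if "t \<in> {1..q}" for t
    using fine.fst_cell_act[OF idx[OF that]] by (simp add: height_def)
  have alloc: "allocation (fine.cell_act h c) t = (translate h \<circ> allocation c) t"
    if t: "t \<in> {1..q}" and h: "height (fine.cell_act h c) t \<noteq> 0" for t
  proof -
    have "fst (c (t - 1)) \<noteq> 0"
      using h fine.fst_cell_act[OF idx[OF t], of h c] unfolding height_def by auto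
    then show ?thesis
      using allocation_in[OF C t] idx[OF t]
      by (simp add: allocation_def translate_def fine.cell_act_def star_act_def grid_act_def)
  qed
  show ?thesis
    unfolding cell_point_def box_action_config_point[OF translate_permutes]
    by (rule config_point_cong[OF height alloc])
qed

lemma close_quotients:
  fixes a b A B :: real
  assumes "\<bar>a - b\<bar> \<le> 1" "\<bar>A - B\<bar> \<le> m" "0 \<le> b" "b \<le> B" "0 < M" "M \<le> A" "M \<le> B"
  shows "\<bar>a / A - b / B\<bar> \<le> (m + 1) / M"
proof -
  have pos: "0 < A" "0 < B" using assms by linarith+
  have "a / A - b / B = (a - b) / A + b / B * ((B - A) / A)"
    using pos by (simp add: field_simps)
  then have "\<bar>a / A - b / B\<bar> \<le> \<bar>(a - b) / A\<bar> + \<bar>b / B * ((B - A) / A)\<bar>"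
    by (metis abs_triangle_ineq)
  also have "\<bar>(a - b) / A\<bar> = \<bar>a - b\<bar> / A" using pos by simp
  also have "\<bar>b / B * ((B - A) / A)\<bar> = b / B * (\<bar>A - B\<bar> / A)"
    using pos assms by (simp add: abs_mult abs_minus_commute)
  also have "\<bar>a - b\<bar> / A \<le> 1 / M"
    using assms pos by (intro frac_le) auto
  also have "b / B * (\<bar>A - B\<bar> / A) \<le> 1 * (m / M)"
    using assms pos by (intro mult_mono frac_le) auto
  finally show ?thesis by (simp add: add_divide_distrib add.commute)
qed

end

context subdivided_translations
begin

text \<open>All cells of the flag are faces of its top cell, so coordinates vary by at most half an
  edge. A leg is the same throughout except where a face has shrunk to the centre, which has no
  leg.\<close>

lemma nearby_cells:
  assumes s: "s \<in> PiE {..<q} fine.outer_cells" and w: "fine.flag_weight s \<noteq> 0"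
    and i: "i < q" and t: "t < q"
  shows "fst (s i t) = 0 \<or> snd (s i t) = snd (s (q - 1) t)"
    and "\<bar>real (fst (s i t)) - real (fst (s 0 t))\<bar> \<le> 1"
    and "fst (s i t) \<noteq> 0 \<Longrightarrow> fst (s (q - 1) t) \<noteq> 0"
proof -
  have inc: "incidence q (s i) (s (Suc i)) \<noteq> 0" if "Suc i < q" for i
    using w that by (auto simp: fine.flag_weight_def chain_weight_def)
  have chain: "s i t = s j t \<or> star_inc (s i t) (s j t) \<noteq> 0" if "i \<le> j" "j < q" for i j
    by (rule fine.chain_coordinates[of s]) (use inc that in simp_all)
  have near: "\<bar>real (fst x) - real (fst y)\<bar> \<le> 1 \<and> (fst x = 0 \<or> snd x = snd y) \<and> (fst x \<noteq> 0 \<longrightarrow> fst y \<noteq> 0)"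
    if "x = y \<or> star_inc x y \<noteq> 0" for x y :: "nat \<times> grid_cell"
    using that
  proof
    assume "star_inc x y \<noteq> 0"
    then have "odd (fst y)" "x = (Suc (fst y), snd y) \<or> x = inner_end y"
      by (auto simp: star_inc_def split: if_splits)
    then show ?thesis by (auto simp: inner_end_def elim: oddE)
  qed simp
  have "i \<le> q - 1" "q - 1 < q" using i by linarith+
  from near[OF chain[OF this]]
  show "fst (s i t) = 0 \<or> snd (s i t) = snd (s (q - 1) t)" "fst (s i t) \<noteq> 0 \<Longrightarrow> fst (s (q - 1) t) \<noteq> 0"
    by blast+
  from near[OF chain[of 0 i]] i show "\<bar>real (fst (s i t)) - real (fst (s 0 t))\<bar> \<le> 1"
    by (simp add: abs_minus_commute)
qed

text \<open>In a fully labelled flag the players prefer different boxes at nearby points.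
  Renumbering the boxes by one permutation gives player i box i at every point, and by equivariance
  the preferences follow.\<close>

lemma approximate_envy_free:
  assumes cov: "covering_preferences q D" and equi: "equivariant_preferences q D"
  shows "\<exists>x. (\<forall>i\<in>{1..q}. x i \<in> D i i) \<and>
    (\<forall>i\<in>{1..q}. \<forall>v. \<bar>x i v - x 1 v\<bar> \<le> (real q + 1) / real N)"
proof -
  define pref where "pref i c b \<longleftrightarrow> cell_point c \<in> D (Suc b) (Suc i)" for i c b
  have equiD: "box_action \<sigma> w \<in> D (\<sigma> i) j"
    if "\<sigma> permutes {1..q}" "i \<in> {1..q}" "j \<in> {1..q}" "w \<in> C3 q" "w \<in> D i j" for \<sigma> w i j
    using equi that unfolding equivariant_preferences_def by blast
  obtain s l where s: "s \<in> PiE {..<q} fine.outer_cells" and w: "fine.flag_weight s \<noteq> 0"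
    and l: "bij_betw l {..<q} {..<q}" and pref: "\<And>i. i < q \<Longrightarrow> pref i (s i) (l i)"
  proof (rule preferred_flag[of pref])
    show "pref i (fine.cell_act h c) (ad h b)"
      if "h < q" "i < q" "c \<in> fine.outer_cells i" "b < q" "pref i c b" for h i c b
    proof -
      have "translate h (Suc b) = Suc (ad h b)" using that(4) by (simp add: translate_def)
      then show ?thesis
        using equiD[OF translate_permutes, of "Suc b" "Suc i" "cell_point c" h] that cell_point_C3[OF that(3)]
          cell_point_act[OF that(3), of h] by (simp add: pref_def)
    qed
    show "\<exists>b<q. pref i c b" if i: "i < q" and c: "c \<in> fine.outer_cells i" for i c
    proof -
      have "(\<Union>b\<in>{1..q}. D b (Suc i)) = C3 q"
        using cov i unfolding covering_preferences_def by simp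
      then obtain b where b: "b \<in> {1..q}" "cell_point c \<in> D b (Suc i)"
        using cell_point_C3[OF c] by blast
      then have "b - 1 < q" "Suc (b - 1) = b" by auto
      with b show ?thesis unfolding pref_def by metis
    qed
  qed blast
  have cell: "s i \<in> fine.outer_cells i" if "i < q" for i using PiE_mem[OF s, of i] that by simp
  have q1: "q - 1 < q" using p_pos by simp
  \<comment> \<open>The box that player b prefers at the cell \<open>s (b - 1)\<close>, in the
    numbering from 1.\<close>
  define \<sigma> where "\<sigma> b = (if b \<in> {1..q} then Suc (l (b - 1)) else b)" for b
  have \<sigma>: "\<sigma> permutes {1..q}"
  proof (rule bij_imp_permutes)
    have "inj_on \<sigma> {1..q}"
    proof (rule inj_onI)
      fix a b assume "a \<in> {1..q}" "b \<in> {1..q}" "\<sigma> a = \<sigma> b"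
      then have "l (a - 1) = l (b - 1)" "a - 1 < q" "b - 1 < q" "1 \<le> a" "1 \<le> b" by (auto simp: \<sigma>_def)
      then show "a = b" using inj_onD[OF bij_betw_imp_inj_on[OF l], of "a - 1" "b - 1"] by simp
    qed
    moreover have "\<sigma> b \<in> {1..q}" if "b \<in> {1..q}" for b
    proof -
      have "b - 1 < q" using that by auto
      then have "l (b - 1) < q" using l by (auto simp: bij_betw_def)
      then show ?thesis using that by (simp add: \<sigma>_def)
    qed
    then have "\<sigma> ` {1..q} \<subseteq> {1..q}" by blast
    ultimately show "bij_betw \<sigma> {1..q} {1..q}"
      unfolding bij_betw_def using endo_inj_surj[of "{1..q}" \<sigma>] by blast
  qed (auto simp: \<sigma>_def)
  define \<tau> where "\<tau> = inv \<sigma>"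
  have \<tau>: "\<tau> permutes {1..q}" unfolding \<tau>_def by (rule permutes_inv[OF \<sigma>])
  \<comment> \<open>The top cell has a leg wherever one of its faces has one, and the same one. So a
    single allocation serves all points of the flag, and they differ only in the lengths of the
    tiles.\<close>
  define \<alpha> where "\<alpha> t = \<tau> (allocation (s (q - 1)) t)" for t
  define x where "x i = config_point q (height (s (i - 1))) \<alpha>" for i
  have "x i \<in> D i i" if i: "i \<in> {1..q}" for i
  proof -
    have i1: "i - 1 < q" and Si: "Suc (i - 1) = i" using i by auto
    have "cell_point (s (i - 1)) \<in> D (\<sigma> i) i"
      using pref[OF i1] i by (simp add: pref_def \<sigma>_def Si)
    moreover have "\<sigma> i \<in> {1..q}" using permutes_in_image[OF \<sigma>] i by blast
    ultimately have "box_action \<tau> (cell_point (s (i - 1))) \<in> D (\<tau> (\<sigma> i)) i"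
      using equiD[OF \<tau> _ i cell_point_C3[OF cell[OF i1]]] by blast
    moreover have "\<tau> (\<sigma> i) = i" unfolding \<tau>_def by (rule permutes_inverses(2)[OF \<sigma>])
    moreover have "box_action \<tau> (cell_point (s (i - 1))) = x i"
      unfolding cell_point_def box_action_config_point[OF \<tau>] x_def
    proof (rule config_point_cong)
      fix t assume t: "t \<in> {1..q}" and "height (s (i - 1)) t \<noteq> 0"
      then have nz: "fst (s (i - 1) (t - 1)) \<noteq> 0" by (auto simp: height_def)
      have t1: "t - 1 < q" using t by auto
      have "snd (s (i - 1) (t - 1)) = snd (s (q - 1) (t - 1))"
        using nz nearby_cells(1)[OF s w i1 t1] by simp
      then show "(\<tau> \<circ> allocation (s (i - 1))) t = \<alpha> t"
        by (simp add: \<alpha>_def allocation_def)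
    qed simp
    ultimately show ?thesis by simp
  qed
  moreover have "\<bar>x i v - x 1 v\<bar> \<le> (real q + 1) / real N" if i: "i \<in> {1..q}" for i v
  proof -
    obtain t b where v: "v = (t, b)" by fastforce
    show ?thesis
    proof (cases "t \<in> {1..q} \<and> b = \<alpha> t")
      case True
      have i1: "i - 1 < q" and t1: "t - 1 < q" using i True by auto
      have q0: "0 < q" using p_pos by simp
      have "\<bar>total (s (i - 1)) - total (s 0)\<bar> \<le> (\<Sum>t<q. \<bar>real (fst (s (i - 1) t)) - real (fst (s 0 t))\<bar>)"
        unfolding total_def sum_subtractf[symmetric] by (rule sum_abs)
      also have "\<dots> \<le> (\<Sum>t<q. 1)"
        by (rule sum_mono) (use nearby_cells(2)[OF s w i1] in simp)
      finally have tot: "\<bar>total (s (i - 1)) - total (s 0)\<bar> \<le> real q" by simp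
      have "\<bar>real (fst (s (i - 1) (t - 1))) / total (s (i - 1)) - real (fst (s 0 (t - 1))) / total (s 0)\<bar>
          \<le> (real q + 1) / real N"
      proof (rule close_quotients[OF nearby_cells(2)[OF s w i1 t1] tot])
        show "real (fst (s 0 (t - 1))) \<le> total (s 0)"
          unfolding total_def by (rule member_le_sum) (use t1 in auto)
        show "real N \<le> total (s (i - 1))" "real N \<le> total (s 0)"
          using total_ge[OF cell[OF i1]] total_ge[OF cell[OF q0]] by linarith+
      qed (use N_pos in simp_all)
      then show ?thesis
        using True by (simp add: v x_def config_point_def height_def)
    next
      case False
      then have "x i v = 0" "x 1 v = 0" by (auto simp: v x_def config_point_def)
      then show ?thesis using N_pos by simp
    qed
  qed
  ultimately show ?thesis by blast
qed

end

theorem theorem5p1: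
  fixes r :: nat and D :: "nat \<Rightarrow> nat \<Rightarrow> (nat \<times> nat \<Rightarrow> real) set"
  assumes "primepow r"
    and "closed_preferences r D"
    and "covering_preferences r D"
    and "equivariant_preferences r D"
  shows "(\<Inter>i\<in>{1..r}. D i i) \<noteq> {} \<and>
         (\<exists>x \<alpha>. is_cut r x \<and> is_allocation r (tile_length x) \<alpha> \<and>
            (\<forall>j\<in>{1..r}. config_point r (tile_length x) \<alpha> \<in> D j j))"
proof -
  obtain p n where pn: "prime p" "0 < n" "r = p ^ n"
    using assms(1) unfolding primepow_def by blast
  have "\<exists>w\<in>C3 r. \<forall>i\<in>{1..r}. w \<in> D i i"
  proof (rule envy_free_limit[OF assms(2)])
    show "0 < r" using pn by (simp add: prime_gt_0_nat)
    fix e :: real assume e: "0 < e"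
    obtain N :: nat where N: "(real r + 1) / e < real N"
      using reals_Archimedean2 by blast
    moreover have "0 < (real r + 1) / e" using e by simp
    ultimately have "0 < N" by (metis less_trans of_nat_0_less_iff)
    then interpret subdivided_translations p n N
      using pn by unfold_locales
    have le: "(real r + 1) / real N \<le> e"
      using N e \<open>0 < N\<close> by (simp add: field_simps)
    obtain x where "\<forall>i\<in>{1..r}. x i \<in> D i i" "\<forall>i\<in>{1..r}. \<forall>v. \<bar>x i v - x 1 v\<bar> \<le> (real r + 1) / real N"
      using approximate_envy_free[of D] assms(3,4) unfolding pn(3) by blast
    with le show "\<exists>x. (\<forall>i\<in>{1..r}. x i \<in> D i i) \<and> (\<forall>i\<in>{1..r}. \<forall>v. \<bar>x i v - x 1 v\<bar> \<le> e)"
      by (meson order_trans)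
  qed
  then obtain w where w: "w \<in> C3 r" "\<And>i. i \<in> {1..r} \<Longrightarrow> w \<in> D i i" by blast
  obtain x \<alpha> where x: "w = config_point r (tile_length x) \<alpha>" "is_cut r x" "is_allocation r (tile_length x) \<alpha>"
    using w(1) unfolding C3_eq_cuts_with_allocations by blast
  have "w \<in> (\<Inter>i\<in>{1..r}. D i i)" using w(2) by blast
  then show ?thesis using x w(2) by blast
qed

end
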